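(* Let $\bar A=(A_0,A_1)$ be a compatible couple of (quasi-)Banach spaces with $A_0\cap A_1\neq\{0\}$. Let $0<q_1,r_1\le\infty$ and $a_1,b_1\in SV$ be such that $\|s^{-1/r_1}b_1(s)\|_{r_1,(1,\infty)}<\infty$ and $\left\|s^{-1/r_1}b_1(s)\|u^{-1/q_1}a_1(u)\|_{q_1,(0,s)}\right\|_{r_1,(0,1)}<\infty$, and put $$\chi_1(t)=\left\|s^{-1/r_1}b_1(s)\|u^{-1/q_1}a_1(u)\|_{q_1,(0,s)}\right\|_{r_1,(0,t)}+\|s^{-1/r_1}b_1(s)\|_{r_1,(t,\infty)}\|u^{-1/q_1}a_1(u)\|_{q_1,(0,t)}.$$ Let $0<\theta_0<1$, $0<r_0,q_0\le\infty$, $a_0,b_0\in SV$, and $\|s^{-1/r_0}b_0(s)\|_{r_0,(0,1)}<\infty$. Put $\chi_0(t)=a_0(t)\|s^{-1/r_0}b_0(s)\|_{r_0,(0,t)}$ and $\rho(t)=t^{1-\theta_0}\frac{\chi_0(t)}{\chi_1(t)}$. Then, for all $f\in\bar A^{\mathcal R}_{\theta_0,r_0,b_0,q_0,a_0}+\bar A^{\mathcal L}_{1,r_1,b_1,q_1,a_1}$ and $t>0$, $$\begin{aligned}K\left(\rho(t),f;\bar A^{\mathcal R}_{\theta_0,r_0,b_0,q_0,a_0},\bar A^{\mathcal L}_{1,r_1,b_1,q_1,a_1}\right)\approx{}&\left\|s^{-1/r_0}b_0(s)\|u^{-\theta_0-1/q_0}a_0(u)K(u,f)\|_{q_0,(s,t)}\right\|_{r_0,(0,t)}\\&+\rho(t)\left\|s^{-1/r_1}b_1(s)\|u^{-1-1/q_1}a_1(u)K(u,f)\|_{q_1,(t,s)}\right\|_{r_1,(t,\infty)},\end{aligned}$$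 with equivalence constants independent of $f$ and $t$.
   Context: Conventions: $1/\infty=0$; $\|\cdot\|_{q,(a,b)}$ is the usual (quasi-)norm of $L_q$ on the interval $(a,b)$, $0<q\le\infty$. $F\approx G$ means $C^{-1}G\le F\le CG$ for some constant $C>0$ independent of all significant quantities. $b\in SV$ (slowly varying) means that $b$ is a positive Lebesgue measurable function on $(0,\infty)$ such that for each $\varepsilon>0$ the function $t^{\varepsilon}b(t)$ is equivalent ($\approx$) to an increasing function and $t^{-\varepsilon}b(t)$ is equivalent to a decreasing function. For a compatible couple $(X_0,X_1)$ of (quasi-)normed spaces, $K(t,f;X_0,X_1)=\inf\{\|f_0\|_{X_0}+t\|f_1\|_{X_1}: f=f_0+f_1,\ f_i\in X_i\}$ for $f\in X_0+X_1$, $t>0$; $K(t,f):=K(t,f;A_0,A_1)$. For $0\le\theta\le1$, $0<r,q\le\infty$, $a,b\in SV$, the following are the spaces of all $f\in A_0+A_1$ with finite (quasi-)norm: $\bar A^{\mathcal L}_{\theta,r,b,q,a}$: $\left\|t^{-1/r}b(t)\|u^{-\theta-1/q}a(u)K(u,f)\|_{q,(0,t)}\right\|_{r,(0,\infty)}$; $\bar A^{\mathcal R}_{\theta,r,b,q,a}$: $\left\|t^{-1/r}b(t)\|u^{-\theta-1/q}a(u)K(u,f)\|_{q,(t,\infty)}\right\|_{r,(0,\infty)}$. Standing assumption: none of the spaces under consideration is $\{0\}$. *)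

theory Defs
  imports "HOL-Probability.Essential_Supremum"
begin

section \<open>Quasi-norms of Lebesgue spaces and slowly varying functions\<close>

text \<open>Exponents range over \<open>(0, \<infinity>]\<close> and are modelled in \<^typ>\<open>ennreal\<close>; the reciprocal is the
  real number \<open>1 / q\<close> with \<open>1 / \<infinity> = 0\<close>.\<close>

definition rcp :: "ennreal \<Rightarrow> real" where
  "rcp q = enn2real (1 / q)"

text \<open>Only used with exponents \<open>p > 0\<close>.\<close>

definition epowr :: "ennreal \<Rightarrow> real \<Rightarrow> ennreal" where
  "epowr x p = (if x = top then top else ennreal (enn2real x powr p))"

text \<open>Quasi-norm of \<open>L\<^sub>q(I)\<close>, for functions with values in \<open>[0, \<infinity>]\<close>.\<close>

definition Lnorm :: "ennreal \<Rightarrow> real set \<Rightarrow> (real \<Rightarrow> ennreal) \<Rightarrow> ennreal" where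
  "Lnorm q I g =
     (if q = top then esssup (lebesgue_on I) g
      else epowr (\<integral>\<^sup>+ x. epowr (g x) (enn2real q) \<partial>lebesgue_on I) (rcp q))"

text \<open>The function \<open>s \<mapsto> s\<^bsup>-1/r\<^esup> b(s)\<close>.\<close>

definition wt :: "ennreal \<Rightarrow> (real \<Rightarrow> real) \<Rightarrow> real \<Rightarrow> ennreal" where
  "wt r b s = ennreal (s powr (- rcp r) * b s)"

text \<open>The iterated quasi-norm \<open>\<parallel> s\<^bsup>-1/r\<^esup> b(s) \<parallel>g\<parallel>\<^bsub>q, J(s)\<^esub> \<parallel>\<^bsub>r, I\<^esub>\<close>.\<close>

definition iter_norm ::
  "ennreal \<Rightarrow> (real \<Rightarrow> real) \<Rightarrow> real set \<Rightarrow> ennreal \<Rightarrow> (real \<Rightarrow> real set) \<Rightarrow> (real \<Rightarrow> ennreal) \<Rightarrow> ennreal"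
where
  "iter_norm r b I q J g =
     Lnorm r I (\<lambda>s. wt r b s * Lnorm q (J s) g)"

definition equiv_on :: "'a set \<Rightarrow> ('a \<Rightarrow> real) \<Rightarrow> ('a \<Rightarrow> real) \<Rightarrow> bool" where
  "equiv_on S F G \<longleftrightarrow> (\<exists>C>0. \<forall>x\<in>S. G x / C \<le> F x \<and> F x \<le> C * G x)"

definition slowly_varying :: "(real \<Rightarrow> real) \<Rightarrow> bool" where
  "slowly_varying b \<longleftrightarrow>
     (\<forall>t>0. b t > 0) \<and>
     b \<in> borel_measurable (lebesgue_on {0<..}) \<and>
     (\<forall>\<epsilon>>0.
        (\<exists>g. mono_on {0<..} g \<and> equiv_on {0<..} (\<lambda>t. t powr \<epsilon> * b t) g) \<and>
        (\<exists>h. antimono_on {0<..} h \<and> equiv_on {0<..} (\<lambda>t. t powr (- \<epsilon>) * b t) h))"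


section \<open>Compatible couples of quasi-Banach spaces\<close>

text \<open>All spaces are linear subspaces of one ambient real vector space. Complex spaces are covered by
  restriction of scalars, since the \<open>K\<close>-functional does not involve the scalars. The value of
  \<open>qnorm\<close> outside \<open>carr\<close> is irrelevant.\<close>

record 'v qspace =
  carr :: "'v set"
  qnorm :: "'v \<Rightarrow> ennreal"

definition quasi_normed :: "'v::real_vector qspace \<Rightarrow> bool" where
  "quasi_normed X \<longleftrightarrow>
     subspace (carr X) \<and>
     (\<forall>x\<in>carr X. qnorm X x < top) \<and>
     (\<forall>x\<in>carr X. qnorm X x = 0 \<longleftrightarrow> x = 0) \<and>
     (\<forall>c. \<forall>x\<in>carr X. qnorm X (c *\<^sub>R x) = ennreal \<bar>c\<bar> * qnorm X x) \<and>
     (\<exists>C::real. C \<ge> 1 \<and>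
        (\<forall>x\<in>carr X. \<forall>y\<in>carr X. qnorm X (x + y) \<le> ennreal C * (qnorm X x + qnorm X y)))"

definition quasi_banach :: "'v::real_vector qspace \<Rightarrow> bool" where
  "quasi_banach X \<longleftrightarrow>
     quasi_normed X \<and>
     (\<forall>x :: nat \<Rightarrow> 'v.
        (\<forall>n. x n \<in> carr X) \<and> (\<forall>e>0. \<exists>N. \<forall>m\<ge>N. \<forall>n\<ge>N. qnorm X (x m - x n) < e)
        \<longrightarrow> (\<exists>l\<in>carr X. (\<lambda>n. qnorm X (x n - l)) \<longlonglongrightarrow> 0))"

definition hausdorff_tvs :: "'v::real_vector topology \<Rightarrow> bool" where
  "hausdorff_tvs T \<longleftrightarrow>
     topspace T = UNIV \<and>
     Hausdorff_space T \<and>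
     continuous_map (prod_topology T T) T (\<lambda>(x, y). x + y) \<and>
     continuous_map (prod_topology euclideanreal T) T (\<lambda>(c, x). c *\<^sub>R x)"

text \<open>Continuity of the inclusion of \<open>X\<close>, with the topology induced by its quasi-norm, into \<open>T\<close>.
  Quasi-norm balls need not be open, so a set is open for the quasi-norm iff it contains a ball
  around each of its points.\<close>

definition embedded_in :: "'v::real_vector qspace \<Rightarrow> 'v topology \<Rightarrow> bool" where
  "embedded_in X T \<longleftrightarrow>
     (\<forall>U. openin T U \<longrightarrow>
        (\<forall>x\<in>carr X \<inter> U. \<exists>e>0. \<forall>y\<in>carr X. qnorm X (y - x) < e \<longrightarrow> y \<in> U))"

definition compatible_couple :: "'v::real_vector qspace \<Rightarrow> 'v qspace \<Rightarrow> bool" where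
  "compatible_couple X0 X1 \<longleftrightarrow>
     quasi_banach X0 \<and> quasi_banach X1 \<and>
     (\<exists>T. hausdorff_tvs T \<and> embedded_in X0 T \<and> embedded_in X1 T)"


section \<open>The \<open>K\<close>-functional and the limiting interpolation spaces\<close>

text \<open>The parameter \<open>t\<close> is extended to \<^typ>\<open>ennreal\<close> only because the function \<open>rho\<close> below is
  \<^typ>\<open>ennreal\<close>-valued; the relevant values lie in \<open>(0, \<infinity>)\<close>.\<close>

definition K_functional ::
  "'v::real_vector qspace \<Rightarrow> 'v qspace \<Rightarrow> ennreal \<Rightarrow> 'v \<Rightarrow> ennreal"
where
  "K_functional X0 X1 t f =
     Inf {qnorm X0 f0 + t * qnorm X1 f1 | f0 f1. f0 \<in> carr X0 \<and> f1 \<in> carr X1 \<and> f = f0 + f1}"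

text \<open>The function \<open>u \<mapsto> u\<^bsup>-\<theta>-1/q\<^esup> a(u) K(u, f)\<close>.\<close>

definition K_weighted ::
  "'v::real_vector qspace \<Rightarrow> 'v qspace \<Rightarrow> real \<Rightarrow> ennreal \<Rightarrow> (real \<Rightarrow> real) \<Rightarrow> 'v \<Rightarrow> real \<Rightarrow> ennreal"
where
  "K_weighted A0 A1 \<theta> q a f u =
     ennreal (u powr (- \<theta> - rcp q) * a u) * K_functional A0 A1 (ennreal u) f"

definition L_norm ::
  "'v::real_vector qspace \<Rightarrow> 'v qspace \<Rightarrow> real \<Rightarrow> ennreal \<Rightarrow> (real \<Rightarrow> real) \<Rightarrow> ennreal \<Rightarrow> (real \<Rightarrow> real)
    \<Rightarrow> 'v \<Rightarrow> ennreal"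
where
  "L_norm A0 A1 \<theta> r b q a f =
     iter_norm r b {0<..} q (\<lambda>t. {0<..<t}) (K_weighted A0 A1 \<theta> q a f)"

definition R_norm ::
  "'v::real_vector qspace \<Rightarrow> 'v qspace \<Rightarrow> real \<Rightarrow> ennreal \<Rightarrow> (real \<Rightarrow> real) \<Rightarrow> ennreal \<Rightarrow> (real \<Rightarrow> real)
    \<Rightarrow> 'v \<Rightarrow> ennreal"
where
  "R_norm A0 A1 \<theta> r b q a f =
     iter_norm r b {0<..} q (\<lambda>t. {t<..}) (K_weighted A0 A1 \<theta> q a f)"

definition L_space ::
  "'v::real_vector qspace \<Rightarrow> 'v qspace \<Rightarrow> real \<Rightarrow> ennreal \<Rightarrow> (real \<Rightarrow> real) \<Rightarrow> ennreal \<Rightarrow> (real \<Rightarrow> real)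
    \<Rightarrow> 'v qspace"
where
  "L_space A0 A1 \<theta> r b q a =
     \<lparr> carr = {f \<in> carr A0 + carr A1. L_norm A0 A1 \<theta> r b q a f < top},
       qnorm = L_norm A0 A1 \<theta> r b q a \<rparr>"

definition R_space ::
  "'v::real_vector qspace \<Rightarrow> 'v qspace \<Rightarrow> real \<Rightarrow> ennreal \<Rightarrow> (real \<Rightarrow> real) \<Rightarrow> ennreal \<Rightarrow> (real \<Rightarrow> real)
    \<Rightarrow> 'v qspace"
where
  "R_space A0 A1 \<theta> r b q a =
     \<lparr> carr = {f \<in> carr A0 + carr A1. R_norm A0 A1 \<theta> r b q a f < top},
       qnorm = R_norm A0 A1 \<theta> r b q a \<rparr>"


section \<open>Auxiliary functions of the Holmstedt-type formula\<close>

definition chi0 :: "ennreal \<Rightarrow> (real \<Rightarrow> real) \<Rightarrow> (real \<Rightarrow> real) \<Rightarrow> real \<Rightarrow> ennreal" where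
  "chi0 r b a t = ennreal (a t) * Lnorm r {0<..<t} (wt r b)"

definition chi1 ::
  "ennreal \<Rightarrow> (real \<Rightarrow> real) \<Rightarrow> ennreal \<Rightarrow> (real \<Rightarrow> real) \<Rightarrow> real \<Rightarrow> ennreal"
where
  "chi1 r b q a t =
     iter_norm r b {0<..<t} q (\<lambda>s. {0<..<s}) (wt q a)
     + Lnorm r {t<..} (wt r b) * Lnorm q {0<..<t} (wt q a)"

definition rho ::
  "real \<Rightarrow> ennreal \<Rightarrow> (real \<Rightarrow> real) \<Rightarrow> (real \<Rightarrow> real) \<Rightarrow>
   ennreal \<Rightarrow> (real \<Rightarrow> real) \<Rightarrow> ennreal \<Rightarrow> (real \<Rightarrow> real) \<Rightarrow> real \<Rightarrow> ennreal"
where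
  "rho \<theta>0 r0 b0 a0 r1 b1 q1 a1 t =
     ennreal (t powr (1 - \<theta>0)) * (chi0 r0 b0 a0 t / chi1 r1 b1 q1 a1 t)"

end

theory Submission
  imports Defs
begin

text \<open>
  The proof follows Holmstedt's pattern. Write \<open>k f u\<close> for \<open>K(u, f; A\<^sub>0, A\<^sub>1)\<close>. As a function of
  \<open>u\<close> it increases while \<open>k f u / u\<close> decreases, and, up to a constant, it is subadditive in \<open>f\<close>. Both
  limiting spaces see \<open>f\<close> only through \<open>k f\<close>, so everything about them is a weighted inequality for
  such functions. The measure behind all norms is \<open>du/u\<close>: the powers \<open>u\<^bsup>-1/q\<^esup>\<close> in the definitions
  are its densities. It is invariant under dilations, and a slowly varying function changes under
  dilation by \<open>l\<close> at most by the factor \<open>C l\<^bsup>\<epsilon>\<^esup>\<close>; hence every auxiliary function built by taking norms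
  of slowly varying functions over \<open>(0, t)\<close> or \<open>(t, \<infinity>)\<close>, in particular \<open>\<chi>\<^sub>0\<close> and \<open>\<chi>\<^sub>1\<close>, is
  again slowly varying in this sense, and a norm of \<open>u\<^bsup>\<alpha>\<^esup> F(u)\<close> over \<open>(0, t)\<close> with \<open>\<alpha> > 0\<close>, or
  over \<open>(t, \<infinity>)\<close> with \<open>\<alpha> < 0\<close>, is controlled by the value at the end point \<open>t\<close>.

  Lower bound for the \<open>K\<close>-functional. Let \<open>f = g + h\<close> with \<open>g\<close> in the \<open>R\<close>-space and \<open>h\<close> in the
  \<open>L\<close>-space. Monotonicity gives \<open>k g u \<le> C u\<^bsup>\<theta>\<^esup> / \<chi>\<^sub>0(u) \<cdot> \<parallel>g\<parallel>\<close> and \<open>k h u \<le> 2 u / \<chi>\<^sub>1(u) \<cdot> \<parallel>h\<parallel>\<close>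
  (\<open>Chi0_mult_le_norm_R\<close>, \<open>Chi1_mult_le_norm_L\<close>). These bounds are inserted into the truncated norm
  that does not belong to the space: the integrand becomes a power with an exponent of the good sign
  times a slowly varying function, and the end point rule bounds the truncated \<open>R\<close>-norm of \<open>h\<close> by
  \<open>C \<rho>(t) \<parallel>h\<parallel>\<close> and the truncated \<open>L\<close>-norm of \<open>g\<close> by \<open>C \<parallel>g\<parallel> / \<rho>(t)\<close> (\<open>trunc_R_le_norm_L\<close>,
  \<open>trunc_L_le_norm_R\<close>). This is where \<open>\<theta> < 1\<close> enters.

  Upper bound. Take \<open>f = g + h\<close> nearly optimal for \<open>K(t, f; A\<^sub>0, A\<^sub>1)\<close>. Then \<open>k g\<close> is bounded by
  \<open>k f\<close> on \<open>(0, t)\<close> and by the constant \<open>k f t\<close> beyond, while \<open>k h\<close> is bounded by \<open>k f\<close> beyond \<open>t\<close>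
  and by the linear function \<open>u k f t / t\<close> before (\<open>near_optimal_decomposition\<close>). So the norms of
  \<open>g\<close> and \<open>h\<close> are bounded by the truncated norms of \<open>f\<close>, plus terms in which only the number
  \<open>k f t\<close> appears (\<open>norm_R_le_trunc_R\<close>, \<open>norm_L_le_trunc_L\<close>). With the factor \<open>\<rho>(t)\<close> on the second,
  both extra terms are \<open>t\<^bsup>-\<theta>\<^esup> \<chi>\<^sub>0(t) k f t\<close>: this is what dictates \<open>\<rho>\<close>. They are absorbed
  by the truncated \<open>R\<close>-norm, because \<open>k f\<close> is at least half of \<open>k f t\<close> on \<open>(t/2, t)\<close>
  (\<open>Chi0_mult_le_trunc_R\<close>).
\<close>

section \<open>Lebesgue quasi-norms for the dilation invariant measure\<close>

abbreviation pos_measurable :: "(real \<Rightarrow> ennreal) \<Rightarrow> bool" where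
  "pos_measurable f \<equiv> f \<in> borel_measurable (lebesgue_on {0<..})"

lemma rcp_top: "rcp top = 0"
  by (simp add: rcp_def)

lemma rcp_ennreal: "p > 0 \<Longrightarrow> rcp (ennreal p) = 1 / p"
  by (simp add: rcp_def divide_ennreal flip: ennreal_1)

lemma epowr_ennreal: "x \<ge> 0 \<Longrightarrow> epowr (ennreal x) p = ennreal (x powr p)"
  by (simp add: epowr_def)

lemma epowr_mult: "p > 0 \<Longrightarrow> epowr (x * y) p = epowr x p * epowr y p"
  by (cases x; cases y)
    (auto simp: epowr_def ennreal_mult_eq_top_iff enn2real_mult powr_mult ennreal_mult' ennreal_mult_top ennreal_top_mult)

lemma epowr_mono: "p > 0 \<Longrightarrow> x \<le> y \<Longrightarrow> epowr x p \<le> epowr y p"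
  by (cases x; cases y) (auto simp: epowr_def powr_mono2 top_unique)

lemma epowr_epowr: "p > 0 \<Longrightarrow> epowr (epowr x p) (1 / p) = x"
  by (cases x) (auto simp: epowr_def powr_powr)

lemma epowr_0: "epowr 0 p = 0"
  by (simp add: epowr_def)

lemma epowr_measurable [measurable]: "p > 0 \<Longrightarrow> (\<lambda>x. epowr x p) \<in> borel_measurable borel"
  unfolding epowr_def by measurable

text \<open>Comparison with the larger of the two arguments; it serves all exponents at once, at the price
  of a constant for exponents where the power would be subadditive.\<close>

lemma epowr_add:
  assumes "p > 0" shows "epowr (x + y) p \<le> ennreal (2 powr p) * (epowr x p + epowr y p)"
proof -
  have "x + y \<le> 2 * max x y" by (simp add: mult_2 add_mono)
  then have "epowr (x + y) p \<le> epowr (ennreal 2 * max x y) p" by (intro epowr_mono assms) simp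
  also have "\<dots> = ennreal (2 powr p) * epowr (max x y) p" using assms by (simp add: epowr_mult epowr_ennreal del: ennreal_numeral)
  also have "epowr (max x y) p \<le> epowr x p + epowr y p" by (auto simp: max_def)
  finally show ?thesis by (simp add: mult_left_mono)
qed

text \<open>The quasi-norm of \<open>L\<^sub>q(I, du/u)\<close>. The density \<open>1/u\<close> sits inside \<^const>\<open>Lnorm\<close> as the
  factor \<open>u\<^bsup>-1/q\<^esup>\<close>, so that one formula also covers \<open>q = \<infinity>\<close>, where that factor is \<open>1\<close>.\<close>

definition hnorm :: "ennreal \<Rightarrow> real set \<Rightarrow> (real \<Rightarrow> ennreal) \<Rightarrow> ennreal" where
  "hnorm q I f = Lnorm q I (\<lambda>u. ennreal (u powr - rcp q) * f u)"

lemma pos_measurable_restrict: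
  assumes "pos_measurable f" "I \<subseteq> {0<..}" "I \<in> sets borel"
  shows "f \<in> borel_measurable (lebesgue_on I)"
    "(\<lambda>u. f u * indicator I u) \<in> borel_measurable lebesgue"
proof -
  show 1: "f \<in> borel_measurable (lebesgue_on I)"
    using assms by (metis measurable_restrict_mono)
  show "(\<lambda>u. f u * indicator I u) \<in> borel_measurable lebesgue"
    using 1 assms(3) by (subst (asm) borel_measurable_restrict_space_iff_ennreal) auto
qed

lemma hnorm_finite:
  assumes "p > 0" "I \<subseteq> {0<..}" "I \<in> sets borel"
  shows "hnorm (ennreal p) I f
    = epowr (\<integral>\<^sup>+u. ennreal (1 / u) * epowr (f u) p * indicator I u \<partial>lebesgue) (1 / p)"
proof -
  have "epowr (ennreal (u powr - (1 / p)) * f u) p = ennreal (1 / u) * epowr (f u) p" if "u \<in> I" for u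
  proof -
    have "u > 0" using that assms by auto
    then have "(u powr - (1 / p)) powr p = 1 / u" using assms by (subst powr_powr) (simp add: powr_minus_divide)
    then show ?thesis using assms by (simp add: epowr_mult epowr_ennreal)
  qed
  then show ?thesis using assms
    by (simp add: hnorm_def Lnorm_def rcp_ennreal nn_integral_restrict_space)
       (intro arg_cong[where f="\<lambda>x. epowr x _"] nn_integral_cong, auto simp: indicator_def)
qed

text \<open>For \<open>q = \<infinity>\<close> the norm is used only through its upper bounds. Measurability
  matters here: the essential supremum of a non-measurable function is \<open>\<infinity>\<close> by convention.\<close>

lemma hnorm_top_le_iff:
  assumes "pos_measurable f" "I \<subseteq> {0<..}" "I \<in> sets borel"
  shows "hnorm top I f \<le> c \<longleftrightarrow> (AE u in lebesgue. u \<in> I \<longrightarrow> f u \<le> c)"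
proof -
  have m: "f \<in> borel_measurable (lebesgue_on I)" using pos_measurable_restrict assms by blast
  let ?g = "\<lambda>u. ennreal (u powr - rcp top) * f u"
  have g: "?g u = f u" if "u \<in> I" for u using that assms by (auto simp: rcp_top)
  have mg: "?g \<in> borel_measurable (lebesgue_on I)"
    using m measurable_cong[of "lebesgue_on I" ?g f] g by (simp del: times_ennreal.rep_eq)
  have "hnorm top I f \<le> c \<longleftrightarrow> (AE u in lebesgue_on I. ?g u \<le> c)"
  proof
    assume "hnorm top I f \<le> c"
    then have c: "esssup (lebesgue_on I) ?g \<le> c" by (simp add: hnorm_def Lnorm_def)
    show "AE u in lebesgue_on I. ?g u \<le> c"
      by (rule eventually_mono[OF esssup_AE[of ?g "lebesgue_on I"]]) (rule order_trans[OF _ c])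
  next
    assume "AE u in lebesgue_on I. ?g u \<le> c"
    from esssup_I[OF mg this] show "hnorm top I f \<le> c" by (simp add: hnorm_def Lnorm_def)
  qed
  also have "\<dots> \<longleftrightarrow> (AE u in lebesgue. u \<in> I \<longrightarrow> ?g u \<le> c)"
    using assms by (subst AE_restrict_space_iff) auto
  also have "\<dots> \<longleftrightarrow> (AE u in lebesgue. u \<in> I \<longrightarrow> f u \<le> c)"
    by (rule AE_cong) (simp only: g cong: imp_cong)
  finally show ?thesis .
qed

lemma exponent_cases:
  assumes "0 < (q::ennreal)" obtains "q = top" | p where "p > 0" "q = ennreal p"
  using assms by (cases q) auto

lemma AE_lebesgue_neq: "AE u in lebesgue. u \<noteq> (t::real)"
  by (simp add: AE_completion AE_lborel_singleton)

text \<open>The exceptional point \<open>t\<close> lets an interval be cut at \<open>t\<close> into two open intervals.\<close>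

lemma hnorm_mono_except:
  assumes "0 < q" "pos_measurable f" "pos_measurable g" "I \<subseteq> {0<..}" "I \<in> sets borel"
    and le: "\<And>u. u \<in> I \<Longrightarrow> u \<noteq> t \<Longrightarrow> f u \<le> g u"
  shows "hnorm q I f \<le> hnorm q I g"
  using assms(1)
proof (cases rule: exponent_cases)
  case 1
  have "AE u in lebesgue. u \<in> I \<longrightarrow> g u \<le> hnorm top I g"
    using hnorm_top_le_iff[OF assms(3-5)] by blast
  then have "AE u in lebesgue. u \<in> I \<longrightarrow> f u \<le> hnorm top I g"
    using AE_lebesgue_neq[of t]
    by eventually_elim (use le in \<open>blast intro: order_trans\<close>)
  then show ?thesis using hnorm_top_le_iff[OF assms(2,4,5)] 1 by blast
next
  case (2 p)
  have "(\<integral>\<^sup>+u. ennreal (1 / u) * epowr (f u) p * indicator I u \<partial>lebesgue)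
     \<le> (\<integral>\<^sup>+u. ennreal (1 / u) * epowr (g u) p * indicator I u \<partial>lebesgue)"
    by (rule nn_integral_mono_AE, rule eventually_mono[OF AE_lebesgue_neq[of t]])
      (auto simp: indicator_def 2 intro!: mult_left_mono epowr_mono le)
  then show ?thesis using 2 assms by (simp add: hnorm_finite epowr_mono)
qed

lemma hnorm_mono:
  assumes "0 < q" "pos_measurable f" "pos_measurable g" "I \<subseteq> {0<..}" "I \<in> sets borel"
    and "\<And>u. u \<in> I \<Longrightarrow> f u \<le> g u"
  shows "hnorm q I f \<le> hnorm q I g"
  using assms by (intro hnorm_mono_except) auto

lemma hnorm_cong:
  assumes "\<And>u. u \<in> I \<Longrightarrow> f u = g u" "0 < q" "pos_measurable f" "pos_measurable g" "I \<subseteq> {0<..}" "I \<in> sets borel"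
  shows "hnorm q I f = hnorm q I g"
  using assms by (intro antisym hnorm_mono) auto

lemma hnorm_subset:
  assumes "0 < q" "pos_measurable f" "J \<subseteq> {0<..}" "I \<in> sets borel" "J \<in> sets borel" "I \<subseteq> J"
  shows "hnorm q I f \<le> hnorm q J f"
  using assms(1)
proof (cases rule: exponent_cases)
  case 1
  have "AE u in lebesgue. u \<in> J \<longrightarrow> f u \<le> hnorm top J f"
    using hnorm_top_le_iff[OF assms(2,3,5)] by blast
  then have "AE u in lebesgue. u \<in> I \<longrightarrow> f u \<le> hnorm top J f"
    by (rule eventually_mono) (use assms in blast)
  then show ?thesis using hnorm_top_le_iff[of f I] 1 assms by auto
next
  case (2 p)
  moreover have "I \<subseteq> {0<..}" using assms by auto
  ultimately show ?thesis using assms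
    by (simp add: hnorm_finite)
      (intro epowr_mono nn_integral_mono mult_left_mono, auto simp: indicator_def)
qed

text \<open>The factor may be infinite, since the bounds are later multiplied by quantities
  whose finiteness is not known in advance.\<close>

lemma hnorm_cmult:
  assumes "0 < q" "pos_measurable f" "I \<subseteq> {0<..}" "I \<in> sets borel"
  shows "hnorm q I (\<lambda>u. c * f u) = c * hnorm q I f"
  using assms(1)
proof (cases rule: exponent_cases)
  case 1
  have m: "pos_measurable (\<lambda>u. c * f u)" using assms by measurable
  note I = hnorm_top_le_iff[OF assms(2-4)] hnorm_top_le_iff[OF m assms(3,4)]
  have "AE u in lebesgue. u \<in> I \<longrightarrow> f u \<le> hnorm top I f" using I by blast
  then have "AE u in lebesgue. u \<in> I \<longrightarrow> c * f u \<le> c * hnorm top I f"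
    by (rule eventually_mono) (auto intro: mult_left_mono)
  then have 2: "hnorm top I (\<lambda>u. c * f u) \<le> c * hnorm top I f" using I by blast
  let ?z = "hnorm top I (\<lambda>u. c * f u)"
  have z: "AE u in lebesgue. u \<in> I \<longrightarrow> c * f u \<le> ?z" using I by blast
  consider "c = 0" | "?z = top" | "c = top" "?z < top" | "c \<noteq> 0" "c \<noteq> top"
    by (metis top.not_eq_extremum)
  then have "c * hnorm top I f \<le> ?z"
  proof cases
    case 3
    from z have "AE u in lebesgue. u \<in> I \<longrightarrow> f u \<le> 0"
      by (rule eventually_mono) (use 3 in \<open>auto simp: ennreal_top_mult split: if_splits simp: top_unique\<close>)
    then have "hnorm top I f \<le> 0" using I by blast
    then show ?thesis by simp
  next
    case 4
    from z have "AE u in lebesgue. u \<in> I \<longrightarrow> f u \<le> ?z / c"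
    proof (rule eventually_mono, safe)
      fix u assume "c * f u \<le> ?z"
      then have "c * f u / c \<le> ?z / c" by (rule divide_right_mono_ennreal)
      then show "f u \<le> ?z / c" using 4 by (metis ennreal_mult_divide_eq mult.commute)
    qed
    then have "hnorm top I f \<le> ?z / c" using I by blast
    then have "c * hnorm top I f \<le> c * (?z / c)" by (rule mult_left_mono) simp
    also have "c * (?z / c) = ?z" using 4
      by (metis ennreal_mult_divide_eq ennreal_times_divide mult.commute)
    finally show ?thesis .
  qed auto
  with 1 2 show ?thesis by auto
next
  case (2 p)
  have "(\<integral>\<^sup>+u. ennreal (1 / u) * epowr (c * f u) p * indicator I u \<partial>lebesgue)
     = (\<integral>\<^sup>+u. epowr c p * (ennreal (1 / u) * (epowr (f u) p * indicator I u)) \<partial>lebesgue)"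
    using 2 by (simp add: epowr_mult ac_simps)
  also have "\<dots> = epowr c p * (\<integral>\<^sup>+u. ennreal (1 / u) * (epowr (f u) p * indicator I u) \<partial>lebesgue)"
  proof (rule nn_integral_cmult)
    have [measurable]: "pos_measurable (\<lambda>u. epowr (f u) p)" 
      using measurable_compose[OF assms(2) epowr_measurable[OF 2(1)]] .
    note pos_measurable_restrict(2)[OF this assms(3,4), measurable]
    have [measurable]: "(\<lambda>u. ennreal (1 / u)) \<in> borel_measurable lebesgue"
      by (intro measurable_completion) simp
    show "(\<lambda>u. ennreal (1 / u) * (epowr (f u) p * indicator I u)) \<in> borel_measurable lebesgue"
      by measurable
  qed
  finally show ?thesis using 2 assms by (simp add: hnorm_finite epowr_mult epowr_epowr mult.assoc)
qed

lemma hnorm_add: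
  assumes "0 < q"
  obtains C where "C < top" and "\<And>f g I. pos_measurable f \<Longrightarrow> pos_measurable g \<Longrightarrow> I \<subseteq> {0<..} \<Longrightarrow> I \<in> sets borel \<Longrightarrow>
    hnorm q I (\<lambda>u. f u + g u) \<le> C * (hnorm q I f + hnorm q I g)"
  using assms(1)
proof (cases rule: exponent_cases)
  case 1
  show ?thesis
  proof (rule that[of 1])
    fix f g :: "real \<Rightarrow> ennreal" and I :: "real set" assume a: "pos_measurable f" "pos_measurable g" "I \<subseteq> {0<..}" "I \<in> sets borel"
    have m: "pos_measurable (\<lambda>u. f u + g u)" using a by measurable
    have "AE u in lebesgue. u \<in> I \<longrightarrow> f u \<le> hnorm top I f"
      "AE u in lebesgue. u \<in> I \<longrightarrow> g u \<le> hnorm top I g"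
      using hnorm_top_le_iff[OF a(1,3,4)] hnorm_top_le_iff[OF a(2,3,4)] by blast+
    then have "AE u in lebesgue. u \<in> I \<longrightarrow> f u + g u \<le> hnorm top I f + hnorm top I g"
      by eventually_elim (auto intro: add_mono)
    then show "hnorm q I (\<lambda>u. f u + g u) \<le> 1 * (hnorm q I f + hnorm q I g)"
      using hnorm_top_le_iff[OF m a(3,4)] 1 by simp
  qed simp
next
  case (2 p)
  let ?C = "epowr (ennreal (2 powr p)) (1/p) * ennreal (2 powr (1/p))"
  show ?thesis
  proof (rule that[of ?C])
    show "?C < top" by (simp add: epowr_ennreal ennreal_mult_less_top)
    fix f g :: "real \<Rightarrow> ennreal" and I :: "real set" assume a: "pos_measurable f" "pos_measurable g" "I \<subseteq> {0<..}" "I \<in> sets borel"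
    let ?N = "\<lambda>f. \<integral>\<^sup>+u. ennreal (1 / u) * (epowr (f u) p * indicator I u) \<partial>lebesgue"
    have [measurable]: "(\<lambda>u. ennreal (1 / u)) \<in> borel_measurable lebesgue"
      by (intro measurable_completion) simp
    have m: "(\<lambda>u::real. ennreal (1 / u) * (epowr (f u) p * indicator I u)) \<in> borel_measurable lebesgue"
      if "pos_measurable f" for f :: "real \<Rightarrow> ennreal"
    proof -
      have [measurable]: "pos_measurable (\<lambda>u. epowr (f u) p)" 
        using measurable_compose[OF that epowr_measurable[OF 2(1)]] .
      note pos_measurable_restrict(2)[OF this a(3,4), measurable]
      show ?thesis by measurable
    qed
    have "?N (\<lambda>u. f u + g u) \<le> (\<integral>\<^sup>+u. ennreal (2 powr p) * (ennreal (1 / u) * (epowr (f u) p * indicator I u)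
         + ennreal (1 / u) * (epowr (g u) p * indicator I u)) \<partial>lebesgue)"
    proof (rule nn_integral_mono)
      fix u
      show "ennreal (1 / u) * (epowr (f u + g u) p * indicator I u) \<le> ennreal (2 powr p) * (ennreal (1 / u) * (epowr (f u) p * indicator I u)
         + ennreal (1 / u) * (epowr (g u) p * indicator I u))"
        using mult_left_mono[OF epowr_add[OF 2(1), of "f u" "g u"], of "ennreal (1/u)"]
        by (auto simp: indicator_def algebra_simps)
    qed
    also have "\<dots> = ennreal (2 powr p) * (?N f + ?N g)"
      using m[OF a(1)] m[OF a(2)] by (subst nn_integral_cmult) (auto simp: nn_integral_add)
    finally have "epowr (?N (\<lambda>u. f u + g u)) (1/p) \<le> epowr (ennreal (2 powr p) * (?N f + ?N g)) (1/p)"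
      using 2 by (intro epowr_mono) auto
    also have "\<dots> = epowr (ennreal (2 powr p)) (1/p) * epowr (?N f + ?N g) (1/p)"
      using 2 by (simp add: epowr_mult)
    also have "\<dots> \<le> epowr (ennreal (2 powr p)) (1/p) * (ennreal (2 powr (1/p)) * (epowr (?N f) (1/p) + epowr (?N g) (1/p)))"
      using 2 by (intro mult_left_mono epowr_add) auto
    finally show "hnorm q I (\<lambda>u. f u + g u) \<le> ?C * (hnorm q I f + hnorm q I g)"
      using 2 a by (simp add: hnorm_finite mult.assoc)
  qed
qed

lemma hnorm_indicator:
  assumes "0 < q" "pos_measurable f" "I \<subseteq> J" "J \<subseteq> {0<..}" "I \<in> sets borel" "J \<in> sets borel"
  shows "hnorm q J (\<lambda>u. f u * indicator I u) = hnorm q I f"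
  using assms(1)
proof (cases rule: exponent_cases)
  case 1
  have Ip: "I \<subseteq> {0<..}" using assms by auto
  have [measurable]: "I \<in> sets (lebesgue_on {0<..})" using assms Ip by (auto simp: sets_restrict_space)
  have m: "pos_measurable (\<lambda>u. f u * indicator I u)" using assms by measurable
  have "hnorm top J (\<lambda>u. f u * indicator I u) \<le> c \<longleftrightarrow> hnorm top I f \<le> c" for c
    unfolding hnorm_top_le_iff[OF m assms(4,6)] hnorm_top_le_iff[OF assms(2) Ip assms(5)]
    using assms by (intro AE_cong) (auto simp: indicator_def)
  then show ?thesis unfolding 1 by (metis order_antisym order_refl)
next
  case (2 p)
  have Ip: "I \<subseteq> {0<..}" using assms by auto
  show ?thesis using 2 assms Ip by (simp add: hnorm_finite)
     (intro arg_cong[where f="\<lambda>x. epowr x _"] nn_integral_cong, auto simp: indicator_def epowr_0)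
qed

lemma pos_measurable_borel: "f \<in> borel_measurable borel \<Longrightarrow> pos_measurable f"
  by (intro measurable_restrict_space1 measurable_completion) simp

lemma pos_measurable_indicator:
  assumes "pos_measurable f" "I \<in> sets borel"
  shows "pos_measurable (\<lambda>u. f u * indicator I u)"
proof -
  have "pos_measurable (indicator I)" using assms(2) by (intro pos_measurable_borel) auto
  then show ?thesis using assms(1) by measurable
qed

lemma pos_measurable_times: "pos_measurable f \<Longrightarrow> pos_measurable g \<Longrightarrow> pos_measurable (\<lambda>u. f u * g u)"
  by measurable

lemma pos_measurable_powr: "pos_measurable (\<lambda>u. ennreal (u powr \<alpha>))"
  by (intro pos_measurable_borel) measurable

lemma pos_measurable_const: "pos_measurable (\<lambda>u. c)"
  by measurable

lemmas pos_measurable_intros = pos_measurable_times pos_measurable_powr pos_measurable_const pos_measurable_indicator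

text \<open>An up-closed set of positive numbers is one of the two half-lines that start at its infimum.\<close>

lemma up_closed_borel:
  fixes A :: "real set"
  assumes "A \<subseteq> {0<..}" "\<And>u v. u \<in> A \<Longrightarrow> u \<le> v \<Longrightarrow> v \<in> A"
  shows "A \<in> sets borel"
proof (cases "A = {}")
  case False
  have bdd: "bdd_below A" using assms(1) by (meson bdd_belowI greaterThan_iff less_imp_le subsetD)
  have "A = {Inf A<..} \<or> A = {Inf A..}"
  proof -
    have 1: "{Inf A<..} \<subseteq> A"
    proof
      fix v assume "v \<in> {Inf A<..}"
      then obtain u where "u \<in> A" "u < v" using cInf_less_iff[OF False bdd] by auto
      then show "v \<in> A" using assms(2)[of u v] by simp
    qed
    have 2: "A \<subseteq> {Inf A..}" using cInf_lower[OF _ bdd] by auto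
    show ?thesis
    proof (cases "Inf A \<in> A")
      case True
      then have "{Inf A..} \<subseteq> A" using assms(2) by auto
      then show ?thesis using 2 by blast
    next
      case False
      then have "A \<subseteq> {Inf A<..}" using 2 by (auto simp: less_le)
      then show ?thesis using 1 by blast
    qed
  qed
  then obtain a where "A = {a<..} \<or> A = {a..}" by blast
  then show ?thesis by auto
qed auto

text \<open>The \<open>K\<close>-functional and every norm over an interval with one moving end point are
  monotone, and this is the source of their measurability.\<close>

lemma pos_measurable_mono:
  assumes "\<And>u v. 0 < u \<Longrightarrow> u \<le> v \<Longrightarrow> f u \<le> f v"
  shows "pos_measurable f"
proof (rule borel_measurableI_greater)
  fix y
  have "{u \<in> {0<..}. y < f u} \<in> sets borel"
    by (rule up_closed_borel) (auto intro: assms order.strict_trans2)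
  then show "{x \<in> space (lebesgue_on {0<..}). y < f x} \<in> sets (lebesgue_on {0<..})"
    by (auto simp: sets_restrict_space intro!: image_eqI[where x="{u \<in> {0<..}. y < f u}"])
qed

lemma pos_measurable_antimono:
  assumes "\<And>u v. 0 < u \<Longrightarrow> u \<le> v \<Longrightarrow> f v \<le> f u"
  shows "pos_measurable f"
proof (rule borel_measurableI_less)
  fix y
  have "{u \<in> {0<..}. f u < y} \<in> sets borel"
    by (rule up_closed_borel) (auto intro: assms order.strict_trans1)
  then show "{x \<in> space (lebesgue_on {0<..}). f x < y} \<in> sets (lebesgue_on {0<..})"
    by (auto simp: sets_restrict_space intro!: image_eqI[where x="{u \<in> {0<..}. f u < y}"])
qed

text \<open>The indicator of \<open>K\<close> is at most the sum of those of \<open>I\<close> and \<open>J\<close> off the point \<open>t\<close>.\<close>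

lemma hnorm_cover:
  assumes "0 < q"
  obtains C where "C < top" and "\<And>f I J K t. pos_measurable f \<Longrightarrow> I \<subseteq> {0<..} \<Longrightarrow> J \<subseteq> {0<..} \<Longrightarrow> 
     I \<in> sets borel \<Longrightarrow> J \<in> sets borel \<Longrightarrow> K \<subseteq> {0<..} \<Longrightarrow> K \<in> sets borel \<Longrightarrow> K \<subseteq> insert t (I \<union> J) \<Longrightarrow>
    hnorm q K f \<le> C * (hnorm q I f + hnorm q J f)"
proof -
  obtain C where C: "C < top" "\<And>f g I. pos_measurable f \<Longrightarrow> pos_measurable g \<Longrightarrow> I \<subseteq> {0<..} \<Longrightarrow> I \<in> sets borel \<Longrightarrow>
    hnorm q I (\<lambda>u. f u + g u) \<le> C * (hnorm q I f + hnorm q I g)" using hnorm_add[OF assms] by blast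
  show ?thesis
  proof (rule that[OF C(1)])
    fix f :: "real \<Rightarrow> ennreal" and I J K :: "real set" and t :: real
    assume a: "pos_measurable f" "I \<subseteq> {0<..}" "J \<subseteq> {0<..}" 
     "I \<in> sets borel" "J \<in> sets borel" "K \<subseteq> {0<..}" "K \<in> sets borel" "K \<subseteq> insert t (I \<union> J)"
    note m = pos_measurable_indicator[OF a(1)]
    let ?P = "{0<..} :: real set"
    have P: "?P \<subseteq> {0<..}" "?P \<in> sets borel" by auto
    have "hnorm q K f = hnorm q ?P (\<lambda>u. f u * indicator K u)"
      using assms a by (subst hnorm_indicator) auto
    also have "\<dots> \<le> hnorm q ?P (\<lambda>u. f u * indicator I u + f u * indicator J u)"
      by (rule hnorm_mono_except[where t=t]) (use assms m[of I] m[of J] m[of K] a in \<open>auto simp: indicator_def\<close>)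
    also have "\<dots> \<le> C * (hnorm q ?P (\<lambda>u. f u * indicator I u) + hnorm q ?P (\<lambda>u. f u * indicator J u))"
      by (intro C(2) m a P)
    also have "\<dots> = C * (hnorm q I f + hnorm q J f)"
      using assms a by (subst (1 2) hnorm_indicator) auto
    finally show "hnorm q K f \<le> C * (hnorm q I f + hnorm q J f)" .
  qed
qed

text \<open>Invariance of \<open>du/u\<close> under dilations. Every uniform estimate below is obtained by moving
  the problem to the interval \<open>(0, 1)\<close>, \<open>(1, 2)\<close> or \<open>(1, \<infinity>)\<close> with this rule.\<close>

lemma hnorm_dilate:
  assumes l: "0 < (l::real)" and "0 < q" "pos_measurable f" "I \<subseteq> {0<..}" "I \<in> sets borel"
  shows "pos_measurable (\<lambda>u. f (l * u))"
    and "(*) l ` I \<in> sets borel" "(*) l ` I \<subseteq> {0<..}"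
    and "hnorm q ((*) l ` I) f = hnorm q I (\<lambda>u. f (l * u))"
proof -
  have ml: "(*) l \<in> lebesgue \<rightarrow>\<^sub>M lebesgue" 
  proof -
    have "(*) l = (*\<^sub>R) l" by (simp add: fun_eq_iff)
    then show ?thesis using lebesgue_measurable_scaling[of l] by simp
  qed
  have mlp: "(*) l \<in> lebesgue_on {0<..} \<rightarrow>\<^sub>M lebesgue_on {0<..}"
    using l ml by (intro measurable_restrict_space2 measurable_restrict_space1) (auto simp: space_restrict_space)
  show m: "pos_measurable (\<lambda>u. f (l * u))"
    by (rule measurable_compose[OF mlp assms(3)])
  have vim: "(*) l ` I = (\<lambda>v. v / l) -` I" using l by (auto simp: image_iff intro!: bexI[where x="_ / l"])
  show lI: "(*) l ` I \<in> sets borel"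
    unfolding vim using measurable_sets[of "\<lambda>v. v / l" borel borel I] assms(5) by simp
  show lP: "(*) l ` I \<subseteq> {0<..}" using assms l by auto
  have ind: "indicator ((*) l ` I) (l * u) = (indicator I u :: ennreal)" for u
    using l by (auto simp: indicator_def)
  have scale: "lebesgue = density (distr lebesgue lebesgue ((*) l)) (\<lambda>x. ennreal l)"
    using lebesgue_real_scale[of l] l by simp
  show "hnorm q ((*) l ` I) f = hnorm q I (\<lambda>u. f (l * u))"
    using assms(2)
  proof (cases rule: exponent_cases)
    case 1
    have "hnorm top ((*) l ` I) f \<le> c \<longleftrightarrow> hnorm top I (\<lambda>u. f (l * u)) \<le> c" for c
    proof -
      let ?P = "\<lambda>v. v \<in> (*) l ` I \<longrightarrow> f v \<le> c"
      have eq: "{v. ?P v} = UNIV - {v \<in> {0<..}. c < f v} \<inter> (*) l ` I" using lP by auto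
      have "{v \<in> {0<..}. c < f v} \<in> sets lebesgue"
      proof -
        have "{v \<in> space (lebesgue_on {0<..}). c < f v} \<in> sets (lebesgue_on {0<..})"
          using assms(3) by measurable
        moreover have "sets (lebesgue_on {0<..}) \<subseteq> sets (lebesgue :: real measure)"
          by (auto simp: sets_restrict_space)
        ultimately show ?thesis by auto
      qed
      moreover have "(*) l ` I \<in> sets lebesgue" using lI by (simp add: sets_completionI_sets)
      ultimately have "UNIV - {v \<in> {0<..}. c < f v} \<inter> (*) l ` I \<in> sets lebesgue"
        using sets.Diff[OF sets.top[of lebesgue] sets.Int[of _ lebesgue]] by simp
      then have ms: "{v \<in> space lebesgue. ?P v} \<in> sets lebesgue" using eq by simp
      have "(AE v in lebesgue. ?P v) \<longleftrightarrow> (AE v in density (distr lebesgue lebesgue ((*) l)) (\<lambda>x. ennreal l). ?P v)"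
        by (rule arg_cong[OF scale, where f="\<lambda>M. AE v in M. ?P v"])
      also have "\<dots> \<longleftrightarrow> (AE v in distr lebesgue lebesgue ((*) l). ?P v)"
        using l by (subst AE_density) auto
      also have "\<dots> \<longleftrightarrow> (AE u in lebesgue. ?P (l * u))"
        by (rule AE_distr_iff[OF ml ms])
      also have "\<dots> \<longleftrightarrow> (AE u in lebesgue. u \<in> I \<longrightarrow> f (l * u) \<le> c)"
        using l by (intro AE_cong) auto
      finally show ?thesis
        unfolding hnorm_top_le_iff[OF assms(3) lP lI] hnorm_top_le_iff[OF m assms(4,5)] .
    qed
    then show ?thesis unfolding 1 by (intro antisym) auto
  next
    case (2 p)
    let ?g = "\<lambda>v. ennreal (1 / v) * (epowr (f v) p * indicator ((*) l ` I) v)"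
    have [measurable]: "(\<lambda>u. ennreal (1 / u)) \<in> borel_measurable lebesgue"
      by (intro measurable_completion) simp
    have [measurable]: "pos_measurable (\<lambda>u. epowr (f u) p)" 
      using measurable_compose[OF assms(3) epowr_measurable[OF 2(1)]] .
    note pos_measurable_restrict(2)[OF this lP lI, measurable]
    have g: "?g \<in> borel_measurable lebesgue" by measurable
    have "(\<integral>\<^sup>+v. ?g v \<partial>lebesgue) = (\<integral>\<^sup>+v. ?g v \<partial>density (distr lebesgue lebesgue ((*) l)) (\<lambda>x. ennreal l))"
      by (rule arg_cong[OF scale, where f="\<lambda>M. nn_integral M ?g"])
    also have "\<dots> = (\<integral>\<^sup>+v. ennreal l * ?g v \<partial>distr lebesgue lebesgue ((*) l))"
      using g by (subst nn_integral_density) auto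
    also have "\<dots> = (\<integral>\<^sup>+u. ennreal l * ?g (l * u) \<partial>lebesgue)"
      using g by (subst nn_integral_distr[OF ml]) auto
    also have "\<dots> = (\<integral>\<^sup>+u. ennreal (1 / u) * (epowr (f (l * u)) p * indicator I u) \<partial>lebesgue)"
    proof (rule nn_integral_cong)
      fix u
      have "ennreal l * ennreal (1 / (l * u)) = ennreal (1 / u)"
        using l by (subst ennreal_mult'[symmetric]) auto
      then show "ennreal l * ?g (l * u) = ennreal (1 / u) * (epowr (f (l * u)) p * indicator I u)"
        by (simp add: ind flip: mult.assoc)
    qed
    finally show ?thesis using 2 assms lI lP by (simp add: hnorm_finite mult.assoc)
  qed
qed

lemma image_mult_intervals:
  assumes "0 < (l::real)"
  shows "(*) l ` {0<..<t} = {0<..<l * t}" "(*) l ` {t<..} = {l * t<..}" "(*) l ` {s<..<t} = {l * s<..<l * t}"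
proof -
  have *: "(*) l ` A = {v. v / l \<in> A}" for A
    using assms by (auto simp: image_iff intro!: bexI[where x="_ / l"])
  show "(*) l ` {0<..<t} = {0<..<l * t}" "(*) l ` {t<..} = {l * t<..}" "(*) l ` {s<..<t} = {l * s<..<l * t}"
    using assms unfolding * by (auto simp: field_simps)
qed

lemma hnorm_powr_0_1:
  assumes "0 < q" "0 < \<alpha>"
  shows "hnorm q {0<..<1} (\<lambda>u. ennreal (u powr \<alpha>)) < top"
  using assms(1)
proof (cases rule: exponent_cases)
  case 1
  have "hnorm top {0<..<1} (\<lambda>u. ennreal (u powr \<alpha>)) \<le> 1"
    using assms by (subst hnorm_top_le_iff) (auto simp: pos_measurable_powr powr_le1)
  then show ?thesis using 1 by (simp add: le_less_trans[OF _ ennreal_one_less_top])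
next
  case (2 p)
  let ?a = "\<alpha> * p - 1"
  have "((\<lambda>x. x powr ?a) has_integral (1 powr (?a + 1) / (?a + 1))) {0..1}"
    by (rule has_integral_powr_from_0) (use assms 2 in auto)
  from nn_integral_has_integral_lebesgue[OF _ this]
  have fin: "(\<integral>\<^sup>+x. ennreal (indicator {0..1} x * x powr ?a) \<partial>lborel) < top"
    by simp
  have "(\<integral>\<^sup>+u. ennreal (1 / u) * epowr (ennreal (u powr \<alpha>)) p * indicator {0<..<1} u \<partial>lebesgue)
     \<le> (\<integral>\<^sup>+x. ennreal (indicator {0..1} x * x powr ?a) \<partial>lborel)"
    unfolding nn_integral_completion
  proof (rule nn_integral_mono)
    fix u :: real
    have "ennreal (1 / u) * epowr (ennreal (u powr \<alpha>)) p = ennreal (u powr ?a)" if "u > 0"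
      using that by (simp add: epowr_ennreal powr_powr powr_diff flip: ennreal_mult')
    then show "ennreal (1 / u) * epowr (ennreal (u powr \<alpha>)) p * indicator {0<..<1} u \<le> ennreal (indicator {0..1} u * u powr ?a)"
      by (auto simp: indicator_def)
  qed
  also note fin
  finally show ?thesis using 2 assms by (subst 2(2), subst hnorm_finite) (auto simp: epowr_def)
qed

lemma hnorm_powr_1_inf:
  assumes "0 < q" "0 < \<alpha>"
  shows "hnorm q {1<..} (\<lambda>u. ennreal (u powr - \<alpha>)) < top"
  using assms(1)
proof (cases rule: exponent_cases)
  case 1
  have "u powr - \<alpha> \<le> 1" if "u > 1" for u using that assms ge_one_powr_ge_zero[of u \<alpha>]
    by (simp add: powr_minus_divide)
  then have "hnorm top {1<..} (\<lambda>u. ennreal (u powr - \<alpha>)) \<le> 1"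
    using assms by (subst hnorm_top_le_iff) (auto simp: pos_measurable_powr)
  then show ?thesis using 1 by (simp add: le_less_trans[OF _ ennreal_one_less_top])
next
  case (2 p)
  let ?a = "- \<alpha> * p - 1"
  have "((\<lambda>x. x powr ?a) has_integral -(1 powr (?a + 1)) / (?a + 1)) {1..}"
    by (rule has_integral_powr_to_inf) (use assms 2 in auto)
  from nn_integral_has_integral_lebesgue[OF _ this]
  have fin: "(\<integral>\<^sup>+x. ennreal (indicator {1..} x * x powr ?a) \<partial>lborel) < top"
    by simp
  have "(\<integral>\<^sup>+u. ennreal (1 / u) * epowr (ennreal (u powr - \<alpha>)) p * indicator {1<..} u \<partial>lebesgue)
     \<le> (\<integral>\<^sup>+x. ennreal (indicator {1..} x * x powr ?a) \<partial>lborel)"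
    unfolding nn_integral_completion
  proof (rule nn_integral_mono)
    fix u :: real
    have "ennreal (1 / u) * epowr (ennreal (u powr - \<alpha>)) p = ennreal (u powr ?a)" if "u > 0"
      using that by (subst powr_diff) (simp add: epowr_ennreal powr_powr flip: ennreal_mult')
    then show "ennreal (1 / u) * epowr (ennreal (u powr - \<alpha>)) p * indicator {1<..} u \<le> ennreal (indicator {1..} u * u powr ?a)"
      by (auto simp: indicator_def)
  qed
  also note fin
  finally show ?thesis using 2 assms by (subst 2(2), subst hnorm_finite) (auto simp: epowr_def)
qed

text \<open>Dilation moves this number to every interval \<open>(t, 2t)\<close>; \<open>slow_le_hnorm\<close> divides by it.\<close>

lemma hnorm_one_1_2:
  assumes "0 < q"
  shows "0 < hnorm q {1<..<2} (\<lambda>u. 1)" "hnorm q {1<..<2} (\<lambda>u. 1) < top"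
proof -
  show "0 < hnorm q {1<..<2} (\<lambda>u. 1)" 
    using assms(1)
  proof (cases rule: exponent_cases)
    case 1
    have "\<not> hnorm top {1<..<2} (\<lambda>u. 1) \<le> 0"
    proof
      assume "hnorm top {1<..<2} (\<lambda>u. 1) \<le> 0"
      then have "AE u::real in lebesgue. u \<in> {1<..<2} \<longrightarrow> (1::ennreal) \<le> 0"
        by (subst (asm) hnorm_top_le_iff) auto
      then have "AE u in lebesgue. u \<notin> {1<..<2::real}" by simp
      then have "{1<..<2::real} \<in> null_sets lebesgue" by (subst (asm) AE_iff_null_sets[symmetric]) auto
      then have "emeasure lebesgue {1<..<2::real} = 0" by auto
      then show False by simp
    qed
    then show ?thesis using 1 by (simp add: zero_less_iff_neq_zero)
  next
    case (2 p)
    have "ennreal (1/2) * ennreal 1 = (\<integral>\<^sup>+u. ennreal (1/2) * indicator {1<..<2::real} u \<partial>lebesgue)"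
      by (subst nn_integral_cmult_indicator) auto
    also have "\<dots> \<le> (\<integral>\<^sup>+u. ennreal (1 / u) * epowr 1 p * indicator {1<..<2} u \<partial>lebesgue)"
    proof (rule nn_integral_mono)
      fix u :: real
      have "ennreal (1/2) \<le> ennreal (1/u)" if "1 < u" "u < 2" using that by (intro ennreal_leI frac_le) auto
      then show "ennreal (1/2) * indicator {1<..<2::real} u \<le> ennreal (1 / u) * epowr 1 p * indicator {1<..<2} u"
        by (simp add: indicator_def epowr_def )
    qed
    finally have "(\<integral>\<^sup>+u. ennreal (1 / u) * epowr 1 p * indicator {1<..<2} u \<partial>lebesgue) > 0"
      by (rule less_le_trans[rotated]) (simp only: ennreal_zero_less_mult_iff, simp only: ennreal_less_zero_iff, simp)
    then show ?thesis using 2 by (subst 2(2), subst hnorm_finite) (auto simp: epowr_def enn2real_eq_0_iff zero_less_iff_neq_zero)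
  qed
  \<comment> \<open>For the upper bound, \<open>1 \<le> 2/u\<close> on \<open>(1, 2)\<close> and \<open>1/u\<close> has finite norm on \<open>(1, \<infinity>)\<close>.\<close>
  have "hnorm q {1<..<2} (\<lambda>u. 1) \<le> hnorm q {1<..<2} (\<lambda>u. 2 * ennreal (u powr - 1))"
  proof (rule hnorm_mono)
    fix u :: real assume "u \<in> {1<..<2}"
    then have "1 \<le> 2 * u powr -1" by (simp add: powr_minus_divide)
    then have "ennreal 1 \<le> ennreal (2 * u powr -1)" by (rule ennreal_leI)
    moreover have "ennreal (2 * u powr -1) = ennreal 2 * ennreal (u powr -1)" by (rule ennreal_mult) auto
    ultimately show "1 \<le> 2 * ennreal (u powr -1)" by (simp only: ennreal_1 ennreal_numeral)
  qed (rule pos_measurable_intros | rule assms | force)+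
  also have "\<dots> = 2 * hnorm q {1<..<2} (\<lambda>u. ennreal (u powr - 1))"
    by (rule hnorm_cmult) (rule pos_measurable_intros | rule assms | force)+
  also have "\<dots> \<le> 2 * hnorm q {1<..} (\<lambda>u. ennreal (u powr - 1))"
    by (intro mult_left_mono hnorm_subset) (rule pos_measurable_intros | rule assms | force)+
  also have "\<dots> < top" using hnorm_powr_1_inf[OF assms, of 1] by (simp add: ennreal_mult_less_top)
  finally show "hnorm q {1<..<2} (\<lambda>u. 1) < top" .
qed

lemma hnorm_le_cmult:
  assumes "0 < q" "pos_measurable F" "pos_measurable G" "I \<subseteq> {0<..}" "I \<in> sets borel"
    and "\<And>u. u \<in> I \<Longrightarrow> F u \<le> c * G u"
  shows "hnorm q I F \<le> c * hnorm q I G"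
  using hnorm_mono[OF assms(1,2) pos_measurable_times[OF pos_measurable_const assms(3)] assms(4,5)] assms(6)
  by (simp add: hnorm_cmult[OF assms(1,3-5)])

lemma hnorm_ge_cmult:
  assumes "0 < q" "pos_measurable F" "pos_measurable G" "I \<subseteq> {0<..}" "I \<in> sets borel"
    and "\<And>u. u \<in> I \<Longrightarrow> c * F u \<le> G u"
  shows "c * hnorm q I F \<le> hnorm q I G"
  using hnorm_mono[OF assms(1) pos_measurable_times[OF pos_measurable_const assms(2)] assms(3-5)] assms(6)
  by (simp add: hnorm_cmult[OF assms(1,2,4,5)])

lemma hnorm_weight_le:
  assumes "0 < q" "pos_measurable b" "pos_measurable F" "I \<subseteq> {0<..}" "I \<in> sets borel"
    and le: "\<And>s. s \<in> I \<Longrightarrow> F s \<le> c"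
  shows "hnorm q I (\<lambda>s. b s * F s) \<le> c * hnorm q I b"
proof (rule hnorm_le_cmult)
  fix s assume "s \<in> I"
  then have "b s * F s \<le> b s * c" by (intro mult_left_mono le) auto
  then show "b s * F s \<le> c * b s" by (simp only: ac_simps)
qed (use assms pos_measurable_times in auto)

text \<open>Quasi-subadditivity of the iterated norms: the triangle inequality is applied to the inner
  norm and then to the outer one. The inner interval \<open>J s\<close> stays arbitrary so that both the
  intervals \<open>(s, t)\<close> and \<open>(t, s)\<close> are covered.\<close>

lemma hnorm_iterated_add:
  assumes "0 < r" "0 < q" "pos_measurable b"
  obtains C where "C < top"
    "\<And>g g1 g2 c I J. pos_measurable g \<Longrightarrow> pos_measurable g1 \<Longrightarrow> pos_measurable g2 \<Longrightarrow>
      (\<And>u. 0 < u \<Longrightarrow> g u \<le> c * (g1 u + g2 u)) \<Longrightarrow> I \<subseteq> {0<..} \<Longrightarrow> I \<in> sets borel \<Longrightarrow>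
      (\<And>s. s \<in> I \<Longrightarrow> J s \<subseteq> {0<..}) \<Longrightarrow> (\<And>s. J s \<in> sets borel) \<Longrightarrow>
      (\<And>f. pos_measurable f \<Longrightarrow> pos_measurable (\<lambda>s. hnorm q (J s) f)) \<Longrightarrow>
      hnorm r I (\<lambda>s. b s * hnorm q (J s) g)
        \<le> C * c * (hnorm r I (\<lambda>s. b s * hnorm q (J s) g1) + hnorm r I (\<lambda>s. b s * hnorm q (J s) g2))"
proof -
  obtain C where C: "C < top" "\<And>f g I. pos_measurable f \<Longrightarrow> pos_measurable g \<Longrightarrow> I \<subseteq> {0<..} \<Longrightarrow> I \<in> sets borel \<Longrightarrow>
    hnorm r I (\<lambda>u. f u + g u) \<le> C * (hnorm r I f + hnorm r I g)" using hnorm_add[OF assms(1)] by blast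
  obtain D where D: "D < top" "\<And>f g I. pos_measurable f \<Longrightarrow> pos_measurable g \<Longrightarrow> I \<subseteq> {0<..} \<Longrightarrow> I \<in> sets borel \<Longrightarrow>
    hnorm q I (\<lambda>u. f u + g u) \<le> D * (hnorm q I f + hnorm q I g)" using hnorm_add[OF assms(2)] by blast
  show ?thesis
  proof (rule that[of "D * C"])
    show "D * C < top" using C D by (simp add: ennreal_mult_less_top)
    fix g g1 g2 :: "real \<Rightarrow> ennreal" and c and I :: "real set" and J :: "real \<Rightarrow> real set"
    assume m: "pos_measurable g" "pos_measurable g1" "pos_measurable g2"
      and le: "\<And>u. 0 < u \<Longrightarrow> g u \<le> c * (g1 u + g2 u)"
      and I: "I \<subseteq> {0<..}" "I \<in> sets borel"
      and J: "\<And>s. s \<in> I \<Longrightarrow> J s \<subseteq> {0<..}" "\<And>s. J s \<in> sets borel"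
      and mJ: "\<And>f. pos_measurable f \<Longrightarrow> pos_measurable (\<lambda>s. hnorm q (J s) f)"
    note mb = pos_measurable_times[OF assms(3) mJ]
    have "hnorm r I (\<lambda>s. b s * hnorm q (J s) g) \<le> D * c * hnorm r I (\<lambda>s. b s * hnorm q (J s) g1 + b s * hnorm q (J s) g2)"
    proof (rule hnorm_le_cmult)
      fix s assume s: "s \<in> I"
      have pos: "0 < u" if "u \<in> J s" for u using J(1)[OF s] that by auto
      have "hnorm q (J s) g \<le> c * hnorm q (J s) (\<lambda>u. g1 u + g2 u)"
        by (rule hnorm_le_cmult) (use m assms J s le[OF pos] in \<open>auto intro: borel_measurable_add\<close>)
      also have "\<dots> \<le> c * (D * (hnorm q (J s) g1 + hnorm q (J s) g2))"
        by (intro mult_left_mono D m J s) simp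
      finally have "b s * hnorm q (J s) g \<le> b s * (c * (D * (hnorm q (J s) g1 + hnorm q (J s) g2)))"
        by (rule mult_left_mono) simp
      then show "b s * hnorm q (J s) g \<le> D * c * (b s * hnorm q (J s) g1 + b s * hnorm q (J s) g2)"
        by (simp only: distrib_left ac_simps)
    qed (use assms I m mb in \<open>auto intro!: borel_measurable_add\<close>)
    also have "\<dots> \<le> D * c * (C * (hnorm r I (\<lambda>s. b s * hnorm q (J s) g1) + hnorm r I (\<lambda>s. b s * hnorm q (J s) g2)))"
      by (intro mult_left_mono C mb m I) simp
    finally show "hnorm r I (\<lambda>s. b s * hnorm q (J s) g)
        \<le> D * C * c * (hnorm r I (\<lambda>s. b s * hnorm q (J s) g1) + hnorm r I (\<lambda>s. b s * hnorm q (J s) g2))"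
      by (simp only: ac_simps)
  qed
qed

section \<open>Slowly varying functions and monomials\<close>

text \<open>Monomials with values in \<^typ>\<open>ennreal\<close>. The constant is kept opaque so that the
  simplifier does not turn special exponents such as \<open>-1\<close> into quotients.\<close>

definition mon :: "real \<Rightarrow> real \<Rightarrow> ennreal" where
  "mon \<alpha> u = ennreal (u powr \<alpha>)"

lemma mon_mult: "0 < u \<Longrightarrow> mon \<alpha> u * mon \<beta> u = mon (\<alpha> + \<beta>) u"
  by (simp add: mon_def powr_add flip: ennreal_mult')

lemma mon_cancel:
  assumes "0 < u"
  shows "mon (- \<alpha>) u * (mon \<alpha> u * x) = x" "mon \<alpha> u * (mon (- \<alpha>) u * x) = x"
  using mon_mult[OF assms, of "- \<alpha>" \<alpha>] mon_mult[OF assms, of \<alpha> "- \<alpha>"] assms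
  by (simp_all add: mon_def flip: mult.assoc)

lemma pos_measurable_mon: "pos_measurable (mon \<alpha>)"
  unfolding mon_def by (rule pos_measurable_powr)

lemma mon_mono: "0 \<le> \<alpha> \<Longrightarrow> 0 < u \<Longrightarrow> u \<le> v \<Longrightarrow> mon \<alpha> u \<le> mon \<alpha> v"
  by (simp add: mon_def powr_mono2 ennreal_leI)

lemma mon_antimono: "\<alpha> \<le> 0 \<Longrightarrow> 0 < u \<Longrightarrow> u \<le> v \<Longrightarrow> mon \<alpha> v \<le> mon \<alpha> u"
  by (simp add: mon_def powr_mono2' ennreal_leI)

lemma mon_dilate: "0 < l \<Longrightarrow> 0 < u \<Longrightarrow> mon \<alpha> (l * u) = mon \<alpha> l * mon \<alpha> u"
  by (simp add: mon_def powr_mult ennreal_mult)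

lemma mon_finite: "mon \<alpha> u < top"
  by (simp add: mon_def)

lemma mon_1: "0 \<le> u \<Longrightarrow> ennreal u = mon 1 u"
  by (simp add: mon_def)

text \<open>The growth condition through which slowly varying functions are used: a dilation by \<open>l\<close>
  costs at most \<open>C l\<^bsup>\<epsilon>\<^esup>\<close>. Unlike equivalence to monotone functions, this form passes
  directly to norms over moving intervals, and it also makes sense for functions that take
  the values \<open>0\<close> and \<open>\<infinity>\<close>.\<close>

definition slow :: "(real \<Rightarrow> ennreal) \<Rightarrow> bool" where
  "slow F \<longleftrightarrow> pos_measurable F \<and>
     (\<forall>\<epsilon>>0. \<exists>C<top. \<forall>l\<ge>1. \<forall>u>0.
        F (l * u) \<le> C * ennreal (l powr \<epsilon>) * F u \<and> F u \<le> C * ennreal (l powr \<epsilon>) * F (l * u))"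

lemma slow_measurable: "slow F \<Longrightarrow> pos_measurable F"
  by (simp add: slow_def)

text \<open>The same condition for two points \<open>s \<le> t\<close>, without quotients: \<open>F(t)/t\<^bsup>\<epsilon>\<^esup>\<close> is almost
  decreasing and \<open>t\<^bsup>\<epsilon>\<^esup> F(t)\<close> is almost increasing.\<close>

lemma slow_bound:
  assumes "slow F" "0 < \<epsilon>"
  obtains C where "C < top"
    "\<And>s t. 0 < s \<Longrightarrow> s \<le> t \<Longrightarrow> mon \<epsilon> s * F t \<le> C * (mon \<epsilon> t * F s)"
    "\<And>s t. 0 < s \<Longrightarrow> s \<le> t \<Longrightarrow> mon \<epsilon> s * F s \<le> C * (mon \<epsilon> t * F t)"
proof -
  obtain C where C: "C < top" "\<And>l u. 1 \<le> l \<Longrightarrow> 0 < u \<Longrightarrow> F (l * u) \<le> C * ennreal (l powr \<epsilon>) * F u"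
    "\<And>l u. 1 \<le> l \<Longrightarrow> 0 < u \<Longrightarrow> F u \<le> C * ennreal (l powr \<epsilon>) * F (l * u)"
    using assms unfolding slow_def by meson
  have e: "mon \<epsilon> s * ennreal ((t / s) powr \<epsilon>) = mon \<epsilon> t" if "0 < s" "s \<le> t" for s t
    using that by (simp add: mon_def powr_divide flip: ennreal_mult)
  show ?thesis
  proof (rule that[OF C(1)])
    fix s t :: real assume st: "0 < s" "s \<le> t"
    then have t: "t / s * s = t" "1 \<le> t / s" by auto
    have "mon \<epsilon> s * F t \<le> mon \<epsilon> s * (C * ennreal ((t / s) powr \<epsilon>) * F s)"
      using C(2)[OF t(2) st(1)] unfolding t by (intro mult_left_mono) auto
    also have "\<dots> = C * ((mon \<epsilon> s * ennreal ((t / s) powr \<epsilon>)) * F s)" by (simp only: ac_simps)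
    finally show "mon \<epsilon> s * F t \<le> C * (mon \<epsilon> t * F s)" unfolding e[OF st] .
    have "mon \<epsilon> s * F s \<le> mon \<epsilon> s * (C * ennreal ((t / s) powr \<epsilon>) * F t)"
      using C(3)[OF t(2) st(1)] unfolding t by (intro mult_left_mono) auto
    also have "\<dots> = C * ((mon \<epsilon> s * ennreal ((t / s) powr \<epsilon>)) * F t)" by (simp only: ac_simps)
    finally show "mon \<epsilon> s * F s \<le> C * (mon \<epsilon> t * F t)" unfolding e[OF st] .
  qed
qed

text \<open>With the monotone equivalents \<open>g\<close> of \<open>t\<^bsup>\<epsilon>\<^esup> b\<close> and \<open>h\<close> of \<open>t\<^bsup>-\<epsilon>\<^esup> b\<close>, comparison of
  \<open>h\<close> at \<open>u\<close> and \<open>l u\<close> gives the upper bound for \<open>b(l u)\<close>, and \<open>g\<close> gives the lower one.\<close>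

lemma slowly_varying_imp_slow:
  assumes "slowly_varying b"
  shows "slow (\<lambda>t. ennreal (b t))"
  unfolding slow_def
proof (intro conjI allI impI)
  have "b \<in> borel_measurable (lebesgue_on {0<..})" using assms by (simp add: slowly_varying_def)
  then show "pos_measurable (\<lambda>t. ennreal (b t))" by measurable
  fix \<epsilon> :: real assume "0 < \<epsilon>"
  then obtain g h where gh: "mono_on {0<..} g" "equiv_on {0<..} (\<lambda>t. t powr \<epsilon> * b t) g"
    "antimono_on {0<..} h" "equiv_on {0<..} (\<lambda>t. t powr (- \<epsilon>) * b t) h"
    using assms unfolding slowly_varying_def by meson
  obtain C where C: "C > 0" "\<And>t. 0 < t \<Longrightarrow> g t / C \<le> t powr \<epsilon> * b t" "\<And>t. 0 < t \<Longrightarrow> t powr \<epsilon> * b t \<le> C * g t"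
    using gh(2) unfolding equiv_on_def by auto
  obtain D where D: "D > 0" "\<And>t. 0 < t \<Longrightarrow> h t / D \<le> t powr - \<epsilon> * b t" "\<And>t. 0 < t \<Longrightarrow> t powr - \<epsilon> * b t \<le> D * h t"
    using gh(4) unfolding equiv_on_def by auto
  let ?M = "C * C + D * D"
  have M: "?M \<ge> 0" "C * C \<le> ?M" "D * D \<le> ?M" by auto
  have pos: "b t > 0" if "t > 0" for t using assms that by (simp add: slowly_varying_def)
  have "ennreal (b (l * u)) \<le> ennreal ?M * ennreal (l powr \<epsilon>) * ennreal (b u) \<and>
     ennreal (b u) \<le> ennreal ?M * ennreal (l powr \<epsilon>) * ennreal (b (l * u))" if lu: "1 \<le> l" "0 < u" for l u :: real
  proof -
    have l: "0 < l" "u \<le> l * u" "0 < l * u" using lu by auto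
    have le: "l powr \<epsilon> > 0" "u powr \<epsilon> > 0" "u powr -\<epsilon> > 0" using lu l by auto
    have "(l * u) powr - \<epsilon> * b (l * u) \<le> D * h (l * u)" using D l by blast
    also have "\<dots> \<le> D * h u" using gh(3) D(1) lu l by (auto simp: monotone_on_def)
    also have "\<dots> \<le> D * (D * (u powr - \<epsilon> * b u))" using D(1) D(2)[OF lu(2)] by (intro mult_left_mono) (auto simp: field_simps)
    finally have "l powr -\<epsilon> * b (l * u) \<le> D * D * b u" using le lu l by (simp add: powr_mult ac_simps)
    then have "b (l * u) \<le> D * D * l powr \<epsilon> * b u" using le by (simp add: powr_minus field_simps)
    also have "\<dots> \<le> ?M * l powr \<epsilon> * b u" using M(3) le pos[OF lu(2)] by (intro mult_right_mono) auto
    finally have 1: "b (l * u) \<le> ?M * l powr \<epsilon> * b u" .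
    have "u powr \<epsilon> * b u \<le> C * g u" using C lu by blast
    also have "\<dots> \<le> C * g (l * u)" using gh(1) C(1) lu l by (auto simp: monotone_on_def)
    also have "\<dots> \<le> C * (C * ((l * u) powr \<epsilon> * b (l * u)))" using C(1) C(2)[OF l(3)] by (intro mult_left_mono) (auto simp: field_simps)
    finally have "b u \<le> C * C * l powr \<epsilon> * b (l * u)" using le lu l by (simp add: powr_mult ac_simps)
    also have "\<dots> \<le> ?M * l powr \<epsilon> * b (l * u)" using M(2) le pos[OF l(3)] by (intro mult_right_mono) auto
    finally have 2: "b u \<le> ?M * l powr \<epsilon> * b (l * u)" .
    show ?thesis using ennreal_leI[OF 1] ennreal_leI[OF 2] M(1) le pos[OF lu(2)] pos[OF l(3)] by (simp add: ennreal_mult'')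
  qed
  then show "\<exists>C<top. \<forall>l\<ge>1. \<forall>u>0. ennreal (b (l * u)) \<le> C * ennreal (l powr \<epsilon>) * ennreal (b u) \<and>
     ennreal (b u) \<le> C * ennreal (l powr \<epsilon>) * ennreal (b (l * u))"
    by (intro exI[of _ "ennreal ?M"]) auto
qed

lemma slow_mult:
  assumes F: "slow F" and G: "slow G" shows "slow (\<lambda>u. F u * G u)"
  unfolding slow_def
proof (intro conjI allI impI)
  show "pos_measurable (\<lambda>u. F u * G u)" using slow_measurable[OF F] slow_measurable[OF G] by measurable
  fix \<epsilon> :: real assume "0 < \<epsilon>"
  then have e: "\<epsilon> / 2 > 0" by simp
  from F e obtain C where C: "C < top" "\<And>l u. 1 \<le> l \<Longrightarrow> 0 < u \<Longrightarrow> F (l * u) \<le> C * ennreal (l powr (\<epsilon>/2)) * F u"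
    "\<And>l u. 1 \<le> l \<Longrightarrow> 0 < u \<Longrightarrow> F u \<le> C * ennreal (l powr (\<epsilon>/2)) * F (l * u)"
    unfolding slow_def by meson
  from G e obtain D where D: "D < top" "\<And>l u. 1 \<le> l \<Longrightarrow> 0 < u \<Longrightarrow> G (l * u) \<le> D * ennreal (l powr (\<epsilon>/2)) * G u"
    "\<And>l u. 1 \<le> l \<Longrightarrow> 0 < u \<Longrightarrow> G u \<le> D * ennreal (l powr (\<epsilon>/2)) * G (l * u)"
    unfolding slow_def by meson
  have eq: "C * ennreal (l powr (\<epsilon>/2)) * x * (D * ennreal (l powr (\<epsilon>/2)) * y) = C * D * ennreal (l powr \<epsilon>) * (x * y)" 
    if "1 \<le> l" for l x y
  proof -
    have "ennreal (l powr \<epsilon>) = ennreal (l powr (\<epsilon>/2)) * ennreal (l powr (\<epsilon>/2))"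
      using mon_mult[of l "\<epsilon>/2" "\<epsilon>/2"] that by (simp add: mon_def)
    then show ?thesis by (simp only: ac_simps)
  qed
  show "\<exists>C<top. \<forall>l\<ge>1. \<forall>u>0. F (l * u) * G (l * u) \<le> C * ennreal (l powr \<epsilon>) * (F u * G u) \<and>
     F u * G u \<le> C * ennreal (l powr \<epsilon>) * (F (l * u) * G (l * u))"
  proof (intro exI[of _ "C * D"] conjI allI impI)
    show "C * D < top" using C D by (simp add: ennreal_mult_less_top)
    fix l u :: real assume "1 \<le> l" "0 < u"
    then show "F (l * u) * G (l * u) \<le> C * D * ennreal (l powr \<epsilon>) * (F u * G u)"
      "F u * G u \<le> C * D * ennreal (l powr \<epsilon>) * (F (l * u) * G (l * u))"
      by (subst eq[symmetric], simp, intro mult_mono C D, auto)+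
  qed
qed

lemma slow_add:
  assumes F: "slow F" and G: "slow G" shows "slow (\<lambda>u. F u + G u)"
  unfolding slow_def
proof (intro conjI allI impI)
  show "pos_measurable (\<lambda>u. F u + G u)" using slow_measurable[OF F] slow_measurable[OF G] by measurable
  fix \<epsilon> :: real assume e: "0 < \<epsilon>"
  from F e obtain C where C: "C < top" "\<And>l u. 1 \<le> l \<Longrightarrow> 0 < u \<Longrightarrow> F (l * u) \<le> C * ennreal (l powr \<epsilon>) * F u"
    "\<And>l u. 1 \<le> l \<Longrightarrow> 0 < u \<Longrightarrow> F u \<le> C * ennreal (l powr \<epsilon>) * F (l * u)"
    unfolding slow_def by meson
  from G e obtain D where D: "D < top" "\<And>l u. 1 \<le> l \<Longrightarrow> 0 < u \<Longrightarrow> G (l * u) \<le> D * ennreal (l powr \<epsilon>) * G u"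
    "\<And>l u. 1 \<le> l \<Longrightarrow> 0 < u \<Longrightarrow> G u \<le> D * ennreal (l powr \<epsilon>) * G (l * u)"
    unfolding slow_def by meson
  have le: "C * p * x \<le> (C + D) * p * x" "D * p * x \<le> (C + D) * p * x" for p x
    by (auto intro!: mult_right_mono)
  show "\<exists>C<top. \<forall>l\<ge>1. \<forall>u>0. F (l * u) + G (l * u) \<le> C * ennreal (l powr \<epsilon>) * (F u + G u) \<and>
     F u + G u \<le> C * ennreal (l powr \<epsilon>) * (F (l * u) + G (l * u))"
  proof (intro exI[of _ "C + D"] conjI allI impI)
    show "C + D < top" using C D by simp
    fix l u :: real assume "1 \<le> l" "0 < u"
    then show "F (l * u) + G (l * u) \<le> (C + D) * ennreal (l powr \<epsilon>) * (F u + G u)"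
      "F u + G u \<le> (C + D) * ennreal (l powr \<epsilon>) * (F (l * u) + G (l * u))"
      unfolding distrib_left by (blast intro: add_mono C D order_trans[OF _ le(1)] order_trans[OF _ le(2)])+
  qed
qed

text \<open>By dilation invariance the norm of \<open>F\<close> over \<open>J (l s) = l J s\<close> is the norm of \<open>F(l \<cdot>)\<close> over
  \<open>J s\<close>, so it inherits the growth bound of \<open>F\<close>.\<close>

lemma slow_hnorm:
  assumes "0 < q" and F: "slow F"
    and J: "\<And>s. 0 < s \<Longrightarrow> J s \<subseteq> {0<..}" "\<And>s. J s \<in> sets borel" "\<And>l s. 0 < l \<Longrightarrow> 0 < s \<Longrightarrow> (*) l ` J s = J (l * s)"
    and m: "pos_measurable (\<lambda>s. hnorm q (J s) F)"
  shows "slow (\<lambda>s. hnorm q (J s) F)"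
  unfolding slow_def
proof (intro conjI allI impI)
  show "pos_measurable (\<lambda>s. hnorm q (J s) F)" by fact
  fix \<epsilon> :: real assume e: "0 < \<epsilon>"
  note mF = slow_measurable[OF F]
  from F e obtain C where C: "C < top" "\<And>l u. 1 \<le> l \<Longrightarrow> 0 < u \<Longrightarrow> F (l * u) \<le> C * ennreal (l powr \<epsilon>) * F u"
    "\<And>l u. 1 \<le> l \<Longrightarrow> 0 < u \<Longrightarrow> F u \<le> C * ennreal (l powr \<epsilon>) * F (l * u)"
    unfolding slow_def by meson
  have "hnorm q (J (l * u)) F \<le> C * ennreal (l powr \<epsilon>) * hnorm q (J u) F"
    "hnorm q (J u) F \<le> C * ennreal (l powr \<epsilon>) * hnorm q (J (l * u)) F" if lu: "1 \<le> l" "0 < u" for l u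
  proof -
    have l: "0 < l" using lu by simp
    note dil = hnorm_dilate[OF l assms(1) mF J(1,2), OF lu(2), unfolded J(3)[OF l lu(2)]]
    have 1: "0 < x" if "x \<in> J u" for x using J(1)[OF lu(2)] that by auto
    have "hnorm q (J u) (\<lambda>v. F (l * v)) \<le> hnorm q (J u) (\<lambda>v. C * ennreal (l powr \<epsilon>) * F v)"
      by (rule hnorm_mono) (use assms(1) dil lu J C(2)[OF lu(1) 1] mF in auto)
    also have "\<dots> = C * ennreal (l powr \<epsilon>) * hnorm q (J u) F"
      by (rule hnorm_cmult) (use assms(1) mF J lu in auto)
    finally show "hnorm q (J (l * u)) F \<le> C * ennreal (l powr \<epsilon>) * hnorm q (J u) F"
      unfolding dil(4) .
    have "hnorm q (J u) F \<le> hnorm q (J u) (\<lambda>v. C * ennreal (l powr \<epsilon>) * F (l * v))"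
      by (rule hnorm_mono) (use assms(1) dil lu J C(3)[OF lu(1) 1] mF in auto)
    also have "\<dots> = C * ennreal (l powr \<epsilon>) * hnorm q (J u) (\<lambda>v. F (l * v))"
      by (rule hnorm_cmult) (use assms(1) dil J lu in auto)
    finally show "hnorm q (J u) F \<le> C * ennreal (l powr \<epsilon>) * hnorm q (J (l * u)) F"
      unfolding dil(4) .
  qed
  then show "\<exists>C<top. \<forall>l\<ge>1. \<forall>u>0. hnorm q (J (l * u)) F \<le> C * ennreal (l powr \<epsilon>) * hnorm q (J u) F \<and>
     hnorm q (J u) F \<le> C * ennreal (l powr \<epsilon>) * hnorm q (J (l * u)) F"
    using C(1) by blast
qed

lemma pos_measurable_hnorm:
  assumes "0 < q" "pos_measurable f"
  shows "pos_measurable (\<lambda>s. hnorm q {0<..<s} f)" "pos_measurable (\<lambda>s. hnorm q {s<..} f)"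
    "0 \<le> t \<Longrightarrow> pos_measurable (\<lambda>s. hnorm q {t<..<s} f)" "pos_measurable (\<lambda>s. hnorm q {s<..<t} f)"
proof -
  show "pos_measurable (\<lambda>s. hnorm q {0<..<s} f)" "pos_measurable (\<lambda>s. hnorm q {s<..} f)"
    "pos_measurable (\<lambda>s. hnorm q {s<..<t} f)"
    by (rule pos_measurable_mono pos_measurable_antimono, rule hnorm_subset, use assms in auto)+
  show "0 \<le> t \<Longrightarrow> pos_measurable (\<lambda>s. hnorm q {t<..<s} f)"
    by (rule pos_measurable_mono, rule hnorm_subset, use assms in auto)
qed

lemma slow_hnorm_0:
  assumes "0 < q" "slow F" shows "slow (\<lambda>t. hnorm q {0<..<t} F)"
  by (rule slow_hnorm[OF assms])
    (use assms slow_measurable in \<open>auto simp: image_mult_intervals intro!: pos_measurable_hnorm\<close>)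

lemma slow_hnorm_inf:
  assumes "0 < q" "slow F" shows "slow (\<lambda>t. hnorm q {t<..} F)"
  by (rule slow_hnorm[OF assms])
    (use assms slow_measurable in \<open>auto simp: image_mult_intervals intro!: pos_measurable_hnorm\<close>)

text \<open>Finiteness propagates from one point to all others; thus the hypotheses
  at \<open>1\<close> suffice for every \<open>t\<close>.\<close>

lemma slow_finite:
  assumes "slow F" "F s < top" "0 < s" "0 < t"
  shows "F t < top"
proof -
  obtain C where C: "C < top"
    "\<And>s t. 0 < s \<Longrightarrow> s \<le> t \<Longrightarrow> mon 1 s * F t \<le> C * (mon 1 t * F s)"
    "\<And>s t. 0 < s \<Longrightarrow> s \<le> t \<Longrightarrow> mon 1 s * F s \<le> C * (mon 1 t * F t)"
    using slow_bound[OF assms(1), of 1] by auto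
  show ?thesis
  proof (cases "s \<le> t")
    case True
    have "mon 1 s * F t < top"
      using C(1) assms(2) by (intro le_less_trans[OF C(2)[OF assms(3) True]]) (auto simp: ennreal_mult_less_top mon_def)
    then show ?thesis using assms(3) by (auto simp: ennreal_mult_less_top mon_def)
  next
    case False
    then have ts: "t \<le> s" by simp
    have "mon 1 t * F t < top"
      using C(1) assms(2) by (intro le_less_trans[OF C(3)[OF assms(4) ts]]) (auto simp: ennreal_mult_less_top mon_def)
    then show ?thesis using assms(4) by (auto simp: ennreal_mult_less_top mon_def)
  qed
qed

text \<open>On the dyadic interval next to \<open>t\<close> the function is comparable with its value at \<open>t\<close>, and
  the interval has the same \<open>du/u\<close>-measure for all \<open>t\<close>.\<close>

lemma slow_le_hnorm:
  assumes "0 < q" and F: "slow F"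
  obtains C where "C < top" "\<And>t. 0 < t \<Longrightarrow> F t \<le> C * hnorm q {t<..<2 * t} F"
    "\<And>t. 0 < t \<Longrightarrow> F t \<le> C * hnorm q {t / 2<..<t} F"
proof -
  let ?c = "hnorm q {1<..<2} (\<lambda>u. 1)"
  have c: "?c \<noteq> 0" "?c \<noteq> top" using hnorm_one_1_2[OF assms(1)] by auto
  note mF = slow_measurable[OF F]
  from F obtain C where C: "C < top" "\<And>l u. 1 \<le> l \<Longrightarrow> 0 < u \<Longrightarrow> F (l * u) \<le> C * ennreal (l powr 1) * F u"
    "\<And>l u. 1 \<le> l \<Longrightarrow> 0 < u \<Longrightarrow> F u \<le> C * ennreal (l powr 1) * F (l * u)"
    unfolding slow_def by (meson zero_less_one)
  have near: "F t \<le> C * 2 * F u" if "0 < t" "u \<in> {t/2<..<2*t}" for t u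
  proof (cases "t \<le> u")
    case True
    have "F t \<le> C * ennreal ((u/t) powr 1) * F (u / t * t)" using that True by (intro C) auto
    also have "\<dots> \<le> C * ennreal 2 * F u" using that 
      by (auto intro!: mult_right_mono mult_left_mono ennreal_leI simp: field_simps simp del: ennreal_numeral)
    finally show ?thesis by simp
  next
    case False
    have u: "0 < u" using that by auto
    have "F (t / u * u) \<le> C * ennreal ((t/u) powr 1) * F u" using that False u by (intro C) auto
    also have "\<dots> \<le> C * ennreal 2 * F u" using that u
      by (auto intro!: mult_right_mono mult_left_mono ennreal_leI simp: field_simps simp del: ennreal_numeral)
    finally show ?thesis using u by simp
  qed
  have main: "F t \<le> C * 2 / ?c * hnorm q {l * 1<..<l * 2} F" if "0 < t" "0 < l" "{l * 1<..<l * 2} \<subseteq> {t/2<..<2*t}" for l t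
  proof -
    have "?c = hnorm q {l * 1<..<l * 2} (\<lambda>u. 1)"
      using hnorm_dilate(4)[OF \<open>0 < l\<close> assms(1), of "\<lambda>u. 1" "{1<..<2}"] that(2)
      by (simp add: image_mult_intervals subset_iff)
    then have "F t * ?c = hnorm q {l * 1<..<l * 2} (\<lambda>u. F t * 1)"
      using that by (subst hnorm_cmult) (auto simp: assms(1))
    also have "\<dots> \<le> hnorm q {l * 1<..<l * 2} (\<lambda>u. C * 2 * F u)"
      using that near[OF that(1)] pos_measurable_times[OF pos_measurable_const mF, of "C * 2"]
      by (intro hnorm_mono) (auto simp: assms(1))
    also have "\<dots> = C * 2 * hnorm q {l * 1<..<l * 2} F"
      using that by (intro hnorm_cmult) (auto simp: assms(1) mF)
    finally have "F t * ?c / ?c \<le> C * 2 * hnorm q {l * 1<..<l * 2} F / ?c" by (rule divide_right_mono_ennreal)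
    then show ?thesis using c by (simp add: ennreal_mult_divide_eq ennreal_divide_times ennreal_times_divide)
  qed
  show ?thesis
  proof (rule that[of "C * 2 / ?c"])
    show "C * 2 / ?c < top" using C(1) c by (simp add: ennreal_divide_eq_top_iff less_top[symmetric] ennreal_mult_eq_top_iff)
    fix t :: real assume t: "0 < t"
    show "F t \<le> C * 2 / ?c * hnorm q {t<..<2 * t} F" using main[of t t] t by (simp add: mult.commute subset_iff)
    show "F t \<le> C * 2 / ?c * hnorm q {t/2<..<t} F" using main[of t "t/2"] t by (simp add: subset_iff)
  qed
qed

text \<open>The end point rule at \<open>0\<close>: half of the exponent pays for the slowly varying factor, which
  may then be evaluated at \<open>t\<close>, and the other half makes the power integrable at \<open>0\<close>.\<close>

lemma hnorm_powr_slow_0: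
  assumes "0 < q" and F: "slow F" and \<alpha>: "0 < \<alpha>"
  obtains C where "C < top" "\<And>t. 0 < t \<Longrightarrow> hnorm q {0<..<t} (\<lambda>u. mon \<alpha> u * F u) \<le> C * (mon \<alpha> t * F t)"
proof -
  note mF = slow_measurable[OF F]
  have h: "0 < \<alpha> / 2" using \<alpha> by simp
  obtain C where C: "C < top" 
    "\<And>s t. 0 < s \<Longrightarrow> s \<le> t \<Longrightarrow> mon (\<alpha>/2) s * F s \<le> C * (mon (\<alpha>/2) t * F t)"
    using slow_bound[OF F h] by metis
  let ?p = "mon (\<alpha>/2)"
  let ?c = "hnorm q {0<..<1} ?p"
  show ?thesis
  proof (rule that[of "C * ?c"])
    show "C * ?c < top" using C hnorm_powr_0_1[OF assms(1) h, folded mon_def] by (simp add: ennreal_mult_less_top)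
    fix t :: real assume t: "0 < t"
    have pp: "?p u * ?p u = mon \<alpha> u" if "0 < u" for u using that by (simp add: mon_mult)
    have "hnorm q {0<..<t} (\<lambda>u. mon \<alpha> u * F u) \<le> hnorm q {0<..<t} (\<lambda>u. C * (?p t * F t) * ?p u)"
    proof (rule hnorm_mono)
      fix u assume u: "u \<in> {0<..<t}"
      then have "mon \<alpha> u * F u = ?p u * (?p u * F u)" using pp[of u] by (simp flip: mult.assoc)
      also have "\<dots> \<le> ?p u * (C * (?p t * F t))" using u by (intro mult_left_mono C) auto
      finally show "mon \<alpha> u * F u \<le> C * (?p t * F t) * ?p u" by (simp only: ac_simps)
    qed (rule pos_measurable_mon pos_measurable_intros mF assms(1) | use t in force)+
    also have "\<dots> = C * (?p t * F t) * hnorm q {0<..<t} ?p"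
      by (rule hnorm_cmult) (rule pos_measurable_mon pos_measurable_intros mF assms(1) | use t in force)+
    also have "hnorm q {0<..<t} ?p = hnorm q {0<..<1} (\<lambda>u. ?p (t * u))"
      using hnorm_dilate(4)[OF t assms(1), of ?p "{0<..<1}"] t by (simp add: image_mult_intervals pos_measurable_mon pos_measurable_intros subset_iff)
    also have "\<dots> = hnorm q {0<..<1} (\<lambda>u. ?p t * ?p u)"
    proof (rule hnorm_cong)
      show "?p (t * u) = ?p t * ?p u" if "u \<in> {0<..<1}" for u using that t by (simp add: mon_def powr_mult ennreal_mult)
      show "pos_measurable (\<lambda>u. ?p (t * u))"
        by (rule hnorm_dilate(1)[OF t assms(1) pos_measurable_mon, of "{}"]) auto
    qed (rule pos_measurable_mon pos_measurable_intros assms(1) | force)+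
    also have "\<dots> = ?p t * ?c" by (rule hnorm_cmult) (rule pos_measurable_mon pos_measurable_intros mF assms(1) | use t in force)+
    also have "C * (?p t * F t) * (?p t * ?c) = C * ?c * (?p t * ?p t * F t)" by (simp only: ac_simps)
    finally show "hnorm q {0<..<t} (\<lambda>u. mon \<alpha> u * F u) \<le> C * ?c * (mon \<alpha> t * F t)"
      unfolding pp[OF t] .
  qed
qed

text \<open>The end point rule at \<open>\<infinity>\<close>, by the same division of the exponent.\<close>

lemma hnorm_powr_slow_inf:
  assumes "0 < q" and F: "slow F" and \<alpha>: "0 < \<alpha>"
  obtains C where "C < top" "\<And>t. 0 < t \<Longrightarrow> hnorm q {t<..} (\<lambda>u. mon (- \<alpha>) u * F u) \<le> C * (mon (- \<alpha>) t * F t)"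
proof -
  note mF = slow_measurable[OF F]
  have h: "0 < \<alpha> / 2" using \<alpha> by simp
  obtain C where C: "C < top" 
    "\<And>s t. 0 < s \<Longrightarrow> s \<le> t \<Longrightarrow> mon (\<alpha>/2) s * F t \<le> C * (mon (\<alpha>/2) t * F s)"
    using slow_bound[OF F h] by metis
  let ?p = "mon (- (\<alpha>/2))"
  let ?r = "mon (\<alpha>/2)"
  let ?c = "hnorm q {1<..} ?p"
  show ?thesis
  proof (rule that[of "C * ?c"])
    show "C * ?c < top" using C hnorm_powr_1_inf[OF assms(1) h, folded mon_def] by (simp add: ennreal_mult_less_top)
    fix t :: real assume t: "0 < t"
    have pp: "?p u * ?p u = mon (- \<alpha>) u" if "0 < u" for u using that by (simp add: mon_mult)
    have pr: "?p u * (?r u * x) = x" if "0 < u" for u x using that by (rule mon_cancel)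
    have "hnorm q {t<..} (\<lambda>u. mon (- \<alpha>) u * F u) \<le> hnorm q {t<..} (\<lambda>u. C * (?p t * F t) * ?p u)"
    proof (rule hnorm_mono)
      fix u assume u: "u \<in> {t<..}"
      then have "mon (- \<alpha>) u * F u = ?p u * ?p u * F u" using pp[of u] t by (simp add: mult.assoc)
      \<comment> \<open>Inserting \<open>t\<^bsup>-\<alpha>/2\<^esup> t\<^bsup>\<alpha>/2\<^esup> = 1\<close> prepares the comparison of \<open>F u\<close> with \<open>F t\<close>.\<close>
      also have "\<dots> = ?p u * ?p u * (?p t * (?r t * F u))" unfolding pr[OF t] ..
      also have "\<dots> \<le> ?p u * ?p u * (?p t * (C * (?r u * F t)))" using u t by (intro mult_left_mono C) auto
      also have "\<dots> = C * (?p t * F t) * (?p u * (?r u * ?p u))" by (simp only: ac_simps)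
      finally show "mon (- \<alpha>) u * F u \<le> C * (?p t * F t) * ?p u" using u t pr[of u] by simp
    qed (rule pos_measurable_mon pos_measurable_intros mF assms(1) | use t in force)+
    also have "\<dots> = C * (?p t * F t) * hnorm q {t<..} ?p"
      by (rule hnorm_cmult) (rule pos_measurable_mon pos_measurable_intros mF assms(1) | use t in force)+
    also have "hnorm q {t<..} ?p = hnorm q {1<..} (\<lambda>u. ?p (t * u))"
      using hnorm_dilate(4)[OF t assms(1), of ?p "{1<..}"] t by (simp add: image_mult_intervals pos_measurable_mon pos_measurable_intros subset_iff)
    also have "\<dots> = hnorm q {1<..} (\<lambda>u. ?p t * ?p u)"
    proof (rule hnorm_cong)
      show "?p (t * u) = ?p t * ?p u" if "u \<in> {1<..}" for u using that t by (simp add: mon_def powr_mult ennreal_mult)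
      show "pos_measurable (\<lambda>u. ?p (t * u))"
        by (rule hnorm_dilate(1)[OF t assms(1) pos_measurable_mon, of "{}"]) auto
    qed (rule pos_measurable_mon pos_measurable_intros assms(1) | force)+
    also have "\<dots> = ?p t * ?c" by (rule hnorm_cmult) (rule pos_measurable_mon pos_measurable_intros mF assms(1) | use t in force)+
    also have "C * (?p t * F t) * (?p t * ?c) = C * ?c * (?p t * ?p t * F t)" by (simp only: ac_simps)
    finally show "hnorm q {t<..} (\<lambda>u. mon (- \<alpha>) u * F u) \<le> C * ?c * (mon (- \<alpha>) t * F t)"
      unfolding pp[OF t] .
  qed
qed

section \<open>Norm estimates for quasi-concave functions\<close>

text \<open>The trace of the couple in the norm estimates: \<open>K(\<cdot>, f)\<close> has these two properties, and the
  estimates below hold for every function that has them.\<close>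

definition quasi_concave :: "(real \<Rightarrow> ennreal) \<Rightarrow> bool" where
  "quasi_concave k \<longleftrightarrow> (\<forall>u v. 0 < u \<longrightarrow> u \<le> v \<longrightarrow> k u \<le> k v \<and> mon (- 1) v * k v \<le> mon (- 1) u * k u)"

lemma quasi_concaveD:
  assumes "quasi_concave k" "0 < u" "u \<le> v"
  shows "k u \<le> k v" "mon (- 1) v * k v \<le> mon (- 1) u * k u"
  using assms by (auto simp: quasi_concave_def)

lemma quasi_concave_measurable: "quasi_concave k \<Longrightarrow> pos_measurable k"
  by (rule pos_measurable_mono) (rule quasi_concaveD(1))

text \<open>The data of the two limiting spaces. The weights are \<^typ>\<open>ennreal\<close>-valued to keep all
  estimates in one type. Below, \<open>norm_R\<close> and \<open>norm_L\<close> are the norms of the two spaces as functions of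
  \<open>k = K(\<cdot>, f)\<close>, \<open>trunc_R\<close> and \<open>trunc_L\<close> are their truncations on the right-hand side of the interpolation
  formula, and \<open>Chi0\<close>, \<open>Chi1\<close> are \<open>\<chi>\<^sub>0\<close>, \<open>\<chi>\<^sub>1\<close>.\<close>

locale limiting_parameters =
  fixes \<theta> :: real and r0 q0 r1 q1 :: ennreal and b0 a0 b1 a1 :: "real \<Rightarrow> ennreal"
  assumes theta: "0 < \<theta>" "\<theta> < 1"
    and exps: "0 < r0" "0 < q0" "0 < r1" "0 < q1"
    and slow: "slow b0" "slow a0" "slow b1" "slow a1"
begin

definition "integrand_R k u = mon (- \<theta>) u * (a0 u * k u)"
definition "integrand_L k u = mon (- 1) u * (a1 u * k u)"
definition "norm_R k = hnorm r0 {0<..} (\<lambda>s. b0 s * hnorm q0 {s<..} (integrand_R k))"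
definition "norm_L k = hnorm r1 {0<..} (\<lambda>s. b1 s * hnorm q1 {0<..<s} (integrand_L k))"
definition "trunc_R t k = hnorm r0 {0<..<t} (\<lambda>s. b0 s * hnorm q0 {s<..<t} (integrand_R k))"
definition "trunc_L t k = hnorm r1 {t<..} (\<lambda>s. b1 s * hnorm q1 {t<..<s} (integrand_L k))"
definition "head_b0 t = hnorm r0 {0<..<t} b0"
definition "Chi0 t = a0 t * head_b0 t"
definition "head_a1 t = hnorm q1 {0<..<t} a1"
definition "head_b1a1 t = hnorm r1 {0<..<t} (\<lambda>s. b1 s * head_a1 s)"
definition "tail_b1 t = hnorm r1 {t<..} b1"
definition "Chi1 t = head_b1a1 t + tail_b1 t * head_a1 t"

lemmas measurable_weights = slow[THEN slow_measurable]

lemma slow_head_a1: "slow head_a1"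
  unfolding head_a1_def using slow_hnorm_0[OF exps(4) slow(4)] .

lemma slow_head_b0: "slow head_b0"
  unfolding head_b0_def using slow_hnorm_0[OF exps(1) slow(1)] .

lemma slow_Chi0: "slow Chi0"
  unfolding Chi0_def by (rule slow_mult[OF slow(2) slow_head_b0])

lemma slow_tail_b1: "slow tail_b1"
  unfolding tail_b1_def using slow_hnorm_inf[OF exps(3) slow(3)] .

lemma slow_head_b1a1: "slow head_b1a1"
  unfolding head_b1a1_def using slow_hnorm_0[OF exps(3) slow_mult[OF slow(3) slow_head_a1]] .

lemma slow_Chi1: "slow Chi1"
  unfolding Chi1_def by (rule slow_add[OF slow_head_b1a1 slow_mult[OF slow_tail_b1 slow_head_a1]])

lemma measurable_integrand: assumes "pos_measurable k" shows "pos_measurable (integrand_R k)" "pos_measurable (integrand_L k)"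
proof -
  have "integrand_R k = (\<lambda>u. mon (- \<theta>) u * (a0 u * k u))" "integrand_L k = (\<lambda>u. mon (- 1) u * (a1 u * k u))"
    by (auto simp: integrand_R_def integrand_L_def)
  then show "pos_measurable (integrand_R k)" "pos_measurable (integrand_L k)"
    by (auto intro!: pos_measurable_times pos_measurable_mon measurable_weights assms)
qed

lemmas measurable_intros = pos_measurable_times pos_measurable_const pos_measurable_mon measurable_weights
  pos_measurable_hnorm[OF exps(2) measurable_integrand(1)] pos_measurable_hnorm[OF exps(4) measurable_integrand(2)]
  slow_head_a1[THEN slow_measurable] measurable_integrand
  
text \<open>For \<open>u \<le> t\<close> the quotient \<open>k u / u\<close> is at least \<open>k t / t\<close>. The two terms of \<open>\<chi>\<^sub>1(t)\<close>
  come from the outer integrals over \<open>(0, t)\<close> and over \<open>(t, \<infinity>)\<close>; in the latter, the inner interval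
  is cut down to \<open>(0, t)\<close>.\<close>

lemma Chi1_mult_le_norm_L:
  assumes k: "quasi_concave k" and t: "0 < t"
  shows "mon (- 1) t * k t * Chi1 t \<le> 2 * norm_L k"
proof -
  note mk = quasi_concave_measurable[OF k]
  let ?c = "mon (- 1) t * k t"
  have inner: "?c * head_a1 s \<le> hnorm q1 {0<..<s} (integrand_L k)" if "s \<le> t" for s
    unfolding head_a1_def
  proof (rule hnorm_ge_cmult[OF exps(4)])
    fix u assume "u \<in> {0<..<s}"
    then have "?c * a1 u \<le> mon (- 1) u * k u * a1 u"
      using that by (intro mult_right_mono quasi_concaveD k) auto
    then show "?c * a1 u \<le> integrand_L k u" by (simp add: integrand_L_def ac_simps)
  qed (use mk in \<open>auto intro: measurable_intros\<close>)
  have "?c * head_b1a1 t \<le> hnorm r1 {0<..<t} (\<lambda>s. b1 s * hnorm q1 {0<..<s} (integrand_L k))"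
    unfolding head_b1a1_def
  proof (rule hnorm_ge_cmult[OF exps(3)])
    fix s assume "s \<in> {0<..<t}"
    then have "b1 s * (?c * head_a1 s) \<le> b1 s * hnorm q1 {0<..<s} (integrand_L k)"
      by (intro mult_left_mono inner) auto
    then show "?c * (b1 s * head_a1 s) \<le> b1 s * hnorm q1 {0<..<s} (integrand_L k)" by (simp add: ac_simps)
  qed (use mk in \<open>auto intro!: measurable_intros\<close>)
  also have "\<dots> \<le> norm_L k" unfolding norm_L_def
    by (rule hnorm_subset) (use exps mk in \<open>auto intro!: measurable_intros\<close>)
  finally have 1: "?c * head_b1a1 t \<le> norm_L k" .
  have "?c * head_a1 t * tail_b1 t \<le> hnorm r1 {t<..} (\<lambda>s. b1 s * hnorm q1 {0<..<s} (integrand_L k))"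
    unfolding tail_b1_def
  proof (rule hnorm_ge_cmult[OF exps(3)])
    fix s assume "s \<in> {t<..}"
    then have "hnorm q1 {0<..<t} (integrand_L k) \<le> hnorm q1 {0<..<s} (integrand_L k)"
      using t mk by (intro hnorm_subset) (auto simp: exps intro: measurable_intros)
    with inner[of t] have "?c * head_a1 t \<le> hnorm q1 {0<..<s} (integrand_L k)" by simp
    then have "b1 s * (?c * head_a1 t) \<le> b1 s * hnorm q1 {0<..<s} (integrand_L k)" by (rule mult_left_mono) simp
    then show "?c * head_a1 t * b1 s \<le> b1 s * hnorm q1 {0<..<s} (integrand_L k)" by (simp add: ac_simps)
  qed (use t mk in \<open>auto intro!: measurable_intros\<close>)
  also have "\<dots> \<le> norm_L k" unfolding norm_L_def
    by (rule hnorm_subset) (use exps mk t in \<open>auto intro!: measurable_intros\<close>)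
  finally have 2: "?c * head_a1 t * tail_b1 t \<le> norm_L k" .
  have "?c * Chi1 t = ?c * head_b1a1 t + ?c * head_a1 t * tail_b1 t" by (simp add: Chi1_def distrib_left ac_simps)
  also have "\<dots> \<le> norm_L k + norm_L k" by (rule add_mono[OF 1 2])
  finally show ?thesis by (simp add: mult_2)
qed

text \<open>For \<open>s < t\<close> the inner interval \<open>(s, \<infinity>)\<close> contains \<open>(t, 2t)\<close>, where \<open>k\<close> is at least \<open>k t\<close> and the
  weights are comparable with their values at \<open>t\<close>. What remains is the norm of \<open>b\<^sub>0\<close> over \<open>(0, t)\<close>.\<close>

lemma Chi0_mult_le_norm_R:
  obtains C where "C < top" "\<And>k t. quasi_concave k \<Longrightarrow> 0 < t \<Longrightarrow> mon (- \<theta>) t * k t * Chi0 t \<le> C * norm_R k"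
proof -
  obtain C where C: "C < top" "\<And>t. 0 < t \<Longrightarrow> a0 t \<le> C * hnorm q0 {t<..<2 * t} a0"
    using slow_le_hnorm[OF exps(2) slow(2)] by metis
  show ?thesis
  proof (rule that[of "C * mon \<theta> 2"])
    show "C * mon \<theta> 2 < top" using C by (simp add: ennreal_mult_less_top mon_finite)
    fix k t assume k: "quasi_concave k" and t: "0 < (t::real)"
    note mk = quasi_concave_measurable[OF k]
    let ?c = "mon (- \<theta>) t * k t"
    have m2: "mon (- \<theta>) t = mon \<theta> 2 * mon (- \<theta>) (2 * t)"
      using t by (simp add: mon_dilate mon_cancel)
    have inner: "?c * a0 t \<le> C * mon \<theta> 2 * hnorm q0 {s<..} (integrand_R k)" if "0 < s" "s < t" for s
    proof -
      have "mon (- \<theta>) (2 * t) * k t * hnorm q0 {t<..<2 * t} a0 \<le> hnorm q0 {t<..<2 * t} (integrand_R k)"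
      proof (rule hnorm_ge_cmult[OF exps(2)])
        fix u assume "u \<in> {t<..<2 * t}"
        then have "mon (- \<theta>) (2 * t) * k t * a0 u \<le> mon (- \<theta>) u * k u * a0 u"
          using t theta by (intro mult_right_mono mult_mono quasi_concaveD(1)[OF k] mon_antimono) auto
        then show "mon (- \<theta>) (2 * t) * k t * a0 u \<le> integrand_R k u" by (simp add: integrand_R_def ac_simps)
      qed (use mk t in \<open>auto intro: measurable_intros\<close>)
      also have "\<dots> \<le> hnorm q0 {s<..} (integrand_R k)"
        by (rule hnorm_subset) (use exps mk t that in \<open>auto intro!: measurable_intros\<close>)
      finally have 1: "mon (- \<theta>) (2 * t) * k t * hnorm q0 {t<..<2 * t} a0 \<le> hnorm q0 {s<..} (integrand_R k)" .
      have "?c * a0 t \<le> ?c * (C * hnorm q0 {t<..<2 * t} a0)" using C(2)[OF t] by (rule mult_left_mono) simp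
      also have "\<dots> = C * mon \<theta> 2 * (mon (- \<theta>) (2 * t) * k t * hnorm q0 {t<..<2 * t} a0)"
        unfolding m2 by (simp only: ac_simps)
      also have "\<dots> \<le> C * mon \<theta> 2 * hnorm q0 {s<..} (integrand_R k)" using 1 by (rule mult_left_mono) simp
      finally show ?thesis .
    qed
    have "?c * Chi0 t = ?c * a0 t * head_b0 t" by (simp add: Chi0_def ac_simps)
    also have "\<dots> \<le> hnorm r0 {0<..<t} (\<lambda>s. C * mon \<theta> 2 * (b0 s * hnorm q0 {s<..} (integrand_R k)))"
      unfolding head_b0_def
    proof (rule hnorm_ge_cmult[OF exps(1)])
      fix s assume "s \<in> {0<..<t}"
      then have "b0 s * (?c * a0 t) \<le> b0 s * (C * mon \<theta> 2 * hnorm q0 {s<..} (integrand_R k))"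
        by (intro mult_left_mono inner) auto
      then show "?c * a0 t * b0 s \<le> C * mon \<theta> 2 * (b0 s * hnorm q0 {s<..} (integrand_R k))" by (simp add: ac_simps)
    qed (use mk in \<open>auto intro!: measurable_intros\<close>)
    also have "\<dots> = C * mon \<theta> 2 * hnorm r0 {0<..<t} (\<lambda>s. b0 s * hnorm q0 {s<..} (integrand_R k))"
      by (rule hnorm_cmult) (use exps mk in \<open>auto intro!: measurable_intros\<close>)
    also have "\<dots> \<le> C * mon \<theta> 2 * norm_R k" unfolding norm_R_def
      by (intro mult_left_mono hnorm_subset) (use exps mk in \<open>auto intro!: measurable_intros\<close>)
    finally show "?c * Chi0 t \<le> C * mon \<theta> 2 * norm_R k" .
  qed
qed

text \<open>In quotient form: the truncated \<open>R\<close>-norm is at most \<open>C \<rho>(t)\<close> times the \<open>L\<close>-norm. Insert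
  \<open>k u \<le> 2 u / \<chi>\<^sub>1(u) \<cdot> \<parallel>k\<parallel>\<close>; moving \<open>\<chi>\<^sub>1\<close> from \<open>u\<close> to \<open>t\<close> costs the power \<open>(t/u)\<^bsup>\<epsilon>\<^esup>\<close>, and with
  \<open>\<epsilon> = (1 - \<theta>)/2\<close> the power of \<open>u\<close> that is left is still integrable at \<open>0\<close>.\<close>

lemma trunc_R_le_norm_L:
  obtains C where "C < top" "\<And>k t. quasi_concave k \<Longrightarrow> 0 < t \<Longrightarrow> Chi1 t * trunc_R t k \<le> C * (mon (1 - \<theta>) t * Chi0 t * norm_L k)"
proof -
  let ?e = "(1 - \<theta>) / 2"
  have e: "0 < ?e" using theta by simp
  obtain C where C: "C < top" "\<And>s t. 0 < s \<Longrightarrow> s \<le> t \<Longrightarrow> mon ?e s * Chi1 t \<le> C * (mon ?e t * Chi1 s)"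
    using slow_bound[OF slow_Chi1 e] by metis
  obtain D where D: "D < top" "\<And>t. 0 < t \<Longrightarrow> hnorm q0 {0<..<t} (\<lambda>u. mon ?e u * a0 u) \<le> D * (mon ?e t * a0 t)"
    using hnorm_powr_slow_0[OF exps(2) slow(2) e] by metis
  show ?thesis
  proof (rule that[of "C * 2 * D"])
    show "C * 2 * D < top" using C D by (simp add: ennreal_mult_less_top)
    fix k t assume k: "quasi_concave k" and t: "0 < (t::real)"
    note mk = quasi_concave_measurable[OF k]
    have point: "Chi1 t * integrand_R k u \<le> C * 2 * (mon ?e t * norm_L k) * (mon ?e u * a0 u)" if u: "0 < u" "u < t" for u
    proof -
      have eq: "mon (- \<theta>) u = mon ?e u * mon ?e u * mon (- 1) u"
        using u by (simp add: mon_mult)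
      have "Chi1 t * integrand_R k u = mon ?e u * (mon (- 1) u * k u * (mon ?e u * Chi1 t)) * a0 u"
        unfolding integrand_R_def eq by (simp only: ac_simps)
      also have "\<dots> \<le> mon ?e u * (mon (- 1) u * k u * (C * (mon ?e t * Chi1 u))) * a0 u"
        using u by (intro mult_right_mono mult_left_mono C) auto
      also have "\<dots> = mon ?e u * (C * mon ?e t) * (mon (- 1) u * k u * Chi1 u) * a0 u" by (simp only: ac_simps)
      also have "\<dots> \<le> mon ?e u * (C * mon ?e t) * (2 * norm_L k) * a0 u"
        using u k by (intro mult_right_mono mult_left_mono Chi1_mult_le_norm_L) auto
      finally show ?thesis by (simp only: ac_simps)
    qed
    have inner: "Chi1 t * hnorm q0 {s<..<t} (integrand_R k) \<le> C * 2 * D * (mon (1 - \<theta>) t * a0 t * norm_L k)" if s: "s \<in> {0<..<t}" for s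
    proof -
      have "Chi1 t * hnorm q0 {s<..<t} (integrand_R k) \<le> hnorm q0 {s<..<t} (\<lambda>u. C * 2 * (mon ?e t * norm_L k) * (mon ?e u * a0 u))"
        by (rule hnorm_ge_cmult) (use exps mk s point in \<open>auto intro!: measurable_intros\<close>)
      also have "\<dots> = C * 2 * (mon ?e t * norm_L k) * hnorm q0 {s<..<t} (\<lambda>u. mon ?e u * a0 u)"
        by (rule hnorm_cmult) (use exps s in \<open>auto intro!: measurable_intros\<close>)
      also have "\<dots> \<le> C * 2 * (mon ?e t * norm_L k) * hnorm q0 {0<..<t} (\<lambda>u. mon ?e u * a0 u)"
        by (intro mult_left_mono hnorm_subset) (use exps s in \<open>auto intro!: measurable_intros\<close>)
      also have "\<dots> \<le> C * 2 * (mon ?e t * norm_L k) * (D * (mon ?e t * a0 t))"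
        by (intro mult_left_mono D t) auto
      also have "\<dots> = C * 2 * D * ((mon ?e t * mon ?e t) * a0 t * norm_L k)" by (simp only: ac_simps)
      also have "mon ?e t * mon ?e t = mon (1 - \<theta>) t" using t by (simp add: mon_mult)
      finally show ?thesis .
    qed
    have "Chi1 t * trunc_R t k \<le> hnorm r0 {0<..<t} (\<lambda>s. b0 s * (Chi1 t * hnorm q0 {s<..<t} (integrand_R k)))"
      unfolding trunc_R_def by (rule hnorm_ge_cmult) (use exps mk in \<open>auto intro!: measurable_intros simp: ac_simps\<close>)
    also have "\<dots> \<le> C * 2 * D * (mon (1 - \<theta>) t * a0 t * norm_L k) * hnorm r0 {0<..<t} b0"
      by (rule hnorm_weight_le) (use exps mk inner in \<open>auto intro!: measurable_intros\<close>)
    also have "\<dots> = C * 2 * D * (mon (1 - \<theta>) t * Chi0 t * norm_L k)"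
      by (simp only: Chi0_def head_b0_def ac_simps)
    finally show "Chi1 t * trunc_R t k \<le> C * 2 * D * (mon (1 - \<theta>) t * Chi0 t * norm_L k)" .
  qed
qed

text \<open>The mirror image: insert \<open>k u \<le> C u\<^bsup>\<theta>\<^esup> / \<chi>\<^sub>0(u) \<cdot> \<parallel>k\<parallel>\<close> and move \<open>\<chi>\<^sub>0\<close> from \<open>u\<close> to \<open>t\<close>, which leaves a
  power integrable at \<open>\<infinity>\<close>. The result carries \<open>a\<^sub>1(t)\<close> times the norm of \<open>b\<^sub>1\<close> over \<open>(t, \<infinity>)\<close>, which
  the second term of \<open>\<chi>\<^sub>1(t)\<close> dominates.\<close>

lemma trunc_L_le_norm_R:
  obtains C where "C < top" "\<And>k t. quasi_concave k \<Longrightarrow> 0 < t \<Longrightarrow> Chi0 t * trunc_L t k \<le> C * (mon (\<theta> - 1) t * Chi1 t * norm_R k)"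
proof -
  let ?e = "(1 - \<theta>) / 2"
  have e: "0 < ?e" using theta by simp
  obtain C where C: "C < top" "\<And>s t. 0 < s \<Longrightarrow> s \<le> t \<Longrightarrow> mon ?e s * Chi0 s \<le> C * (mon ?e t * Chi0 t)"
    using slow_bound[OF slow_Chi0 e] by metis
  obtain C2 where C2: "C2 < top" "\<And>k t. quasi_concave k \<Longrightarrow> 0 < t \<Longrightarrow> mon (- \<theta>) t * k t * Chi0 t \<le> C2 * norm_R k"
    using Chi0_mult_le_norm_R by metis
  obtain D where D: "D < top" "\<And>t. 0 < t \<Longrightarrow> hnorm q1 {t<..} (\<lambda>u. mon (- ?e) u * a1 u) \<le> D * (mon (- ?e) t * a1 t)"
    using hnorm_powr_slow_inf[OF exps(4) slow(4) e] by metis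
  obtain E where E: "E < top" "\<And>t. 0 < t \<Longrightarrow> a1 t \<le> E * hnorm q1 {t / 2<..<t} a1"
    using slow_le_hnorm[OF exps(4) slow(4)] by metis
  show ?thesis
  proof (rule that[of "C * C2 * D * E"])
    show "C * C2 * D * E < top" using C C2 D E by (simp add: ennreal_mult_less_top)
    fix k t assume k: "quasi_concave k" and t: "0 < (t::real)"
    note mk = quasi_concave_measurable[OF k]
    have point: "Chi0 t * integrand_L k u \<le> C * C2 * (mon (- ?e) t * norm_R k) * (mon (- ?e) u * a1 u)" if u: "t < u" for u
    proof -
      have u0: "0 < u" using u t by simp
      have eq: "mon (- 1) u * mon ?e u = mon (- \<theta>) u * mon (- ?e) u"
        using u0 by (simp add: mon_mult) (rule arg_cong[where f="\<lambda>\<alpha>. mon \<alpha> u"], simp add: field_simps)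
      have "Chi0 t * integrand_L k u = mon (- ?e) t * (mon ?e t * Chi0 t) * mon (- 1) u * k u * a1 u"
        using mon_cancel(1)[OF t, of ?e "Chi0 t"] by (simp only: integrand_L_def ac_simps)
      also have "\<dots> \<le> mon (- ?e) t * (C * (mon ?e u * Chi0 u)) * mon (- 1) u * k u * a1 u"
        using t u by (intro mult_right_mono mult_left_mono C) auto
      also have "\<dots> = mon (- ?e) t * C * (mon (- 1) u * mon ?e u) * (k u * Chi0 u) * a1 u" by (simp only: ac_simps)
      also have "\<dots> = mon (- ?e) t * C * mon (- ?e) u * (mon (- \<theta>) u * k u * Chi0 u) * a1 u"
        unfolding eq by (simp only: ac_simps)
      also have "\<dots> \<le> mon (- ?e) t * C * mon (- ?e) u * (C2 * norm_R k) * a1 u"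
        by (intro mult_right_mono mult_left_mono C2 k u0) auto
      finally show ?thesis by (simp only: ac_simps)
    qed
    have inner: "Chi0 t * hnorm q1 {t<..<s} (integrand_L k) \<le> C * C2 * D * (mon (\<theta> - 1) t * a1 t * norm_R k)" if s: "s \<in> {t<..}" for s
    proof -
      have "Chi0 t * hnorm q1 {t<..<s} (integrand_L k) \<le> hnorm q1 {t<..<s} (\<lambda>u. C * C2 * (mon (- ?e) t * norm_R k) * (mon (- ?e) u * a1 u))"
        by (rule hnorm_ge_cmult) (use exps mk s t point in \<open>auto intro!: measurable_intros\<close>)
      also have "\<dots> = C * C2 * (mon (- ?e) t * norm_R k) * hnorm q1 {t<..<s} (\<lambda>u. mon (- ?e) u * a1 u)"
        by (rule hnorm_cmult) (use exps s t in \<open>auto intro!: measurable_intros\<close>)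
      also have "\<dots> \<le> C * C2 * (mon (- ?e) t * norm_R k) * hnorm q1 {t<..} (\<lambda>u. mon (- ?e) u * a1 u)"
        by (intro mult_left_mono hnorm_subset) (use exps s t in \<open>auto intro!: measurable_intros\<close>)
      also have "\<dots> \<le> C * C2 * (mon (- ?e) t * norm_R k) * (D * (mon (- ?e) t * a1 t))"
        by (intro mult_left_mono D t) auto
      also have "\<dots> = C * C2 * D * ((mon (- ?e) t * mon (- ?e) t) * a1 t * norm_R k)" by (simp only: ac_simps)
      also have "mon (- ?e) t * mon (- ?e) t = mon (\<theta> - 1) t" using t by (simp add: mon_mult)
      finally show ?thesis .
    qed
    have "Chi0 t * trunc_L t k \<le> hnorm r1 {t<..} (\<lambda>s. b1 s * (Chi0 t * hnorm q1 {t<..<s} (integrand_L k)))"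
      unfolding trunc_L_def by (rule hnorm_ge_cmult) (use exps mk t in \<open>auto intro!: measurable_intros simp: ac_simps\<close>)
    also have "\<dots> \<le> C * C2 * D * (mon (\<theta> - 1) t * a1 t * norm_R k) * hnorm r1 {t<..} b1"
      by (rule hnorm_weight_le) (use exps mk t inner in \<open>auto intro!: measurable_intros\<close>)
    also have "\<dots> = C * C2 * D * (mon (\<theta> - 1) t * norm_R k * tail_b1 t) * a1 t"
      by (simp only: tail_b1_def ac_simps)
    also have "\<dots> \<le> C * C2 * D * (mon (\<theta> - 1) t * norm_R k * tail_b1 t) * (E * head_a1 t)"
      unfolding head_a1_def
      by (intro mult_left_mono order_trans[OF E(2)[OF t]] hnorm_subset) (use exps t in \<open>auto intro!: measurable_intros\<close>)
    also have "\<dots> = C * C2 * D * E * (mon (\<theta> - 1) t * norm_R k * (tail_b1 t * head_a1 t))" by (simp only: ac_simps)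
    also have "\<dots> \<le> C * C2 * D * E * (mon (\<theta> - 1) t * norm_R k * Chi1 t)"
      unfolding Chi1_def by (intro mult_left_mono) auto
    finally show "Chi0 t * trunc_L t k \<le> C * C2 * D * E * (mon (\<theta> - 1) t * Chi1 t * norm_R k)" by (simp only: ac_simps)
  qed
qed

text \<open>Only \<open>s < t/2\<close> and \<open>u\<close> in \<open>(t/2, t)\<close> are needed, where \<open>2 k u \<ge> k t\<close>. This produces the norm of
  \<open>b\<^sub>0\<close> over \<open>(0, t/2)\<close>, which dilation compares with the norm over \<open>(0, t)\<close>.\<close>

lemma Chi0_mult_le_trunc_R:
  obtains C where "C < top" "\<And>k t. quasi_concave k \<Longrightarrow> 0 < t \<Longrightarrow> mon (- \<theta>) t * k t * Chi0 t \<le> C * trunc_R t k"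
proof -
  obtain C where C: "C < top" "\<And>t. 0 < t \<Longrightarrow> a0 t \<le> C * hnorm q0 {t / 2<..<t} a0"
    using slow_le_hnorm[OF exps(2) slow(2)] by metis
  obtain D where D: "D < top" "\<And>s t. 0 < s \<Longrightarrow> s \<le> t \<Longrightarrow> mon 1 s * head_b0 t \<le> D * (mon 1 t * head_b0 s)"
    using slow_bound[OF slow_head_b0 zero_less_one] by metis
  have head_b0: "head_b0 t \<le> D * mon 1 2 * head_b0 (t / 2)" if "0 < t" for t
  proof -
    have "mon (- 1) (t / 2) * (mon 1 (t / 2) * head_b0 t) \<le> mon (- 1) (t / 2) * (D * (mon 1 (2 * (t / 2)) * head_b0 (t / 2)))"
      using D(2)[of "t/2" t] that by (intro mult_left_mono) auto
    also have "mon 1 (2 * (t / 2)) = mon 1 2 * mon 1 (t / 2)" using that by (intro mon_dilate) auto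
    also have "mon (- 1) (t / 2) * (D * (mon 1 2 * mon 1 (t / 2) * head_b0 (t / 2))) = 
       mon (- 1) (t / 2) * (mon 1 (t / 2) * (D * mon 1 2 * head_b0 (t / 2)))" by (simp only: ac_simps)
    finally show ?thesis using that by (subst (asm) (1 2) mon_cancel) auto
  qed
  show ?thesis
  proof (rule that[of "C * mon 1 2 * (D * mon 1 2)"])
    show "C * mon 1 2 * (D * mon 1 2) < top" using C D by (simp add: ennreal_mult_less_top mon_finite)
    fix k t assume k: "quasi_concave k" and t: "0 < (t::real)"
    note mk = quasi_concave_measurable[OF k]
    let ?c = "mon (- \<theta>) t * k t"
    have k2: "k t \<le> mon 1 2 * k u" if "t / 2 < u" "u < t" for u
    proof -
      have u: "0 < u" using that t by simp
      have "k t = mon 1 t * (mon (- 1) t * k t)" using t by (simp add: mon_cancel)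
      also have "\<dots> \<le> mon 1 (2 * u) * (mon (- 1) u * k u)"
        using that t u by (intro mult_mono mon_mono quasi_concaveD[OF k]) auto
      also have "\<dots> = mon 1 2 * k u" using u by (simp add: mon_dilate mon_cancel mult.assoc)
      finally show ?thesis .
    qed
    have inner: "?c * a0 t \<le> C * mon 1 2 * hnorm q0 {s<..<t} (integrand_R k)" if "0 < s" "s < t / 2" for s
    proof -
      have "?c * hnorm q0 {t / 2<..<t} a0 \<le> hnorm q0 {t / 2<..<t} (\<lambda>u. mon 1 2 * integrand_R k u)"
      proof (rule hnorm_ge_cmult[OF exps(2)])
        fix u assume "u \<in> {t / 2<..<t}"
        then have "?c * a0 u \<le> mon (- \<theta>) u * (mon 1 2 * k u) * a0 u"
          using t theta by (intro mult_right_mono mult_mono k2 mon_antimono) auto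
        then show "?c * a0 u \<le> mon 1 2 * integrand_R k u" by (simp add: integrand_R_def ac_simps)
      qed (use mk t in \<open>auto intro!: measurable_intros\<close>)
      also have "\<dots> = mon 1 2 * hnorm q0 {t / 2<..<t} (integrand_R k)"
        by (rule hnorm_cmult) (use exps mk t in \<open>auto intro!: measurable_intros\<close>)
      also have "\<dots> \<le> mon 1 2 * hnorm q0 {s<..<t} (integrand_R k)"
        by (intro mult_left_mono hnorm_subset) (use exps mk t that in \<open>auto intro!: measurable_intros\<close>)
      finally have 1: "?c * hnorm q0 {t / 2<..<t} a0 \<le> mon 1 2 * hnorm q0 {s<..<t} (integrand_R k)" .
      have "?c * a0 t \<le> ?c * (C * hnorm q0 {t / 2<..<t} a0)" using C(2)[OF t] by (rule mult_left_mono) simp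
      also have "\<dots> = C * (?c * hnorm q0 {t / 2<..<t} a0)" by (simp only: ac_simps)
      also have "\<dots> \<le> C * (mon 1 2 * hnorm q0 {s<..<t} (integrand_R k))" using 1 by (rule mult_left_mono) simp
      finally show ?thesis by (simp only: ac_simps)
    qed
    have "?c * a0 t * head_b0 (t / 2) \<le> hnorm r0 {0<..<t / 2} (\<lambda>s. C * mon 1 2 * (b0 s * hnorm q0 {s<..<t} (integrand_R k)))"
      unfolding head_b0_def
    proof (rule hnorm_ge_cmult[OF exps(1)])
      fix s assume "s \<in> {0<..<t / 2}"
      then have "b0 s * (?c * a0 t) \<le> b0 s * (C * mon 1 2 * hnorm q0 {s<..<t} (integrand_R k))"
        by (intro mult_left_mono inner) auto
      then show "?c * a0 t * b0 s \<le> C * mon 1 2 * (b0 s * hnorm q0 {s<..<t} (integrand_R k))" by (simp add: ac_simps)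
    qed (use mk in \<open>auto intro!: measurable_intros\<close>)
    also have "\<dots> = C * mon 1 2 * hnorm r0 {0<..<t / 2} (\<lambda>s. b0 s * hnorm q0 {s<..<t} (integrand_R k))"
      by (rule hnorm_cmult) (use exps mk in \<open>auto intro!: measurable_intros\<close>)
    also have "\<dots> \<le> C * mon 1 2 * trunc_R t k" unfolding trunc_R_def
      by (intro mult_left_mono hnorm_subset) (use exps mk t in \<open>auto intro!: measurable_intros\<close>)
    finally have 2: "?c * a0 t * head_b0 (t / 2) \<le> C * mon 1 2 * trunc_R t k" .
    have "?c * Chi0 t \<le> ?c * (a0 t * (D * mon 1 2 * head_b0 (t / 2)))"
      unfolding Chi0_def by (intro mult_left_mono head_b0 t) auto
    also have "\<dots> = D * mon 1 2 * (?c * a0 t * head_b0 (t / 2))" by (simp only: ac_simps)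
    also have "\<dots> \<le> D * mon 1 2 * (C * mon 1 2 * trunc_R t k)" by (rule mult_left_mono[OF 2]) simp
    finally show "?c * Chi0 t \<le> C * mon 1 2 * (D * mon 1 2) * trunc_R t k" by (simp only: ac_simps)
  qed
qed

text \<open>To be applied with \<open>k = K(\<cdot>, f)\<close> and \<open>k' = K(\<cdot>, g)\<close>. The outer and inner intervals are cut at \<open>t\<close>. Where both
  variables are below \<open>t\<close>, \<open>k'\<close> is compared with \<open>k\<close>; in the two other parts it is bounded by the
  constant \<open>c k t\<close>, and the factor \<open>u\<^bsup>-\<theta>\<^esup>\<close> makes the norms over \<open>(s, \<infinity>)\<close> converge.\<close>

lemma norm_R_le_trunc_R:
  obtains C where "C < top" "\<And>k k' c t. quasi_concave k \<Longrightarrow> quasi_concave k' \<Longrightarrow> 0 < t \<Longrightarrow>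
     (\<And>u. 0 < u \<Longrightarrow> u < t \<Longrightarrow> k' u \<le> c * k u) \<Longrightarrow> (\<And>u. 0 < u \<Longrightarrow> k' u \<le> c * k t) \<Longrightarrow>
     norm_R k' \<le> C * c * (trunc_R t k + mon (- \<theta>) t * k t * Chi0 t)"
proof -
  obtain C where C: "C < top" "\<And>f I J K t. pos_measurable f \<Longrightarrow> I \<subseteq> {0<..} \<Longrightarrow> J \<subseteq> {0<..} \<Longrightarrow> 
     I \<in> sets borel \<Longrightarrow> J \<in> sets borel \<Longrightarrow> K \<subseteq> {0<..} \<Longrightarrow> K \<in> sets borel \<Longrightarrow> K \<subseteq> insert t (I \<union> J) \<Longrightarrow>
    hnorm q0 K f \<le> C * (hnorm q0 I f + hnorm q0 J f)" using hnorm_cover[OF exps(2)] by blast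
  obtain C' where C': "C' < top" "\<And>f I J K t. pos_measurable f \<Longrightarrow> I \<subseteq> {0<..} \<Longrightarrow> J \<subseteq> {0<..} \<Longrightarrow> 
     I \<in> sets borel \<Longrightarrow> J \<in> sets borel \<Longrightarrow> K \<subseteq> {0<..} \<Longrightarrow> K \<in> sets borel \<Longrightarrow> K \<subseteq> insert t (I \<union> J) \<Longrightarrow>
    hnorm r0 K f \<le> C' * (hnorm r0 I f + hnorm r0 J f)" using hnorm_cover[OF exps(1)] by blast
  obtain C'' where C'': "C'' < top" "\<And>f g I. pos_measurable f \<Longrightarrow> pos_measurable g \<Longrightarrow> I \<subseteq> {0<..} \<Longrightarrow> I \<in> sets borel \<Longrightarrow>
    hnorm r0 I (\<lambda>u. f u + g u) \<le> C'' * (hnorm r0 I f + hnorm r0 I g)" using hnorm_add[OF exps(1)] by blast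
  obtain D where D: "D < top" "\<And>t. 0 < t \<Longrightarrow> hnorm q0 {t<..} (\<lambda>u. mon (- \<theta>) u * a0 u) \<le> D * (mon (- \<theta>) t * a0 t)"
    using hnorm_powr_slow_inf[OF exps(2) slow(2) theta(1)] by metis
  obtain D' where D': "D' < top" "\<And>t. 0 < t \<Longrightarrow> hnorm r0 {t<..} (\<lambda>u. mon (- \<theta>) u * (b0 u * a0 u)) \<le> D' * (mon (- \<theta>) t * (b0 t * a0 t))"
    using hnorm_powr_slow_inf[OF exps(1) slow_mult[OF slow(1,2)] theta(1)] by metis
  obtain E where E: "E < top" "\<And>t. 0 < t \<Longrightarrow> b0 t \<le> E * hnorm r0 {t / 2<..<t} b0"
    using slow_le_hnorm[OF exps(1) slow(1)] by metis
  let ?M = "C' * (C * C'' * (1 + D) + D * D' * E)"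
  show ?thesis
  proof (rule that[of ?M])
    show "?M < top" using C C' C'' D D' E by (simp add: ennreal_mult_less_top)
    fix k k' :: "real \<Rightarrow> ennreal" and c t
    assume k: "quasi_concave k" and k': "quasi_concave k'" and t: "0 < (t::real)"
      and le1: "\<And>u. 0 < u \<Longrightarrow> u < t \<Longrightarrow> k' u \<le> c * k u"
      and le2: "\<And>u. 0 < u \<Longrightarrow> k' u \<le> c * k t"
    note mk = quasi_concave_measurable[OF k] quasi_concave_measurable[OF k']
    let ?Z = "mon (- \<theta>) t * k t * Chi0 t"
    have tail: "hnorm q0 {s<..} (integrand_R k') \<le> c * k t * (D * (mon (- \<theta>) s * a0 s))" if s: "0 < s" for s
    proof -
      have "hnorm q0 {s<..} (integrand_R k') \<le> c * k t * hnorm q0 {s<..} (\<lambda>u. mon (- \<theta>) u * a0 u)"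
      proof (rule hnorm_le_cmult[OF exps(2)])
        fix u assume "u \<in> {s<..}"
        then have "mon (- \<theta>) u * a0 u * k' u \<le> mon (- \<theta>) u * a0 u * (c * k t)"
          using s by (intro mult_left_mono le2) auto
        then show "integrand_R k' u \<le> c * k t * (mon (- \<theta>) u * a0 u)" by (simp only: integrand_R_def ac_simps)
      qed (use mk s in \<open>auto intro!: measurable_intros\<close>)
      also have "\<dots> \<le> c * k t * (D * (mon (- \<theta>) s * a0 s))" by (intro mult_left_mono D s) simp
      finally show ?thesis .
    qed
    let ?d = "c * k t * (D * (mon (- \<theta>) t * a0 t))"
    have "hnorm r0 {0<..<t} (\<lambda>s. b0 s * hnorm q0 {s<..} (integrand_R k'))
       \<le> C * hnorm r0 {0<..<t} (\<lambda>s. c * (b0 s * hnorm q0 {s<..<t} (integrand_R k)) + ?d * b0 s)"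
    proof (rule hnorm_le_cmult[OF exps(1)])
      fix s assume s: "s \<in> {0<..<t}"
      have "hnorm q0 {s<..<t} (integrand_R k') \<le> c * hnorm q0 {s<..<t} (integrand_R k)"
      proof (rule hnorm_le_cmult[OF exps(2)])
        fix u assume "u \<in> {s<..<t}"
        then have "mon (- \<theta>) u * a0 u * k' u \<le> mon (- \<theta>) u * a0 u * (c * k u)"
          using s by (intro mult_left_mono le1) auto
        then show "integrand_R k' u \<le> c * integrand_R k u" by (simp only: integrand_R_def ac_simps)
      qed (use mk s in \<open>auto intro!: measurable_intros\<close>)
      then have "hnorm q0 {s<..<t} (integrand_R k') + hnorm q0 {t<..} (integrand_R k') \<le> c * hnorm q0 {s<..<t} (integrand_R k) + ?d"
        by (intro add_mono tail t)
      moreover have "hnorm q0 {s<..} (integrand_R k') \<le> C * (hnorm q0 {s<..<t} (integrand_R k') + hnorm q0 {t<..} (integrand_R k'))"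
        by (rule C(2)[where t=t]) (use mk s t in \<open>auto intro!: measurable_intros\<close>)
      ultimately have "hnorm q0 {s<..} (integrand_R k') \<le> C * (c * hnorm q0 {s<..<t} (integrand_R k) + ?d)"
        by (blast intro: order_trans mult_left_mono zero_le)
      then have "b0 s * hnorm q0 {s<..} (integrand_R k') \<le> b0 s * (C * (c * hnorm q0 {s<..<t} (integrand_R k) + ?d))"
        by (rule mult_left_mono) simp
      then show "b0 s * hnorm q0 {s<..} (integrand_R k') \<le> C * (c * (b0 s * hnorm q0 {s<..<t} (integrand_R k)) + ?d * b0 s)"
        by (simp only: distrib_left ac_simps)
    qed (use mk t in \<open>auto intro!: measurable_intros borel_measurable_add\<close>)
    also have "\<dots> \<le> C * (C'' * (hnorm r0 {0<..<t} (\<lambda>s. c * (b0 s * hnorm q0 {s<..<t} (integrand_R k))) + hnorm r0 {0<..<t} (\<lambda>s. ?d * b0 s)))"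
      by (rule mult_left_mono, rule C'') (use mk t in \<open>auto intro!: measurable_intros\<close>)
    also have "hnorm r0 {0<..<t} (\<lambda>s. c * (b0 s * hnorm q0 {s<..<t} (integrand_R k))) = c * trunc_R t k"
      unfolding trunc_R_def by (rule hnorm_cmult) (use exps mk t in \<open>auto intro!: measurable_intros\<close>)
    also have "hnorm r0 {0<..<t} (\<lambda>s. ?d * b0 s) = ?d * head_b0 t"
      unfolding head_b0_def by (rule hnorm_cmult) (use exps mk t in \<open>auto intro!: measurable_intros\<close>)
    also have "?d * head_b0 t = c * (D * ?Z)" by (simp only: Chi0_def ac_simps)
    also have "C * (C'' * (c * trunc_R t k + c * (D * ?Z))) = C * C'' * c * (trunc_R t k + D * ?Z)"
      by (simp only: distrib_left ac_simps)
    also have "\<dots> \<le> C * C'' * c * ((1 + D) * (trunc_R t k + ?Z))"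
      by (intro mult_left_mono) (auto simp: distrib_left distrib_right add_increasing2 add_increasing)
    also have "\<dots> = C * C'' * (1 + D) * (c * (trunc_R t k + ?Z))" by (simp only: ac_simps)
    finally have 1: "hnorm r0 {0<..<t} (\<lambda>s. b0 s * hnorm q0 {s<..} (integrand_R k')) \<le> C * C'' * (1 + D) * (c * (trunc_R t k + ?Z))" .
    have "hnorm r0 {t<..} (\<lambda>s. b0 s * hnorm q0 {s<..} (integrand_R k')) \<le> c * k t * D * hnorm r0 {t<..} (\<lambda>s. mon (- \<theta>) s * (b0 s * a0 s))"
    proof (rule hnorm_le_cmult[OF exps(1)])
      fix s assume "s \<in> {t<..}"
      then have "b0 s * hnorm q0 {s<..} (integrand_R k') \<le> b0 s * (c * k t * (D * (mon (- \<theta>) s * a0 s)))"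
        using t by (intro mult_left_mono tail) auto
      then show "b0 s * hnorm q0 {s<..} (integrand_R k') \<le> c * k t * D * (mon (- \<theta>) s * (b0 s * a0 s))" by (simp only: ac_simps)
    qed (use mk t in \<open>auto intro!: measurable_intros\<close>)
    also have "\<dots> \<le> c * k t * D * (D' * (mon (- \<theta>) t * (b0 t * a0 t)))"
      by (intro mult_left_mono D' t) simp
    also have "\<dots> = c * k t * D * (D' * (mon (- \<theta>) t * a0 t)) * b0 t" by (simp only: ac_simps)
    also have "\<dots> \<le> c * k t * D * (D' * (mon (- \<theta>) t * a0 t)) * (E * head_b0 t)"
      unfolding head_b0_def
      by (intro mult_left_mono order_trans[OF E(2)[OF t]] hnorm_subset) (use exps t in \<open>auto intro!: measurable_intros\<close>)
    also have "\<dots> = D * D' * E * (c * ?Z)" by (simp only: Chi0_def ac_simps)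
    also have "\<dots> \<le> D * D' * E * (c * (trunc_R t k + ?Z))" by (intro mult_left_mono) auto
    finally have 2: "hnorm r0 {t<..} (\<lambda>s. b0 s * hnorm q0 {s<..} (integrand_R k')) \<le> D * D' * E * (c * (trunc_R t k + ?Z))" .
    have "norm_R k' \<le> C' * (hnorm r0 {0<..<t} (\<lambda>s. b0 s * hnorm q0 {s<..} (integrand_R k')) + hnorm r0 {t<..} (\<lambda>s. b0 s * hnorm q0 {s<..} (integrand_R k')))"
      unfolding norm_R_def by (rule C'(2)[where t=t]) (use mk t in \<open>auto intro!: measurable_intros\<close>)
    also have "\<dots> \<le> C' * (C * C'' * (1 + D) * (c * (trunc_R t k + ?Z)) + D * D' * E * (c * (trunc_R t k + ?Z)))"
      by (intro mult_left_mono add_mono 1 2) simp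
    also have "\<dots> = ?M * c * (trunc_R t k + ?Z)" by (simp only: distrib_right mult.assoc)
    finally show "norm_R k' \<le> ?M * c * (trunc_R t k + ?Z)" .
  qed
qed

text \<open>To be applied with \<open>k = K(\<cdot>, f)\<close> and \<open>k' = K(\<cdot>, h)\<close>. Wherever \<open>u < t\<close> the linear bound on \<open>k'\<close> cancels the
  factor \<open>1/u\<close>, and the two parts of the outer interval reproduce the two terms of \<open>\<chi>\<^sub>1(t)\<close>.\<close>

lemma norm_L_le_trunc_L:
  obtains C where "C < top" "\<And>k k' c t. quasi_concave k \<Longrightarrow> quasi_concave k' \<Longrightarrow> 0 < t \<Longrightarrow>
     (\<And>u. t < u \<Longrightarrow> k' u \<le> c * k u) \<Longrightarrow> (\<And>u. 0 < u \<Longrightarrow> mon (- 1) u * k' u \<le> c * (mon (- 1) t * k t)) \<Longrightarrow>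
     norm_L k' \<le> C * c * (trunc_L t k + mon (- 1) t * k t * Chi1 t)"
proof -
  obtain C where C: "C < top" "\<And>f I J K t. pos_measurable f \<Longrightarrow> I \<subseteq> {0<..} \<Longrightarrow> J \<subseteq> {0<..} \<Longrightarrow> 
     I \<in> sets borel \<Longrightarrow> J \<in> sets borel \<Longrightarrow> K \<subseteq> {0<..} \<Longrightarrow> K \<in> sets borel \<Longrightarrow> K \<subseteq> insert t (I \<union> J) \<Longrightarrow>
    hnorm q1 K f \<le> C * (hnorm q1 I f + hnorm q1 J f)" using hnorm_cover[OF exps(4)] by blast
  obtain C' where C': "C' < top" "\<And>f I J K t. pos_measurable f \<Longrightarrow> I \<subseteq> {0<..} \<Longrightarrow> J \<subseteq> {0<..} \<Longrightarrow> 
     I \<in> sets borel \<Longrightarrow> J \<in> sets borel \<Longrightarrow> K \<subseteq> {0<..} \<Longrightarrow> K \<in> sets borel \<Longrightarrow> K \<subseteq> insert t (I \<union> J) \<Longrightarrow>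
    hnorm r1 K f \<le> C' * (hnorm r1 I f + hnorm r1 J f)" using hnorm_cover[OF exps(3)] by blast
  obtain C'' where C'': "C'' < top" "\<And>f g I. pos_measurable f \<Longrightarrow> pos_measurable g \<Longrightarrow> I \<subseteq> {0<..} \<Longrightarrow> I \<in> sets borel \<Longrightarrow>
    hnorm r1 I (\<lambda>u. f u + g u) \<le> C'' * (hnorm r1 I f + hnorm r1 I g)" using hnorm_add[OF exps(3)] by blast
  let ?M = "C' * (1 + C * C'')"
  show ?thesis
  proof (rule that[of ?M])
    show "?M < top" using C C' C'' by (simp add: ennreal_mult_less_top)
    fix k k' :: "real \<Rightarrow> ennreal" and c t
    assume k: "quasi_concave k" and k': "quasi_concave k'" and t: "0 < (t::real)"
      and le1: "\<And>u. t < u \<Longrightarrow> k' u \<le> c * k u"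
      and le2: "\<And>u. 0 < u \<Longrightarrow> mon (- 1) u * k' u \<le> c * (mon (- 1) t * k t)"
    note mk = quasi_concave_measurable[OF k] quasi_concave_measurable[OF k']
    let ?z = "mon (- 1) t * k t"
    have head: "hnorm q1 {0<..<s} (integrand_L k') \<le> c * ?z * head_a1 s" for s
      unfolding head_a1_def
    proof (rule hnorm_le_cmult[OF exps(4)])
      fix u assume "u \<in> {0<..<s}"
      then have "a1 u * (mon (- 1) u * k' u) \<le> a1 u * (c * ?z)"
        by (intro mult_left_mono le2) auto
      then show "integrand_L k' u \<le> c * ?z * a1 u" by (simp only: integrand_L_def ac_simps)
    qed (use mk in \<open>auto intro!: measurable_intros\<close>)
    have "hnorm r1 {0<..<t} (\<lambda>s. b1 s * hnorm q1 {0<..<s} (integrand_L k')) \<le> c * ?z * head_b1a1 t"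
      unfolding head_b1a1_def
    proof (rule hnorm_le_cmult[OF exps(3)])
      fix s
      have "b1 s * hnorm q1 {0<..<s} (integrand_L k') \<le> b1 s * (c * ?z * head_a1 s)"
        by (intro mult_left_mono head) auto
      then show "b1 s * hnorm q1 {0<..<s} (integrand_L k') \<le> c * ?z * (b1 s * head_a1 s)" by (simp only: ac_simps)
    qed (use mk t in \<open>auto intro!: measurable_intros\<close>)
    also have "\<dots> \<le> c * ?z * Chi1 t" unfolding Chi1_def by (intro mult_left_mono) auto
    also have "\<dots> \<le> c * (trunc_L t k + ?z * Chi1 t)" unfolding mult.assoc[of c] by (intro mult_left_mono) auto
    finally have 1: "hnorm r1 {0<..<t} (\<lambda>s. b1 s * hnorm q1 {0<..<s} (integrand_L k')) \<le> c * (trunc_L t k + ?z * Chi1 t)" .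
    let ?d = "c * ?z * head_a1 t"
    have "hnorm r1 {t<..} (\<lambda>s. b1 s * hnorm q1 {0<..<s} (integrand_L k'))
       \<le> C * hnorm r1 {t<..} (\<lambda>s. c * (b1 s * hnorm q1 {t<..<s} (integrand_L k)) + ?d * b1 s)"
    proof (rule hnorm_le_cmult[OF exps(3)])
      fix s assume s: "s \<in> {t<..}"
      have "hnorm q1 {t<..<s} (integrand_L k') \<le> c * hnorm q1 {t<..<s} (integrand_L k)"
      proof (rule hnorm_le_cmult[OF exps(4)])
        fix u assume "u \<in> {t<..<s}"
        then have "mon (- 1) u * a1 u * k' u \<le> mon (- 1) u * a1 u * (c * k u)"
          using s by (intro mult_left_mono le1) auto
        then show "integrand_L k' u \<le> c * integrand_L k u" by (simp only: integrand_L_def ac_simps)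
      qed (use mk s t in \<open>auto intro!: measurable_intros\<close>)
      then have "hnorm q1 {t<..<s} (integrand_L k') + hnorm q1 {0<..<t} (integrand_L k') \<le> c * hnorm q1 {t<..<s} (integrand_L k) + ?d"
        by (intro add_mono head)
      moreover have "hnorm q1 {0<..<s} (integrand_L k') \<le> C * (hnorm q1 {t<..<s} (integrand_L k') + hnorm q1 {0<..<t} (integrand_L k'))"
        by (rule C(2)[where t=t]) (use mk s t in \<open>auto intro!: measurable_intros\<close>)
      ultimately have "hnorm q1 {0<..<s} (integrand_L k') \<le> C * (c * hnorm q1 {t<..<s} (integrand_L k) + ?d)"
        by (blast intro: order_trans mult_left_mono zero_le)
      then have "b1 s * hnorm q1 {0<..<s} (integrand_L k') \<le> b1 s * (C * (c * hnorm q1 {t<..<s} (integrand_L k) + ?d))"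
        by (rule mult_left_mono) simp
      then show "b1 s * hnorm q1 {0<..<s} (integrand_L k') \<le> C * (c * (b1 s * hnorm q1 {t<..<s} (integrand_L k)) + ?d * b1 s)"
        by (simp only: distrib_left ac_simps)
    qed (use mk t in \<open>auto intro!: measurable_intros borel_measurable_add\<close>)
    also have "\<dots> \<le> C * (C'' * (hnorm r1 {t<..} (\<lambda>s. c * (b1 s * hnorm q1 {t<..<s} (integrand_L k))) + hnorm r1 {t<..} (\<lambda>s. ?d * b1 s)))"
      by (rule mult_left_mono, rule C'') (use mk t in \<open>auto intro!: measurable_intros\<close>)
    also have "hnorm r1 {t<..} (\<lambda>s. c * (b1 s * hnorm q1 {t<..<s} (integrand_L k))) = c * trunc_L t k"
      unfolding trunc_L_def by (rule hnorm_cmult) (use exps mk t in \<open>auto intro!: measurable_intros\<close>)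
    also have "hnorm r1 {t<..} (\<lambda>s. ?d * b1 s) = ?d * tail_b1 t"
      unfolding tail_b1_def by (rule hnorm_cmult) (use exps mk t in \<open>auto intro!: measurable_intros\<close>)
    also have "C * (C'' * (c * trunc_L t k + ?d * tail_b1 t)) = C * C'' * (c * (trunc_L t k + ?z * (tail_b1 t * head_a1 t)))"
      by (simp only: distrib_left ac_simps)
    also have "\<dots> \<le> C * C'' * (c * (trunc_L t k + ?z * Chi1 t))"
      unfolding Chi1_def by (intro mult_left_mono add_left_mono) auto
    finally have 2: "hnorm r1 {t<..} (\<lambda>s. b1 s * hnorm q1 {0<..<s} (integrand_L k')) \<le> C * C'' * (c * (trunc_L t k + ?z * Chi1 t))" .
    have "norm_L k' \<le> C' * (hnorm r1 {0<..<t} (\<lambda>s. b1 s * hnorm q1 {0<..<s} (integrand_L k')) + hnorm r1 {t<..} (\<lambda>s. b1 s * hnorm q1 {0<..<s} (integrand_L k')))"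
      unfolding norm_L_def by (rule C'(2)[where t=t]) (use mk t in \<open>auto intro!: measurable_intros\<close>)
    also have "\<dots> \<le> C' * (c * (trunc_L t k + ?z * Chi1 t) + C * C'' * (c * (trunc_L t k + ?z * Chi1 t)))"
      by (intro mult_left_mono add_mono 1 2) simp
    also have "\<dots> = ?M * c * (trunc_L t k + ?z * Chi1 t)" by (simp only: distrib_right mult.assoc mult_1_left)
    finally show "norm_L k' \<le> ?M * c * (trunc_L t k + ?z * Chi1 t)" .
  qed
qed

lemma trunc_R_le_norm_R:
  assumes "pos_measurable k" "0 < t" shows "trunc_R t k \<le> norm_R k"
proof -
  have "trunc_R t k \<le> hnorm r0 {0<..<t} (\<lambda>s. b0 s * hnorm q0 {s<..} (integrand_R k))"
    unfolding trunc_R_def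
    by (intro hnorm_mono mult_left_mono hnorm_subset) (use assms exps in \<open>auto intro!: measurable_intros\<close>)
  also have "\<dots> \<le> norm_R k" unfolding norm_R_def
    by (rule hnorm_subset) (use assms exps in \<open>auto intro!: measurable_intros\<close>)
  finally show ?thesis .
qed

lemma trunc_L_le_norm_L:
  assumes "pos_measurable k" "0 < t" shows "trunc_L t k \<le> norm_L k"
proof -
  have "trunc_L t k \<le> hnorm r1 {t<..} (\<lambda>s. b1 s * hnorm q1 {0<..<s} (integrand_L k))"
    unfolding trunc_L_def
    by (intro hnorm_mono mult_left_mono hnorm_subset) (use assms exps in \<open>auto intro!: measurable_intros\<close>)
  also have "\<dots> \<le> norm_L k" unfolding norm_L_def
    by (rule hnorm_subset) (use assms exps in \<open>auto intro!: measurable_intros\<close>)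
  finally show ?thesis .
qed

lemma integrand_le:
  assumes "k u \<le> c * (k1 u + k2 u)"
  shows "integrand_R k u \<le> c * (integrand_R k1 u + integrand_R k2 u)" "integrand_L k u \<le> c * (integrand_L k1 u + integrand_L k2 u)"
proof -
  have *: "m * (a * k u) \<le> c * (m * (a * k1 u) + m * (a * k2 u))" for m a
  proof -
    have "m * (a * k u) \<le> m * (a * (c * (k1 u + k2 u)))" using assms by (intro mult_left_mono) auto
    then show ?thesis by (simp only: distrib_left ac_simps)
  qed
  show "integrand_R k u \<le> c * (integrand_R k1 u + integrand_R k2 u)" "integrand_L k u \<le> c * (integrand_L k1 u + integrand_L k2 u)"
    unfolding integrand_R_def integrand_L_def by (rule *)+
qed

text \<open>The lower half of the interpolation formula, as a statement about functions: each truncated norm is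
  estimated by its own full norm on one summand and by the other norm on the other summand.
  The number \<open>\<rho>\<close> enters through the equation \<open>\<rho> \<chi>\<^sub>1(t) = t\<^bsup>1-\<theta>\<^esup> \<chi>\<^sub>0(t)\<close>, which keeps
  division out of the estimates.\<close>

lemma truncated_norms_le:
  obtains C where "C < top"
    "\<And>k k1 k2 c t \<rho>. quasi_concave k \<Longrightarrow> quasi_concave k1 \<Longrightarrow> quasi_concave k2 \<Longrightarrow> 0 < t \<Longrightarrow>
      Chi1 t \<noteq> 0 \<Longrightarrow> Chi1 t \<noteq> top \<Longrightarrow> \<rho> * Chi1 t = mon (1 - \<theta>) t * Chi0 t \<Longrightarrow>
      (\<And>u. 0 < u \<Longrightarrow> k u \<le> c * (k1 u + k2 u)) \<Longrightarrow>
      trunc_R t k + \<rho> * trunc_L t k \<le> C * c * (norm_R k1 + \<rho> * norm_L k2)"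
proof -
  obtain C1 where C1: "C1 < top" "\<And>k t. quasi_concave k \<Longrightarrow> 0 < t \<Longrightarrow> Chi1 t * trunc_R t k \<le> C1 * (mon (1 - \<theta>) t * Chi0 t * norm_L k)"
    using trunc_R_le_norm_L by blast
  obtain C2 where C2: "C2 < top" "\<And>k t. quasi_concave k \<Longrightarrow> 0 < t \<Longrightarrow> Chi0 t * trunc_L t k \<le> C2 * (mon (\<theta> - 1) t * Chi1 t * norm_R k)"
    using trunc_L_le_norm_R by blast
  note ia = hnorm_iterated_add[OF exps(1,2) measurable_weights(1)] hnorm_iterated_add[OF exps(3,4) measurable_weights(3)]
  obtain D1 where D1: "D1 < top"
    "\<And>k k1 k2 c t. pos_measurable k \<Longrightarrow> pos_measurable k1 \<Longrightarrow> pos_measurable k2 \<Longrightarrow> 0 < t \<Longrightarrow>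
      (\<And>u. 0 < u \<Longrightarrow> k u \<le> c * (k1 u + k2 u)) \<Longrightarrow> trunc_R t k \<le> D1 * c * (trunc_R t k1 + trunc_R t k2)"
  proof (rule ia(1))
    fix C assume C: "C < top" and *: "\<And>g integrand_L g2 c I J. pos_measurable g \<Longrightarrow> pos_measurable integrand_L \<Longrightarrow> pos_measurable g2 \<Longrightarrow>
      (\<And>u. 0 < u \<Longrightarrow> g u \<le> c * (integrand_L u + g2 u)) \<Longrightarrow> I \<subseteq> {0<..} \<Longrightarrow> I \<in> sets borel \<Longrightarrow>
      (\<And>s. s \<in> I \<Longrightarrow> J s \<subseteq> {0<..}) \<Longrightarrow> (\<And>s. J s \<in> sets borel) \<Longrightarrow>
      (\<And>f. pos_measurable f \<Longrightarrow> pos_measurable (\<lambda>s. hnorm q0 (J s) f)) \<Longrightarrow>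
      hnorm r0 I (\<lambda>s. b0 s * hnorm q0 (J s) g)
        \<le> C * c * (hnorm r0 I (\<lambda>s. b0 s * hnorm q0 (J s) integrand_L) + hnorm r0 I (\<lambda>s. b0 s * hnorm q0 (J s) g2))"
    show thesis
    proof (rule that[OF C])
      fix k k1 k2 c t assume m: "pos_measurable k" "pos_measurable k1" "pos_measurable k2" and t: "0 < (t::real)"
       and le: "\<And>u. 0 < u \<Longrightarrow> k u \<le> c * (k1 u + k2 u)"
      show "trunc_R t k \<le> C * c * (trunc_R t k1 + trunc_R t k2)" unfolding trunc_R_def
        by (rule *) (use m le integrand_le(1) in \<open>auto intro!: measurable_integrand pos_measurable_hnorm exps\<close>)
    qed
  qed
  obtain D2 where D2: "D2 < top"
    "\<And>k k1 k2 c t. pos_measurable k \<Longrightarrow> pos_measurable k1 \<Longrightarrow> pos_measurable k2 \<Longrightarrow> 0 < t \<Longrightarrow>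
      (\<And>u. 0 < u \<Longrightarrow> k u \<le> c * (k1 u + k2 u)) \<Longrightarrow> trunc_L t k \<le> D2 * c * (trunc_L t k1 + trunc_L t k2)"
  proof (rule ia(2))
    fix C assume C: "C < top" and *: "\<And>g integrand_L g2 c I J. pos_measurable g \<Longrightarrow> pos_measurable integrand_L \<Longrightarrow> pos_measurable g2 \<Longrightarrow>
      (\<And>u. 0 < u \<Longrightarrow> g u \<le> c * (integrand_L u + g2 u)) \<Longrightarrow> I \<subseteq> {0<..} \<Longrightarrow> I \<in> sets borel \<Longrightarrow>
      (\<And>s. s \<in> I \<Longrightarrow> J s \<subseteq> {0<..}) \<Longrightarrow> (\<And>s. J s \<in> sets borel) \<Longrightarrow>
      (\<And>f. pos_measurable f \<Longrightarrow> pos_measurable (\<lambda>s. hnorm q1 (J s) f)) \<Longrightarrow>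
      hnorm r1 I (\<lambda>s. b1 s * hnorm q1 (J s) g)
        \<le> C * c * (hnorm r1 I (\<lambda>s. b1 s * hnorm q1 (J s) integrand_L) + hnorm r1 I (\<lambda>s. b1 s * hnorm q1 (J s) g2))"
    show thesis
    proof (rule that[OF C])
      fix k k1 k2 c t assume m: "pos_measurable k" "pos_measurable k1" "pos_measurable k2" and t: "0 < (t::real)"
       and le: "\<And>u. 0 < u \<Longrightarrow> k u \<le> c * (k1 u + k2 u)"
      show "trunc_L t k \<le> C * c * (trunc_L t k1 + trunc_L t k2)" unfolding trunc_L_def
        by (rule *) (use m le integrand_le(2) t in \<open>auto intro!: measurable_integrand pos_measurable_hnorm exps\<close>)
    qed
  qed
  let ?M = "D1 * (1 + C1) + D2 * (1 + C2)"
  show ?thesis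
  proof (rule that[of ?M])
    show "?M < top" using C1 C2 D1 D2 by (simp add: ennreal_mult_less_top)
    fix k k1 k2 :: "real \<Rightarrow> ennreal" and c t \<rho>
    assume k: "quasi_concave k" "quasi_concave k1" "quasi_concave k2" and t: "0 < (t::real)"
      and Chi1: "Chi1 t \<noteq> 0" "Chi1 t \<noteq> top" and \<rho>: "\<rho> * Chi1 t = mon (1 - \<theta>) t * Chi0 t"
      and le: "\<And>u. 0 < u \<Longrightarrow> k u \<le> c * (k1 u + k2 u)"
    note mk = k[THEN quasi_concave_measurable]
    have cancel: "x \<le> y" if "Chi1 t * x \<le> Chi1 t * y" for x y
      using that Chi1 by (simp add: ennreal_mult_le_mult_iff)
    have "Chi1 t * trunc_R t k2 \<le> C1 * (mon (1 - \<theta>) t * Chi0 t * norm_L k2)" by (rule C1(2)[OF k(3) t])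
    also have "\<dots> = Chi1 t * (C1 * (\<rho> * norm_L k2))"
      by (subst \<rho>[symmetric]) (simp only: ac_simps)
    finally have 1: "trunc_R t k2 \<le> C1 * (\<rho> * norm_L k2)" by (rule cancel)
    have "Chi1 t * (\<rho> * trunc_L t k1) = mon (1 - \<theta>) t * (Chi0 t * trunc_L t k1)" 
      using arg_cong[OF \<rho>, of "\<lambda>x. x * trunc_L t k1"] by (simp only: ac_simps)
    also have "\<dots> \<le> mon (1 - \<theta>) t * (C2 * (mon (\<theta> - 1) t * Chi1 t * norm_R k1))"
      by (intro mult_left_mono C2 k t) simp
    also have "\<dots> = mon (1 - \<theta>) t * (mon (- (1 - \<theta>)) t * (Chi1 t * (C2 * norm_R k1)))" by (simp add: ac_simps)
    also have "\<dots> = Chi1 t * (C2 * norm_R k1)" using t by (rule mon_cancel)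
    finally have 2: "\<rho> * trunc_L t k1 \<le> C2 * norm_R k1" by (rule cancel)
    let ?S = "norm_R k1 + \<rho> * norm_L k2"
    have "trunc_R t k \<le> D1 * c * (trunc_R t k1 + trunc_R t k2)" by (rule D1(2)[OF mk t le])
    also have "\<dots> \<le> D1 * c * (norm_R k1 + C1 * (\<rho> * norm_L k2))"
      by (intro mult_left_mono add_mono 1 trunc_R_le_norm_R mk t) simp
    also have "\<dots> \<le> D1 * c * ((1 + C1) * ?S)"
      by (intro mult_left_mono) (auto simp: distrib_left distrib_right add_increasing2 add_increasing intro!: add_mono)
    finally have 3: "trunc_R t k \<le> D1 * (1 + C1) * (c * ?S)" by (simp only: ac_simps)
    have "\<rho> * trunc_L t k \<le> \<rho> * (D2 * c * (trunc_L t k1 + trunc_L t k2))" by (intro mult_left_mono D2(2)[OF mk t le]) simp_all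
    also have "\<dots> = D2 * c * (\<rho> * trunc_L t k1 + \<rho> * trunc_L t k2)" by (simp only: distrib_left ac_simps)
    also have "\<dots> \<le> D2 * c * (C2 * norm_R k1 + \<rho> * norm_L k2)"
      by (intro mult_left_mono add_mono 2 trunc_L_le_norm_L mk t) simp_all
    also have "\<dots> \<le> D2 * c * ((1 + C2) * ?S)"
      by (intro mult_left_mono) (auto simp: distrib_left distrib_right add_increasing2 add_increasing intro!: add_mono)
    finally have 4: "\<rho> * trunc_L t k \<le> D2 * (1 + C2) * (c * ?S)" by (simp only: ac_simps)
    have "trunc_R t k + \<rho> * trunc_L t k \<le> D1 * (1 + C1) * (c * ?S) + D2 * (1 + C2) * (c * ?S)" by (rule add_mono[OF 3 4])
    then show "trunc_R t k + \<rho> * trunc_L t k \<le> ?M * c * ?S" by (simp only: distrib_right mult.assoc)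
  qed
qed

text \<open>The upper half of the interpolation formula, as a statement about functions. By the equation for \<open>\<rho>\<close>,
  both extra terms turn into \<open>t\<^bsup>-\<theta>\<^esup> \<chi>\<^sub>0(t) k t\<close>, which the truncated \<open>R\<close>-norm absorbs.\<close>

lemma norms_le_truncated:
  obtains C where "C < top"
    "\<And>k k1 k2 c t \<rho>. quasi_concave k \<Longrightarrow> quasi_concave k1 \<Longrightarrow> quasi_concave k2 \<Longrightarrow> 0 < t \<Longrightarrow>
      \<rho> * Chi1 t = mon (1 - \<theta>) t * Chi0 t \<Longrightarrow>
      (\<And>u. 0 < u \<Longrightarrow> u < t \<Longrightarrow> k1 u \<le> c * k u) \<Longrightarrow> (\<And>u. 0 < u \<Longrightarrow> k1 u \<le> c * k t) \<Longrightarrow>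
      (\<And>u. t < u \<Longrightarrow> k2 u \<le> c * k u) \<Longrightarrow> (\<And>u. 0 < u \<Longrightarrow> mon (- 1) u * k2 u \<le> c * (mon (- 1) t * k t)) \<Longrightarrow>
      norm_R k1 + \<rho> * norm_L k2 \<le> C * c * (trunc_R t k + \<rho> * trunc_L t k)"
proof -
  obtain C where C: "C < top" "\<And>k t. quasi_concave k \<Longrightarrow> 0 < t \<Longrightarrow> mon (- \<theta>) t * k t * Chi0 t \<le> C * trunc_R t k"
    using Chi0_mult_le_trunc_R by blast
  obtain D where D: "D < top" "\<And>k k' c t. quasi_concave k \<Longrightarrow> quasi_concave k' \<Longrightarrow> 0 < t \<Longrightarrow>
     (\<And>u. 0 < u \<Longrightarrow> u < t \<Longrightarrow> k' u \<le> c * k u) \<Longrightarrow> (\<And>u. 0 < u \<Longrightarrow> k' u \<le> c * k t) \<Longrightarrow>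
     norm_R k' \<le> D * c * (trunc_R t k + mon (- \<theta>) t * k t * Chi0 t)" using norm_R_le_trunc_R by blast
  obtain E where E: "E < top" "\<And>k k' c t. quasi_concave k \<Longrightarrow> quasi_concave k' \<Longrightarrow> 0 < t \<Longrightarrow>
     (\<And>u. t < u \<Longrightarrow> k' u \<le> c * k u) \<Longrightarrow> (\<And>u. 0 < u \<Longrightarrow> mon (- 1) u * k' u \<le> c * (mon (- 1) t * k t)) \<Longrightarrow>
     norm_L k' \<le> E * c * (trunc_L t k + mon (- 1) t * k t * Chi1 t)" using norm_L_le_trunc_L by blast
  let ?M = "(D + E) * (1 + C)"
  show ?thesis
  proof (rule that[of ?M])
    show "?M < top" using C D E by (simp add: ennreal_mult_less_top)
    fix k k1 k2 :: "real \<Rightarrow> ennreal" and c t \<rho>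
    assume k: "quasi_concave k" "quasi_concave k1" "quasi_concave k2" and t: "0 < (t::real)"
      and \<rho>: "\<rho> * Chi1 t = mon (1 - \<theta>) t * Chi0 t"
      and le: "\<And>u. 0 < u \<Longrightarrow> u < t \<Longrightarrow> k1 u \<le> c * k u" "\<And>u. 0 < u \<Longrightarrow> k1 u \<le> c * k t"
       "\<And>u. t < u \<Longrightarrow> k2 u \<le> c * k u" "\<And>u. 0 < u \<Longrightarrow> mon (- 1) u * k2 u \<le> c * (mon (- 1) t * k t)"
    let ?Z = "mon (- \<theta>) t * k t * Chi0 t" and ?S = "trunc_R t k + \<rho> * trunc_L t k"
    have Z: "?Z \<le> C * trunc_R t k" by (rule C(2)[OF k(1) t])
    have "C * trunc_R t k \<le> C * ?S" by (intro mult_left_mono) auto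
    then have ZS: "x + ?Z \<le> (1 + C) * ?S" if "x \<le> ?S" for x
      using add_mono[OF that order_trans[OF Z]] by (simp only: distrib_right mult_1_left)
    have le1: "trunc_R t k + ?Z \<le> (1 + C) * ?S" "\<rho> * trunc_L t k + ?Z \<le> (1 + C) * ?S"
      by (intro ZS, simp)+
    have "norm_R k1 \<le> D * c * (trunc_R t k + ?Z)" by (rule D(2)[OF k(1,2) t le(1,2)])
    also have "\<dots> \<le> D * c * ((1 + C) * ?S)" by (rule mult_left_mono[OF le1(1)]) simp
    finally have 1: "norm_R k1 \<le> D * c * ((1 + C) * ?S)" .
    have m: "mon (- \<theta>) t = mon (- 1) t * mon (1 - \<theta>) t" using t by (simp add: mon_mult)
    have "\<rho> * (mon (- 1) t * k t * Chi1 t) = mon (- 1) t * k t * (\<rho> * Chi1 t)" by (simp only: ac_simps)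
    also have "\<dots> = ?Z" unfolding \<rho> m by (simp only: ac_simps)
    finally have Zr: "\<rho> * (mon (- 1) t * k t * Chi1 t) = ?Z" .
    have "\<rho> * norm_L k2 \<le> \<rho> * (E * c * (trunc_L t k + mon (- 1) t * k t * Chi1 t))"
      by (rule mult_left_mono[OF E(2)[OF k(1,3) t le(3,4)]]) simp_all
    also have "\<dots> = E * c * (\<rho> * trunc_L t k + \<rho> * (mon (- 1) t * k t * Chi1 t))" by (simp only: distrib_left ac_simps)
    also have "\<dots> \<le> E * c * ((1 + C) * ?S)" unfolding Zr by (rule mult_left_mono[OF le1(2)]) simp
    finally have 2: "\<rho> * norm_L k2 \<le> E * c * ((1 + C) * ?S)" .
    have "norm_R k1 + \<rho> * norm_L k2 \<le> D * c * ((1 + C) * ?S) + E * c * ((1 + C) * ?S)" by (rule add_mono[OF 1 2])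
    also have "\<dots> = (D + E) * c * ((1 + C) * ?S)" by (simp only: distrib_right)
    also have "\<dots> = ?M * c * ?S" by (simp only: ac_simps)
    finally show "norm_R k1 + \<rho> * norm_L k2 \<le> ?M * c * ?S" .
  qed
qed

lemma Chi0_pos:
  assumes "\<And>t. 0 < t \<Longrightarrow> 0 < a0 t" "\<And>t. 0 < t \<Longrightarrow> 0 < b0 t" "0 < t"
  shows "Chi0 t \<noteq> 0"
proof -
  obtain C where C: "C < top" "\<And>t. 0 < t \<Longrightarrow> b0 t \<le> C * hnorm r0 {t / 2<..<t} b0"
    using slow_le_hnorm[OF exps(1) slow(1)] by metis
  have "hnorm r0 {t / 2<..<t} b0 \<le> head_b0 t" unfolding head_b0_def
    by (rule hnorm_subset) (use exps assms in \<open>auto intro!: measurable_intros\<close>)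
  then have "head_b0 t \<noteq> 0" using C(2)[OF assms(3)] assms(2)[OF assms(3)] by auto
  then show ?thesis using assms(1)[OF assms(3)] by (auto simp: Chi0_def)
qed

lemma Chi1_pos:
  assumes "\<And>t. 0 < t \<Longrightarrow> 0 < a1 t" "\<And>t. 0 < t \<Longrightarrow> 0 < b1 t" "0 < t"
  shows "Chi1 t \<noteq> 0"
proof -
  obtain C where C: "C < top" "\<And>t. 0 < t \<Longrightarrow> a1 t \<le> C * hnorm q1 {t / 2<..<t} a1"
    using slow_le_hnorm[OF exps(4) slow(4)] by metis
  have "hnorm q1 {t / 2<..<t} a1 \<le> head_a1 t" unfolding head_a1_def
    by (rule hnorm_subset) (use exps assms in \<open>auto intro!: measurable_intros\<close>)
  then have A: "head_a1 t \<noteq> 0" using C(2)[OF assms(3)] assms(1)[OF assms(3)] by auto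
  obtain D where D: "D < top" "\<And>t. 0 < t \<Longrightarrow> b1 t \<le> D * hnorm r1 {t<..<2 * t} b1"
    using slow_le_hnorm[OF exps(3) slow(3)] by metis
  have "hnorm r1 {t<..<2 * t} b1 \<le> tail_b1 t" unfolding tail_b1_def
    by (rule hnorm_subset) (use exps assms in \<open>auto intro!: measurable_intros\<close>)
  then have "tail_b1 t \<noteq> 0" using D(2)[OF assms(3)] assms(2)[OF assms(3)] by auto
  then show ?thesis using A by (auto simp: Chi1_def)
qed

text \<open>If the norm of \<open>a\<^sub>1\<close> over \<open>(0, 1/2)\<close> were infinite, then so would be the iterated norm over
  \<open>(0, 1)\<close>, as \<open>b\<^sub>1\<close> does not vanish on \<open>(1/2, 1)\<close>. Finiteness at one point then suffices.\<close>

lemma Chi1_finite: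
  assumes "\<And>t. 0 < t \<Longrightarrow> 0 < b1 t" "tail_b1 1 < top" "head_b1a1 1 < top" "0 < t"
  shows "Chi1 t \<noteq> top"
proof -
  obtain C where C: "C < top" "\<And>t. 0 < t \<Longrightarrow> b1 t \<le> C * hnorm r1 {t / 2<..<t} b1"
    using slow_le_hnorm[OF exps(3) slow(3)] by metis
  have "head_a1 (1/2) * hnorm r1 {1 / 2<..<1} b1 \<le> hnorm r1 {1 / 2<..<1} (\<lambda>s. b1 s * head_a1 s)"
  proof (rule hnorm_ge_cmult[OF exps(3)])
    fix s :: real assume "s \<in> {1 / 2<..<1}"
    then have "head_a1 (1 / 2) \<le> head_a1 s" unfolding head_a1_def
      by (intro hnorm_subset) (use exps in \<open>auto intro!: measurable_intros\<close>)
    then show "head_a1 (1 / 2) * b1 s \<le> b1 s * head_a1 s" by (simp add: mult.commute mult_left_mono)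
  qed (auto intro!: measurable_intros)
  also have "\<dots> \<le> head_b1a1 1" unfolding head_b1a1_def by (rule hnorm_subset) (use exps in \<open>auto intro!: measurable_intros\<close>)
  finally have "head_a1 (1/2) * hnorm r1 {1 / 2<..<1} b1 < top" using assms(3) by (rule le_less_trans)
  moreover have "hnorm r1 {1 / 2<..<1} b1 \<noteq> 0" using C(2)[of 1] assms(1)[of 1] by auto
  ultimately have "head_a1 (1/2) < top" by (auto simp: ennreal_mult_less_top)
  then have "Chi1 (1/2) < top"
    unfolding Chi1_def using slow_finite[OF slow_head_b1a1 assms(3), of "1/2"] slow_finite[OF slow_tail_b1 assms(2), of "1/2"]
    by (simp add: ennreal_mult_less_top)
  then show ?thesis using slow_finite[OF slow_Chi1, of "1/2" t] assms(4) by simp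
qed

end

section \<open>The K-functional of a quasi-normed couple\<close>

lemma ennreal_less_add: "x < top \<Longrightarrow> 0 < e \<Longrightarrow> x < x + (e::ennreal)"
  using ennreal_add_left_cancel_less[of x 0 e] by simp

lemma K_functional_le:
  assumes "g \<in> carr X" "h \<in> carr Y"
  shows "K_functional X Y t (g + h) \<le> qnorm X g + t * qnorm Y h"
  unfolding K_functional_def using assms by (intro Inf_lower) blast

lemma K_functional_greatest:
  assumes "\<And>g h. g \<in> carr X \<Longrightarrow> h \<in> carr Y \<Longrightarrow> f = g + h \<Longrightarrow> z \<le> qnorm X g + t * qnorm Y h"
  shows "z \<le> K_functional X Y t f"
  unfolding K_functional_def using assms by (intro Inf_greatest) auto

lemma K_functional_approx:
  assumes "K_functional X Y t f < z"
  obtains g h where "g \<in> carr X" "h \<in> carr Y" "f = g + h" "qnorm X g + t * qnorm Y h < z"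
  using assms unfolding K_functional_def Inf_less_iff by blast

text \<open>For a fixed decomposition, the sum \<open>\<parallel>g\<parallel> + u \<parallel>h\<parallel>\<close> increases in \<open>u\<close> and its quotient by \<open>u\<close>
  decreases; both properties pass to the infimum.\<close>

lemma quasi_concave_K: "quasi_concave (\<lambda>u. K_functional X Y (ennreal u) f)"
  unfolding quasi_concave_def
proof (intro allI impI conjI)
  fix u v :: real assume uv: "0 < u" "u \<le> v"
  show "K_functional X Y (ennreal u) f \<le> K_functional X Y (ennreal v) f"
  proof (rule K_functional_greatest)
    fix g h assume "g \<in> carr X" "h \<in> carr Y" "f = g + h"
    then have "K_functional X Y (ennreal u) f \<le> qnorm X g + ennreal u * qnorm Y h"
      using K_functional_le by blast
    also have "\<dots> \<le> qnorm X g + ennreal v * qnorm Y h"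
      using uv by (intro add_left_mono mult_right_mono ennreal_leI) auto
    finally show "K_functional X Y (ennreal u) f \<le> qnorm X g + ennreal v * qnorm Y h" .
  qed
  have "mon 1 u * (mon (- 1) v * K_functional X Y (ennreal v) f) \<le> K_functional X Y (ennreal u) f"
  proof (rule K_functional_greatest)
    fix g h assume "g \<in> carr X" "h \<in> carr Y" "f = g + h"
    then have "K_functional X Y (ennreal v) f \<le> qnorm X g + mon 1 v * qnorm Y h"
      using K_functional_le[of g X h Y "ennreal v"] uv by (simp add: mon_1)
    then have "mon 1 u * (mon (- 1) v * K_functional X Y (ennreal v) f) \<le> mon 1 u * (mon (- 1) v * (qnorm X g + mon 1 v * qnorm Y h))"
      by (intro mult_left_mono) auto
    also have "\<dots> = mon 1 u * (mon (- 1) v * qnorm X g) + mon 1 u * qnorm Y h"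
      using uv by (simp add: distrib_left mon_cancel)
    also have "mon 1 u * (mon (- 1) v * qnorm X g) \<le> mon 1 v * (mon (- 1) v * qnorm X g)"
      using uv by (intro mult_right_mono mon_mono) auto
    also have "\<dots> = qnorm X g" using uv by (simp add: mon_cancel)
    finally show "mon 1 u * (mon (- 1) v * K_functional X Y (ennreal v) f) \<le> qnorm X g + ennreal u * qnorm Y h"
      using uv by (simp add: mon_1 add_right_mono)
  qed
  then have "mon (- 1) u * (mon 1 u * (mon (- 1) v * K_functional X Y (ennreal v) f)) \<le> mon (- 1) u * K_functional X Y (ennreal u) f"
    by (rule mult_left_mono) simp
  then show "mon (- 1) v * K_functional X Y (ennreal v) f \<le> mon (- 1) u * K_functional X Y (ennreal u) f"
    using uv by (simp add: mon_cancel)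
qed

lemma quasi_normed_subspace: "quasi_normed X \<Longrightarrow> subspace (carr X)"
  unfolding quasi_normed_def by (elim conjE)

lemma quasi_normed_finite: "quasi_normed X \<Longrightarrow> x \<in> carr X \<Longrightarrow> qnorm X x < top"
  unfolding quasi_normed_def by (elim conjE) (rule bspec)

lemma quasi_normed_triangle:
  assumes "quasi_normed X"
  obtains C :: real where "C \<ge> 1"
    "\<And>x y. x \<in> carr X \<Longrightarrow> y \<in> carr X \<Longrightarrow> qnorm X (x + y) \<le> ennreal C * (qnorm X x + qnorm X y)"
proof -
  have "\<exists>C::real. C \<ge> 1 \<and> (\<forall>x\<in>carr X. \<forall>y\<in>carr X. qnorm X (x + y) \<le> ennreal C * (qnorm X x + qnorm X y))"
    using assms unfolding quasi_normed_def by (elim conjE)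
  then show ?thesis using that by metis
qed

lemma quasi_normed_zero: "quasi_normed X \<Longrightarrow> 0 \<in> carr X \<and> qnorm X 0 = 0"
  by (auto simp: quasi_normed_def subspace_0)

lemma quasi_normed_minus:
  assumes "quasi_normed X" "x \<in> carr X"
  shows "- x \<in> carr X \<and> qnorm X (- x) = qnorm X x"
proof -
  note sub = quasi_normed_subspace[OF assms(1)]
  have hom: "\<forall>c. \<forall>x\<in>carr X. qnorm X (c *\<^sub>R x) = ennreal \<bar>c\<bar> * qnorm X x"
    using assms(1) unfolding quasi_normed_def by (elim conjE)
  have "qnorm X ((- 1) *\<^sub>R x) = ennreal \<bar>- 1\<bar> * qnorm X x" by (rule hom[rule_format, OF assms(2)])
  then have "qnorm X (- x) = qnorm X x" by simp
  moreover have "- x \<in> carr X" by (rule subspace_neg[OF sub assms(2)])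
  ultimately show ?thesis by blast
qed

text \<open>Add decompositions of \<open>f\<close> and \<open>g\<close> that are optimal up to an error, chosen so small
  that after multiplication with the constant the total error is \<open>e\<close>.\<close>

lemma K_functional_triangle:
  assumes X: "quasi_normed X" and Y: "quasi_normed Y"
  obtains D where "1 \<le> D" "D < top" "\<And>t f g. t < top \<Longrightarrow> f \<in> carr X + carr Y \<Longrightarrow> g \<in> carr X + carr Y \<Longrightarrow>
    K_functional X Y t (f + g) \<le> D * (K_functional X Y t f + K_functional X Y t g)"
proof -
  note sX = quasi_normed_subspace[OF X] and sY = quasi_normed_subspace[OF Y]
  obtain C0 where C0: "C0 \<ge> 1" "\<And>x y. x \<in> carr X \<Longrightarrow> y \<in> carr X \<Longrightarrow> qnorm X (x + y) \<le> ennreal C0 * (qnorm X x + qnorm X y)"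
    using quasi_normed_triangle[OF X] by metis
  obtain C1 where C1: "C1 \<ge> 1" "\<And>x y. x \<in> carr Y \<Longrightarrow> y \<in> carr Y \<Longrightarrow> qnorm Y (x + y) \<le> ennreal C1 * (qnorm Y x + qnorm Y y)"
    using quasi_normed_triangle[OF Y] by metis
  let ?D = "ennreal (max C0 C1)"
  show ?thesis
  proof (rule that[of ?D])
    show "1 \<le> ?D" using C0 by (simp add: le_max_iff_disj)
    show "?D < top" by simp
    fix t :: ennreal and f g assume t: "t < top" and fg: "f \<in> carr X + carr Y" "g \<in> carr X + carr Y"
    have fin: "K_functional X Y t f < top" if f: "f \<in> carr X + carr Y" for f
    proof -
      obtain a b where ab: "a \<in> carr X" "b \<in> carr Y" "f = a + b" using f by (elim set_plus_elim)
      then have "K_functional X Y t f \<le> qnorm X a + t * qnorm Y b" using K_functional_le by blast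
      also have "\<dots> < top" using ab t quasi_normed_finite[OF X] quasi_normed_finite[OF Y] by (simp add: ennreal_mult_less_top)
      finally show ?thesis .
    qed
    have "K_functional X Y t (f + g) \<le> ?D * (K_functional X Y t f + K_functional X Y t g) + ennreal e" if e: "0 < e" for e
    proof -
      let ?e = "ennreal (e / (2 * max C0 C1))"
      have m: "max C0 C1 > 0" using C0 by auto
      have e': "?e > 0" using e m by simp
      have "K_functional X Y t f < K_functional X Y t f + ?e" "K_functional X Y t g < K_functional X Y t g + ?e"
        using fin[OF fg(1)] fin[OF fg(2)] e' by (auto intro: ennreal_less_add)
      then obtain a b c d where ab: "a \<in> carr X" "b \<in> carr Y" "f = a + b" "qnorm X a + t * qnorm Y b < K_functional X Y t f + ?e"
        and cd: "c \<in> carr X" "d \<in> carr Y" "g = c + d" "qnorm X c + t * qnorm Y d < K_functional X Y t g + ?e"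
        by (metis K_functional_approx)
      have fg_eq: "f + g = (a + c) + (b + d)" using ab cd by simp
      have "K_functional X Y t (f + g) \<le> qnorm X (a + c) + t * qnorm Y (b + d)"
        unfolding fg_eq by (intro K_functional_le subspace_add sX sY ab cd)
      also have "\<dots> \<le> ?D * (qnorm X a + qnorm X c) + t * (?D * (qnorm Y b + qnorm Y d))"
        by (intro add_mono mult_left_mono order_trans[OF C0(2)] order_trans[OF C1(2)] mult_right_mono ennreal_leI ab cd) auto
      also have "\<dots> = ?D * ((qnorm X a + t * qnorm Y b) + (qnorm X c + t * qnorm Y d))"
        by (simp only: distrib_left ac_simps)
      also have "\<dots> \<le> ?D * ((K_functional X Y t f + ?e) + (K_functional X Y t g + ?e))"
        by (intro mult_left_mono add_mono[OF less_imp_le[OF ab(4)] less_imp_le[OF cd(4)]]) simp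
      also have "\<dots> = ?D * (K_functional X Y t f + K_functional X Y t g) + ?D * (?e + ?e)"
        by (simp only: distrib_left ac_simps)
      also have "?D * (?e + ?e) = ennreal e"
        using e m by (simp flip: ennreal_plus ennreal_mult)
      finally show ?thesis .
    qed
    then show "K_functional X Y t (f + g) \<le> ?D * (K_functional X Y t f + K_functional X Y t g)"
      by (rule ennreal_le_epsilon)
  qed
qed

text \<open>If \<open>K(t, f) > 0\<close>, a decomposition with \<open>\<parallel>g\<parallel> + t \<parallel>h\<parallel> < 2 K(t, f)\<close> exists. It bounds \<open>K(u, g)\<close>
  by \<open>\<parallel>g\<parallel>\<close> and \<open>K(u, h)\<close> by \<open>u \<parallel>h\<parallel>\<close>, and the other two bounds follow by writing \<open>g = f - h\<close>
  and \<open>h = f - g\<close> and using quasi-concavity. If \<open>K(t, f) = 0\<close>, then \<open>K(\<cdot>, f)\<close> vanishes identically,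
  and \<open>g = f\<close>, \<open>h = 0\<close> will do.\<close>

lemma near_optimal_decomposition:
  assumes X: "quasi_normed X" and Y: "quasi_normed Y"
  obtains c where "c < top" "\<And>f t. f \<in> carr X + carr Y \<Longrightarrow> 0 < t \<Longrightarrow>
    \<exists>g h. g \<in> carr X + carr Y \<and> h \<in> carr X + carr Y \<and> f = g + h \<and>
      (\<forall>u. 0 < u \<longrightarrow> u < t \<longrightarrow> K_functional X Y (ennreal u) g \<le> c * K_functional X Y (ennreal u) f) \<and>
      (\<forall>u>0. K_functional X Y (ennreal u) g \<le> c * K_functional X Y (ennreal t) f) \<and>
      (\<forall>u>t. K_functional X Y (ennreal u) h \<le> c * K_functional X Y (ennreal u) f) \<and>
      (\<forall>u>0. mon (- 1) u * K_functional X Y (ennreal u) h \<le> c * (mon (- 1) t * K_functional X Y (ennreal t) f))"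
proof -
  obtain D where D: "1 \<le> D" "D < top" "\<And>t f g. t < top \<Longrightarrow> f \<in> carr X + carr Y \<Longrightarrow> g \<in> carr X + carr Y \<Longrightarrow>
    K_functional X Y t (f + g) \<le> D * (K_functional X Y t f + K_functional X Y t g)"
    using K_functional_triangle[OF X Y] by blast
  note zX = quasi_normed_zero[OF X] and zY = quasi_normed_zero[OF Y]
  note mX = quasi_normed_minus[OF X] and mY = quasi_normed_minus[OF Y]
  have XY: "x \<in> carr X + carr Y" if "x \<in> carr X" for x
    using set_plus_intro[OF that, of 0 "carr Y"] zY by simp
  have YX: "y \<in> carr X + carr Y" if "y \<in> carr Y" for y
    using set_plus_intro[OF _ that, of 0 "carr X"] zX by simp
  show ?thesis
  proof (rule that[of "3 * D"])
    show "3 * D < top" using D by (simp add: ennreal_mult_less_top)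
    fix f and t :: real assume f: "f \<in> carr X + carr Y" and t: "0 < t"
    let ?K = "\<lambda>u f. K_functional X Y (ennreal u) f"
    note qc = quasi_concaveD[OF quasi_concave_K[of X Y f]]
    have D2: "2 \<le> 3 * D" using D(1) mult_mono[of 2 3 1 D] by simp
    have D3: "D * (x + 2 * x) = 3 * D * x" for x :: ennreal
    proof -
      have "(3::ennreal) = 1 + 2" by simp
      then have "x + 2 * x = 3 * x" by (simp only: distrib_right mult_1_left)
      then show ?thesis by (simp only: ac_simps)
    qed
    \<comment> \<open>The factor \<open>2\<close> yields no strict inequality when \<open>K(t, f) = 0\<close>, hence the distinction.\<close>
    consider "?K t f = 0" | "?K t f > 0" by (auto simp: zero_less_iff_neq_zero)
    then show "\<exists>g h. g \<in> carr X + carr Y \<and> h \<in> carr X + carr Y \<and> f = g + h \<and>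
      (\<forall>u. 0 < u \<longrightarrow> u < t \<longrightarrow> ?K u g \<le> 3 * D * ?K u f) \<and>
      (\<forall>u>0. ?K u g \<le> 3 * D * ?K t f) \<and>
      (\<forall>u>t. ?K u h \<le> 3 * D * ?K u f) \<and>
      (\<forall>u>0. mon (- 1) u * ?K u h \<le> 3 * D * (mon (- 1) t * ?K t f))"
    proof cases
      case 1
      have z: "?K u f = 0" if u: "0 < u" for u
      proof (cases "u \<le> t")
        case True then show ?thesis using qc(1)[OF u True] 1 by simp
      next
        case False
        then have "mon (- 1) u * ?K u f \<le> mon (- 1) t * ?K t f" using t by (intro qc) auto
        then have "mon 1 u * (mon (- 1) u * ?K u f) \<le> 0" using 1 by simp
        then show ?thesis using mon_cancel(2)[OF u, of 1] by simp
      qed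
      have "?K u 0 = 0" for u using K_functional_le[of 0 X 0 Y "ennreal u"] zX zY by simp
      then show ?thesis using f z XY[of 0] zX by (intro exI[of _ f] exI[of _ 0]) auto
    next
      case 2
      obtain a b where "a \<in> carr X" "b \<in> carr Y" "f = a + b" using f by (elim set_plus_elim)
      then have "?K t f \<le> qnorm X a + ennreal t * qnorm Y b" using K_functional_le by blast
      also have "\<dots> < top" using \<open>a \<in> carr X\<close> \<open>b \<in> carr Y\<close> quasi_normed_finite[OF X] quasi_normed_finite[OF Y]
        by (simp add: ennreal_mult_less_top)
      finally have "?K t f < 2 * ?K t f" using 2 by (simp add: mult_2 ennreal_less_add)
      then obtain g h where gh: "g \<in> carr X" "h \<in> carr Y" "f = g + h" "qnorm X g + ennreal t * qnorm Y h < 2 * ?K t f"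
        by (rule K_functional_approx)
      have ng: "qnorm X g \<le> 2 * ?K t f"
        by (rule order_trans[OF _ less_imp_le[OF gh(4)]]) simp
      have "mon 1 t * qnorm Y h \<le> 2 * ?K t f"
        by (rule order_trans[OF _ less_imp_le[OF gh(4)]]) (use t in \<open>simp add: mon_1\<close>)
      then have "mon (- 1) t * (mon 1 t * qnorm Y h) \<le> mon (- 1) t * (2 * ?K t f)" by (rule mult_left_mono) simp
      then have "qnorm Y h \<le> mon (- 1) t * (2 * ?K t f)" using t by (simp add: mon_cancel)
      then have nh: "qnorm Y h \<le> 2 * (mon (- 1) t * ?K t f)" by (simp only: ac_simps)
      have Kg: "?K u x \<le> 2 * ?K t f" if "x = g \<or> x = - g" for x u
        using K_functional_le[of x X 0 Y "ennreal u"] that mX gh(1) zY ng by (auto intro: order_trans)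
      have Kh: "mon (- 1) u * ?K u x \<le> 2 * (mon (- 1) t * ?K t f)" if "x = h \<or> x = - h" "0 < u" for x u
      proof -
        have "?K u x \<le> mon 1 u * qnorm Y h"
          using K_functional_le[of 0 X x Y "ennreal u"] that mY gh(2) zX by (auto simp: mon_1)
        then have "mon (- 1) u * ?K u x \<le> mon (- 1) u * (mon 1 u * qnorm Y h)" by (rule mult_left_mono) simp
        then show ?thesis using nh that by (simp add: mon_cancel)
      qed
      have lo: "?K u g \<le> 3 * D * ?K u f" if u: "0 < u" "u < t" for u
      proof -
        have "mon 1 u * (mon (- 1) u * ?K u (- h)) \<le> mon 1 u * (2 * (mon (- 1) u * ?K u f))"
          by (rule mult_left_mono[OF order_trans[OF Kh]]) (use u qc(2)[of u t] in \<open>auto intro: mult_left_mono\<close>)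
        also have "\<dots> = 2 * (mon 1 u * (mon (- 1) u * ?K u f))" by (simp only: ac_simps)
        finally have "?K u (- h) \<le> 2 * ?K u f" using u by (simp only: mon_cancel)
        moreover have "?K u (f + - h) \<le> D * (?K u f + ?K u (- h))"
          by (rule D) (use f YX mY gh in auto)
        ultimately have "?K u (f + - h) \<le> D * (?K u f + 2 * ?K u f)"
          by (blast intro: order_trans mult_left_mono add_left_mono zero_le)
        then show ?thesis using gh(3) by (simp add: D3)
      qed
      have hi: "?K u h \<le> 3 * D * ?K u f" if u: "t < u" for u
      proof -
        have "?K u (- g) \<le> 2 * ?K t f" by (rule Kg) simp
        also have "\<dots> \<le> 2 * ?K u f" using u t by (intro mult_left_mono qc) auto
        finally have "?K u (- g) \<le> 2 * ?K u f" .
        moreover have "?K u (f + - g) \<le> D * (?K u f + ?K u (- g))"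
          by (rule D) (use f XY mX gh in auto)
        ultimately have "?K u (f + - g) \<le> D * (?K u f + 2 * ?K u f)"
          by (blast intro: order_trans mult_left_mono add_left_mono zero_le)
        then show ?thesis using gh(3) by (simp add: D3)
      qed
      have w: "2 * x \<le> 3 * D * x" for x by (rule mult_right_mono[OF D2]) simp
      show ?thesis using gh XY[OF gh(1)] YX[OF gh(2)] lo hi order_trans[OF Kg w] order_trans[OF Kh w] by blast
    qed
  qed
qed

section \<open>The interpolation formula\<close>

lemma wt_eq: "wt r b s = ennreal (s powr - rcp r) * ennreal (b s)"
  by (simp add: wt_def ennreal_mult')

lemma Lnorm_wt: "Lnorm r I (wt r b) = hnorm r I (\<lambda>s. ennreal (b s))"
  by (simp add: hnorm_def wt_eq[abs_def])

lemma iter_norm_wt: "iter_norm r b I q J (wt q a) = hnorm r I (\<lambda>s. ennreal (b s) * hnorm q (J s) (\<lambda>u. ennreal (a u)))"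
  by (simp add: iter_norm_def Lnorm_wt) (simp add: hnorm_def wt_eq mult.assoc)

text \<open>The exponent \<open>-\<theta> - 1/q\<close> splits into the density \<open>u\<^bsup>-1/q\<^esup>\<close> of \<open>du/u\<close> and the weight \<open>u\<^bsup>-\<theta>\<^esup>\<close>.\<close>

lemma iter_norm_K: "iter_norm r b I q J (K_weighted A0 A1 \<theta> q a f)
  = hnorm r I (\<lambda>s. ennreal (b s) * hnorm q (J s) (\<lambda>u. mon (- \<theta>) u * (ennreal (a u) * K_functional A0 A1 (ennreal u) f)))"
proof -
  have "K_weighted A0 A1 \<theta> q a f
    = (\<lambda>u. ennreal (u powr - rcp q) * (mon (- \<theta>) u * (ennreal (a u) * K_functional A0 A1 (ennreal u) f)))"
  proof
    fix u
    have "- \<theta> - rcp q = - rcp q + - \<theta>" by simp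
    then have "u powr (- \<theta> - rcp q) = u powr - rcp q * u powr - \<theta>" by (simp only: powr_add)
    then show "K_weighted A0 A1 \<theta> q a f u
      = ennreal (u powr - rcp q) * (mon (- \<theta>) u * (ennreal (a u) * K_functional A0 A1 (ennreal u) f))"
      by (simp add: K_weighted_def mon_def ennreal_mult' mult.assoc)
  qed
  then show ?thesis by (simp add: iter_norm_def hnorm_def wt_eq mult.assoc)
qed

theorem theorem37:
  fixes A0 A1 :: "'v::real_vector qspace"
    and q0 r0 q1 r1 :: ennreal
    and a0 b0 a1 b1 :: "real \<Rightarrow> real"
    and \<theta>0 :: real
  assumes "compatible_couple A0 A1"
    and "carr A0 \<inter> carr A1 \<noteq> {0}"
    and "0 < q1" "0 < r1"
    and "slowly_varying a1" "slowly_varying b1"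
    and "Lnorm r1 {1<..} (wt r1 b1) < top"
    and "iter_norm r1 b1 {0<..<1} q1 (\<lambda>s. {0<..<s}) (wt q1 a1) < top"
    and "0 < \<theta>0" "\<theta>0 < 1"
    and "0 < r0" "0 < q0"
    and "slowly_varying a0" "slowly_varying b0"
    and "Lnorm r0 {0<..<1} (wt r0 b0) < top"
    and "carr (R_space A0 A1 \<theta>0 r0 b0 q0 a0) \<noteq> {0}"
    and "carr (L_space A0 A1 1 r1 b1 q1 a1) \<noteq> {0}"
  shows "\<exists>C::real. C > 0 \<and>
    (\<forall>f \<in> carr (R_space A0 A1 \<theta>0 r0 b0 q0 a0) + carr (L_space A0 A1 1 r1 b1 q1 a1). \<forall>t>0.
       let \<rho> = rho \<theta>0 r0 b0 a0 r1 b1 q1 a1 t;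
           lhs = K_functional (R_space A0 A1 \<theta>0 r0 b0 q0 a0) (L_space A0 A1 1 r1 b1 q1 a1) \<rho> f;
           rhs = iter_norm r0 b0 {0<..<t} q0 (\<lambda>s. {s<..<t}) (K_weighted A0 A1 \<theta>0 q0 a0 f)
                 + \<rho> * iter_norm r1 b1 {t<..} q1 (\<lambda>s. {t<..<s}) (K_weighted A0 A1 1 q1 a1 f)
       in ennreal (1 / C) * rhs \<le> lhs \<and> lhs \<le> ennreal C * rhs)"
proof -
  interpret limiting_parameters \<theta>0 r0 q0 r1 q1 "\<lambda>t. ennreal (b0 t)" "\<lambda>t. ennreal (a0 t)" "\<lambda>t. ennreal (b1 t)" "\<lambda>t. ennreal (a1 t)"
    by unfold_locales (use assms slowly_varying_imp_slow in auto)
  have pos: "0 < ennreal (a0 t)" "0 < ennreal (b0 t)" "0 < ennreal (a1 t)" "0 < ennreal (b1 t)" if "0 < t" for t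
    using assms that by (auto simp: slowly_varying_def)
  have qn: "quasi_normed A0" "quasi_normed A1"
    using assms(1) by (auto simp: compatible_couple_def quasi_banach_def)
  let ?X = "R_space A0 A1 \<theta>0 r0 b0 q0 a0" and ?Y = "L_space A0 A1 1 r1 b1 q1 a1"
  let ?S = "carr A0 + carr A1"
  define k where "k f u = K_functional A0 A1 (ennreal u) f" for f u
  have qc: "quasi_concave (k f)" for f unfolding k_def by (rule quasi_concave_K)
  have integrand_R: "integrand_R (k f) = (\<lambda>u. mon (- \<theta>0) u * (ennreal (a0 u) * K_functional A0 A1 (ennreal u) f))"
    and integrand_L: "integrand_L (k f) = (\<lambda>u. mon (- 1) u * (ennreal (a1 u) * K_functional A0 A1 (ennreal u) f))" for f
    by (simp_all add: fun_eq_iff integrand_R_def integrand_L_def k_def)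
  have carrX: "carr ?X = {f \<in> ?S. norm_R (k f) < top}" and qX: "qnorm ?X f = norm_R (k f)" for f
    by (simp_all add: R_space_def R_norm_def iter_norm_K norm_R_def integrand_R)
  have carrY: "carr ?Y = {f \<in> ?S. norm_L (k f) < top}" and qY: "qnorm ?Y f = norm_L (k f)" for f
    by (simp_all add: L_space_def L_norm_def iter_norm_K norm_L_def integrand_L)
  have trunc_R: "iter_norm r0 b0 {0<..<t} q0 (\<lambda>s. {s<..<t}) (K_weighted A0 A1 \<theta>0 q0 a0 f) = trunc_R t (k f)"
    and trunc_L: "iter_norm r1 b1 {t<..} q1 (\<lambda>s. {t<..<s}) (K_weighted A0 A1 1 q1 a1 f) = trunc_L t (k f)" for t f
    by (simp_all add: iter_norm_K trunc_R_def trunc_L_def integrand_R integrand_L)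
  have "chi0 r0 b0 a0 t = Chi0 t" "chi1 r1 b1 q1 a1 t = Chi1 t" for t
    by (simp_all add: chi0_def chi1_def Lnorm_wt iter_norm_wt Chi0_def Chi1_def head_b0_def tail_b1_def head_a1_def head_b1a1_def)
  then have rho_eq: "rho \<theta>0 r0 b0 a0 r1 b1 q1 a1 t = mon (1 - \<theta>0) t * (Chi0 t / Chi1 t)" for t
    by (simp add: rho_def mon_def)
  have Chi1: "Chi1 t \<noteq> 0" "Chi1 t \<noteq> top" and Chi0: "Chi0 t \<noteq> 0" if "0 < t" for t
  proof -
    show "Chi1 t \<noteq> 0" by (rule Chi1_pos[OF pos(3,4) that])
    show "Chi0 t \<noteq> 0" by (rule Chi0_pos[OF pos(1,2) that])
    show "Chi1 t \<noteq> top"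
      by (rule Chi1_finite[OF pos(4) _ _ that])
        (use assms(7,8) in \<open>simp_all add: Lnorm_wt iter_norm_wt tail_b1_def head_b1a1_def head_a1_def\<close>)
  qed
  have rho_Chi1: "rho \<theta>0 r0 b0 a0 r1 b1 q1 a1 t * Chi1 t = mon (1 - \<theta>0) t * Chi0 t" if "0 < t" for t
    unfolding rho_eq using Chi1[OF that]
    by (metis ennreal_divide_times ennreal_mult_divide_eq mult.assoc mult_divide_eq_ennreal)
  have rho_pos: "rho \<theta>0 r0 b0 a0 r1 b1 q1 a1 t \<noteq> 0" if "0 < t" for t
    using rho_Chi1[OF that] Chi0[OF that] that by (auto simp: mon_def)

  obtain D where D: "1 \<le> D" "D < top" "\<And>t f g. t < top \<Longrightarrow> f \<in> ?S \<Longrightarrow> g \<in> ?S \<Longrightarrow>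
    K_functional A0 A1 t (f + g) \<le> D * (K_functional A0 A1 t f + K_functional A0 A1 t g)"
    using K_functional_triangle[OF qn] by blast
  obtain c where c: "c < top" "\<And>f t. f \<in> ?S \<Longrightarrow> 0 < t \<Longrightarrow>
    \<exists>g h. g \<in> ?S \<and> h \<in> ?S \<and> f = g + h \<and>
      (\<forall>u. 0 < u \<longrightarrow> u < t \<longrightarrow> k g u \<le> c * k f u) \<and> (\<forall>u>0. k g u \<le> c * k f t) \<and>
      (\<forall>u>t. k h u \<le> c * k f u) \<and> (\<forall>u>0. mon (- 1) u * k h u \<le> c * (mon (- 1) t * k f t))"
    using near_optimal_decomposition[OF qn] unfolding k_def by blast
  obtain C1 where C1: "C1 < top"
    "\<And>k k1 k2 c t \<rho>. quasi_concave k \<Longrightarrow> quasi_concave k1 \<Longrightarrow> quasi_concave k2 \<Longrightarrow> 0 < t \<Longrightarrow>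
      Chi1 t \<noteq> 0 \<Longrightarrow> Chi1 t \<noteq> top \<Longrightarrow> \<rho> * Chi1 t = mon (1 - \<theta>0) t * Chi0 t \<Longrightarrow>
      (\<And>u. 0 < u \<Longrightarrow> k u \<le> c * (k1 u + k2 u)) \<Longrightarrow>
      trunc_R t k + \<rho> * trunc_L t k \<le> C1 * c * (norm_R k1 + \<rho> * norm_L k2)"
    using truncated_norms_le by blast
  obtain C2 where C2: "C2 < top"
    "\<And>k k1 k2 c t \<rho>. quasi_concave k \<Longrightarrow> quasi_concave k1 \<Longrightarrow> quasi_concave k2 \<Longrightarrow> 0 < t \<Longrightarrow>
      \<rho> * Chi1 t = mon (1 - \<theta>0) t * Chi0 t \<Longrightarrow>
      (\<And>u. 0 < u \<Longrightarrow> u < t \<Longrightarrow> k1 u \<le> c * k u) \<Longrightarrow> (\<And>u. 0 < u \<Longrightarrow> k1 u \<le> c * k t) \<Longrightarrow>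
      (\<And>u. t < u \<Longrightarrow> k2 u \<le> c * k u) \<Longrightarrow> (\<And>u. 0 < u \<Longrightarrow> mon (- 1) u * k2 u \<le> c * (mon (- 1) t * k t)) \<Longrightarrow>
      norm_R k1 + \<rho> * norm_L k2 \<le> C2 * c * (trunc_R t k + \<rho> * trunc_L t k)"
    using norms_le_truncated by blast

  have "C1 * D < top" "C2 * c < top" using C1 C2 D c by (auto simp: ennreal_mult_less_top)
  then obtain x y where xy: "C1 * D = ennreal x" "0 \<le> x" "C2 * c = ennreal y" "0 \<le> y"
    by (metis ennreal_cases top.not_eq_extremum)
  \<comment> \<open>The summand \<open>1\<close> keeps \<open>C\<close> positive, since \<open>x\<close> and \<open>y\<close> may vanish.\<close>
  define C where "C = x + y + 1"
  have C: "0 < C" "C1 * D \<le> ennreal C" "C2 * c \<le> ennreal C" using xy by (auto simp: C_def intro: ennreal_leI)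
  show ?thesis
  proof (intro exI[of _ C] conjI C(1) ballI allI impI)
    fix f and t :: real assume f: "f \<in> carr ?X + carr ?Y" and t: "0 < t"
    define \<rho> where "\<rho> = rho \<theta>0 r0 b0 a0 r1 b1 q1 a1 t"
    define rhs where "rhs = trunc_R t (k f) + \<rho> * trunc_L t (k f)"
    note r = rho_Chi1[OF t, folded \<rho>_def]
    have lower: "ennreal (1 / C) * rhs \<le> K_functional ?X ?Y \<rho> f"
    proof (rule K_functional_greatest)
      fix g h assume gh: "g \<in> carr ?X" "h \<in> carr ?Y" "f = g + h"
      have "k f u \<le> D * (k g u + k h u)" if "0 < u" for u
        unfolding k_def gh(3) by (rule D) (use gh in \<open>auto simp: carrX carrY\<close>)
      then have "rhs \<le> C1 * D * (norm_R (k g) + \<rho> * norm_L (k h))"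
        unfolding rhs_def by (intro C1 qc t Chi1 r) auto
      also have "\<dots> \<le> ennreal C * (norm_R (k g) + \<rho> * norm_L (k h))" by (rule mult_right_mono[OF C(2)]) simp
      finally have "ennreal (1 / C) * rhs \<le> ennreal (1 / C) * (ennreal C * (norm_R (k g) + \<rho> * norm_L (k h)))"
        by (rule mult_left_mono) simp
      also have "\<dots> = qnorm ?X g + \<rho> * qnorm ?Y h"
        using C(1) by (simp add: qX qY flip: mult.assoc ennreal_mult')
      finally show "ennreal (1 / C) * rhs \<le> qnorm ?X g + \<rho> * qnorm ?Y h" .
    qed
    have upper: "K_functional ?X ?Y \<rho> f \<le> ennreal C * rhs"
    proof (cases "rhs = top")
      case True
      then show ?thesis using C(1) by (simp add: ennreal_mult_top)
    next
      case False
      have "f \<in> ?S"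
      proof -
        obtain g h where gh: "g \<in> ?S" "h \<in> ?S" "f = g + h"
          using f unfolding carrX carrY by (elim set_plus_elim) auto
        have "?S = {x + y |x y. x \<in> carr A0 \<and> y \<in> carr A1}" by (auto simp: set_plus_def)
        then have "subspace ?S" using subspace_sums[OF qn[THEN quasi_normed_subspace]] by simp
        then show ?thesis using gh subspace_add by blast
      qed
      from c(2)[OF this t] obtain g h where gh: "g \<in> ?S" "h \<in> ?S" "f = g + h"
        and le: "\<And>u. 0 < u \<Longrightarrow> u < t \<Longrightarrow> k g u \<le> c * k f u" "\<And>u. 0 < u \<Longrightarrow> k g u \<le> c * k f t"
          "\<And>u. t < u \<Longrightarrow> k h u \<le> c * k f u" "\<And>u. 0 < u \<Longrightarrow> mon (- 1) u * k h u \<le> c * (mon (- 1) t * k f t)"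
        by blast
      have "norm_R (k g) + \<rho> * norm_L (k h) \<le> C2 * c * rhs"
        unfolding rhs_def by (rule C2(2)[OF qc qc qc t r le])
      also have "\<dots> \<le> ennreal C * rhs" by (rule mult_right_mono[OF C(3)]) simp
      finally have *: "norm_R (k g) + \<rho> * norm_L (k h) \<le> ennreal C * rhs" .
      also have "\<dots> < top" using False by (simp add: ennreal_mult_less_top less_top)
      finally have "norm_R (k g) < top" "norm_L (k h) < top"
        \<comment> \<open>\<open>\<rho> \<noteq> 0\<close> is essential: otherwise \<open>\<rho> \<cdot> \<parallel>h\<parallel> < \<infinity>\<close> would say nothing about \<open>h\<close>.\<close>
        using rho_pos[OF t] by (auto simp: ennreal_mult_less_top \<rho>_def)
      then have "K_functional ?X ?Y \<rho> f \<le> norm_R (k g) + \<rho> * norm_L (k h)"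
        using K_functional_le[of g ?X h ?Y \<rho>] gh by (simp add: carrX carrY qX qY)
      then show ?thesis using * by (rule order_trans)
    qed
    show "let \<rho> = rho \<theta>0 r0 b0 a0 r1 b1 q1 a1 t;
           lhs = K_functional ?X ?Y \<rho> f;
           rhs = iter_norm r0 b0 {0<..<t} q0 (\<lambda>s. {s<..<t}) (K_weighted A0 A1 \<theta>0 q0 a0 f)
                 + \<rho> * iter_norm r1 b1 {t<..} q1 (\<lambda>s. {t<..<s}) (K_weighted A0 A1 1 q1 a1 f)
       in ennreal (1 / C) * rhs \<le> lhs \<and> lhs \<le> ennreal C * rhs"
      using lower upper unfolding Let_def trunc_R trunc_L rhs_def \<rho>_def by blast
  qed
qed

end
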